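(* Let $(X,* )$ be a spindle having a right unit $1_r$ ($x*1_r=x$ for all $x$) and a right projector $0_r$ ($x*0_r=0_r$ for all $x$). Let $a,c,d\in\mathbb Z$ and let $C_n(X)=\mathbb ZX^{n+1}$ ($n\ge0$) with boundary $\partial^{(a,c,d)}=a\,\partial^{( *_0)}+c\,\partial^{( * )}+d\,\partial^{( *_\sim)}$, where $x*_0y=x$ and $x*_\sim y=y$. (1) The chain complex $(C_n(X),\partial^{(a,c,d)})$ splits as a direct sum of three chain complexes: (i) $C_n(\{1_r\})$, the chain complex of the point $1_r$; (ii) the reduced early degenerate complex $F_0(X,\{1_r\})$; (iii) the reduced early normalized complex $C^{eN}_n(X,\{1_r\})$. (2) If $a+c+d\ne0$, then $H_n(\{1_r\})$ is $\mathbb Z$ for $n=0$, $0$ for $n>0$ even, and $\mathbb Z_{a+c+d}$ for $n$ odd. If $a+c+d=0$, then $H_n(\{1_r\})=\mathbb Z$ for all $n\ge0$. (3) If $X$ is finite and at least one of $a,c,d$ is different from $0$, then $H_n(F_0(X,\{1_r\}))$ is $\mathbb Z_{\gcd(a,c,d)}^{u_n-1}$ if $n$ is even and $\mathbb Z_{\gcd(a,c,d)}^{u_n}$ if $n$ is odd, where $u_n=|X|^n-|X|^{n-1}+\dots+(-1)^n$. (4) If $X$ is finite and $a$ or $c$ is different from $0$, then $H_n(C^{eN}(X,\{1_r\}))\cong\mathbb Z_{\gcd(a,c)}^{u_{n+1}-u_n+(-1)^n}$. (5) If $X$ is finite, $a$ or $c$ is different from $0$, and $a+c+d\ne0$, then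 $$H_n(X)\cong\begin{cases}\mathbb Z\oplus\mathbb Z_{\gcd(a,c)}^{|X|-1}& n=0,\\ \mathbb Z_{\gcd(a,c)}^{u_{n+1}-u_n+1}\oplus\mathbb Z_{\gcd(a,c,d)}^{u_n-1}& n>0\text{ even},\\ \mathbb Z_{a+c+d}\oplus\mathbb Z_{\gcd(a,c)}^{u_{n+1}-u_n-1}\oplus\mathbb Z_{\gcd(a,c,d)}^{u_n}& n\text{ odd}.\end{cases}$$
   Context: A spindle is a set with a binary operation $*$ satisfying $(x*y)*z=(x*z)*(y*z)$ and $x*x=x$. For a binary operation $*$ on $X$, $\partial_n^{( * )}:\mathbb ZX^{n+1}\to\mathbb ZX^n$ ($n\ge1$) is $\partial_n^{( * )}(x_0,\dots,x_n)=(x_1,\dots,x_n)+\sum_{i=1}^n(-1)^i(x_0*x_i,\dots,x_{i-1}*x_i,x_{i+1},\dots,x_n)$; complexes are not augmented ($C_n=0$ for $n<0$). $H_n(X)$ is the homology of $(C_n(X),\partial^{(a,c,d)})$. For $t\in X$, $C_n(\{t\})$ is the subcomplex spanned by $(t,\dots,t)\in X^{n+1}$, with homology $H_n(\{t\})$, and $C_n(X,\{t\})=C_n(X)/C_n(\{t\})$. Let $s_0(x_0,\dots,x_n)=(x_0,x_0,x_1,\dots,x_n)$ and $F^0_n=s_0C_{n-1}(X)$ ($F^0_0=0$), a subcomplex of $C_n(X)$. The reduced early degenerate complex $F_0(X,\{t\})$ is the image of $F^0$ in $C(X,\{t\})$, i.e. $F^0_n/C_n(\{t\})$ for $n\ge1$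 and $0$ for $n=0$. The reduced early normalized complex is $C_n^{eN}(X,\{t\})=C_n(X,\{t\})/F_0(X,\{t\})_n$. $\mathbb Z_m=\mathbb Z/m\mathbb Z$. *)

theory Defs
  imports "HOL-Algebra.Free_Abelian_Groups"
begin

section \<open>Chain complexes of abelian groups\<close>

text \<open>
  Complexes are concentrated in degrees \<open>n \<ge> 0\<close> and are not augmented: \<open>bdry C n\<close> is the
  map from \<open>grp C n\<close> to \<open>grp C (n - 1)\<close> for \<open>n \<ge> 1\<close>. Since the group in degree \<open>-1\<close> is \<open>0\<close>, every
  element of degree \<open>0\<close> is a cycle; the component \<open>bdry C 0\<close> carries no information and
  affects neither homology nor the notions of complex and isomorphism.
\<close>

record 'g cpx =
  grp :: "nat \<Rightarrow> 'g monoid"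
  bdry :: "nat \<Rightarrow> 'g \<Rightarrow> 'g"

definition chain_complex :: "'g cpx \<Rightarrow> bool" where
  "chain_complex C \<longleftrightarrow>
     (\<forall>n. comm_group (grp C n)) \<and>
     (\<forall>n\<ge>1. bdry C n \<in> hom (grp C n) (grp C (n - 1))) \<and>
     (\<forall>n\<ge>2. \<forall>x \<in> carrier (grp C n). bdry C (n - 1) (bdry C n x) = \<one>\<^bsub>grp C (n - 2)\<^esub>)"

definition cycles :: "'g cpx \<Rightarrow> nat \<Rightarrow> 'g set" where
  "cycles C n =
     (if n = 0 then carrier (grp C 0) else kernel (grp C n) (grp C (n - 1)) (bdry C n))"

definition boundaries :: "'g cpx \<Rightarrow> nat \<Rightarrow> 'g set" where
  "boundaries C n = bdry C (n + 1) ` carrier (grp C (n + 1))"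

definition homology :: "'g cpx \<Rightarrow> nat \<Rightarrow> 'g set monoid" where
  "homology C n = (grp C n)\<lparr>carrier := cycles C n\<rparr> Mod boundaries C n"

definition subcpx :: "'g cpx \<Rightarrow> (nat \<Rightarrow> 'g set) \<Rightarrow> 'g cpx" where
  "subcpx C S = \<lparr>grp = (\<lambda>n. (grp C n)\<lparr>carrier := S n\<rparr>), bdry = bdry C\<rparr>"

text \<open>
  The induced boundary sends the coset \<open>K = S\<^sub>n + x\<close> to \<open>S\<^sub>n\<^sub>-\<^sub>1 + \<partial>(K)\<close>, which is the coset
  \<open>S\<^sub>n\<^sub>-\<^sub>1 + \<partial>x\<close> because \<open>\<partial>(S\<^sub>n) \<subseteq> S\<^sub>n\<^sub>-\<^sub>1\<close>.
\<close>

definition quotcpx :: "'g cpx \<Rightarrow> (nat \<Rightarrow> 'g set) \<Rightarrow> 'g set cpx" where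
  "quotcpx C S =
     \<lparr>grp = (\<lambda>n. grp C n Mod S n),
      bdry = (\<lambda>n K. S (n - 1) <#>\<^bsub>grp C (n - 1)\<^esub> (bdry C n ` K))\<rparr>"

definition dsumcpx :: "'g cpx \<Rightarrow> 'h cpx \<Rightarrow> ('g \<times> 'h) cpx" where
  "dsumcpx C D =
     \<lparr>grp = (\<lambda>n. grp C n \<times>\<times> grp D n), bdry = (\<lambda>n. map_prod (bdry C n) (bdry D n))\<rparr>"

definition isomorphic_cpx :: "'g cpx \<Rightarrow> 'h cpx \<Rightarrow> bool" where
  "isomorphic_cpx C D \<longleftrightarrow>
     (\<exists>f. (\<forall>n. f n \<in> iso (grp C n) (grp D n)) \<and>
          (\<forall>n\<ge>1. \<forall>x \<in> carrier (grp C n). f (n - 1) (bdry C n x) = bdry D n (f n x)))"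


section \<open>Spindles\<close>

definition spindle :: "'a set \<Rightarrow> ('a \<Rightarrow> 'a \<Rightarrow> 'a) \<Rightarrow> bool" where
  "spindle X star \<longleftrightarrow>
     (\<forall>x\<in>X. \<forall>y\<in>X. star x y \<in> X) \<and>
     (\<forall>x\<in>X. \<forall>y\<in>X. \<forall>z\<in>X. star (star x y) z = star (star x z) (star y z)) \<and>
     (\<forall>x\<in>X. star x x = x)"

definition right_unit :: "'a set \<Rightarrow> ('a \<Rightarrow> 'a \<Rightarrow> 'a) \<Rightarrow> 'a \<Rightarrow> bool" where
  "right_unit X star e \<longleftrightarrow> e \<in> X \<and> (\<forall>x\<in>X. star x e = x)"

definition right_projector :: "'a set \<Rightarrow> ('a \<Rightarrow> 'a \<Rightarrow> 'a) \<Rightarrow> 'a \<Rightarrow> bool" where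
  "right_projector X star z \<longleftrightarrow> z \<in> X \<and> (\<forall>x\<in>X. star x z = z)"


section \<open>The complexes of a spindle\<close>

text \<open>A tuple \<open>(x\<^sub>0, \<dots>, x\<^sub>n) \<in> X\<^sup>n\<^sup>+\<^sup>1\<close> is a list of length \<open>n + 1\<close>.\<close>

definition tuples :: "'a set \<Rightarrow> nat \<Rightarrow> 'a list set" where
  "tuples X n = {xs. length xs = n + 1 \<and> set xs \<subseteq> X}"

definition chains :: "'a set \<Rightarrow> nat \<Rightarrow> ('a list \<Rightarrow>\<^sub>0 int) monoid" where
  "chains X n = free_Abelian_group (tuples X n)"

definition spindle_face :: "('a \<Rightarrow> 'a \<Rightarrow> 'a) \<Rightarrow> nat \<Rightarrow> 'a list \<Rightarrow> 'a list" where
  "spindle_face star i xs = map (\<lambda>x. star x (xs ! i)) (take i xs) @ drop (i + 1) xs"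

definition op_boundary ::
    "('a \<Rightarrow> 'a \<Rightarrow> 'a) \<Rightarrow> nat \<Rightarrow> ('a list \<Rightarrow>\<^sub>0 int) \<Rightarrow> ('a list \<Rightarrow>\<^sub>0 int)" where
  "op_boundary star n =
     (if n = 0 then (\<lambda>_. 0)
      else frag_extend
        (\<lambda>xs. frag_of (tl xs) + (\<Sum>i = 1..n. frag_cmul ((-1) ^ i) (frag_of (spindle_face star i xs)))))"

definition acd_boundary ::
    "('a \<Rightarrow> 'a \<Rightarrow> 'a) \<Rightarrow> int \<Rightarrow> int \<Rightarrow> int \<Rightarrow> nat \<Rightarrow> ('a list \<Rightarrow>\<^sub>0 int) \<Rightarrow> ('a list \<Rightarrow>\<^sub>0 int)" where
  "acd_boundary star a c d n w =
     frag_cmul a (op_boundary (\<lambda>x y. x) n w) +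
     frag_cmul c (op_boundary star n w) +
     frag_cmul d (op_boundary (\<lambda>x y. y) n w)"

definition spindle_cpx ::
    "'a set \<Rightarrow> ('a \<Rightarrow> 'a \<Rightarrow> 'a) \<Rightarrow> int \<Rightarrow> int \<Rightarrow> int \<Rightarrow> ('a list \<Rightarrow>\<^sub>0 int) cpx" where
  "spindle_cpx X star a c d = \<lparr>grp = chains X, bdry = acd_boundary star a c d\<rparr>"

definition point_chains :: "'a \<Rightarrow> nat \<Rightarrow> ('a list \<Rightarrow>\<^sub>0 int) set" where
  "point_chains t n = carrier (chains {t} n)"

definition point_cpx ::
    "'a set \<Rightarrow> ('a \<Rightarrow> 'a \<Rightarrow> 'a) \<Rightarrow> int \<Rightarrow> int \<Rightarrow> int \<Rightarrow> 'a \<Rightarrow> ('a list \<Rightarrow>\<^sub>0 int) cpx" where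
  "point_cpx X star a c d t = subcpx (spindle_cpx X star a c d) (point_chains t)"

definition reduced_cpx ::
    "'a set \<Rightarrow> ('a \<Rightarrow> 'a \<Rightarrow> 'a) \<Rightarrow> int \<Rightarrow> int \<Rightarrow> int \<Rightarrow> 'a \<Rightarrow> ('a list \<Rightarrow>\<^sub>0 int) set cpx" where
  "reduced_cpx X star a c d t = quotcpx (spindle_cpx X star a c d) (point_chains t)"

definition s0 :: "('a list \<Rightarrow>\<^sub>0 int) \<Rightarrow> ('a list \<Rightarrow>\<^sub>0 int)" where
  "s0 = frag_extend (\<lambda>xs. frag_of (hd xs # xs))"

definition F0_chains :: "'a set \<Rightarrow> nat \<Rightarrow> ('a list \<Rightarrow>\<^sub>0 int) set" where
  "F0_chains X n = (if n = 0 then {0} else s0 ` carrier (chains X (n - 1)))"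

definition F0_red_chains :: "'a set \<Rightarrow> 'a \<Rightarrow> nat \<Rightarrow> ('a list \<Rightarrow>\<^sub>0 int) set set" where
  "F0_red_chains X t n = (\<lambda>x. point_chains t n #>\<^bsub>chains X n\<^esub> x) ` F0_chains X n"

definition F0_red_cpx ::
    "'a set \<Rightarrow> ('a \<Rightarrow> 'a \<Rightarrow> 'a) \<Rightarrow> int \<Rightarrow> int \<Rightarrow> int \<Rightarrow> 'a \<Rightarrow> ('a list \<Rightarrow>\<^sub>0 int) set cpx" where
  "F0_red_cpx X star a c d t = subcpx (reduced_cpx X star a c d t) (F0_red_chains X t)"

definition eN_red_cpx ::
    "'a set \<Rightarrow> ('a \<Rightarrow> 'a \<Rightarrow> 'a) \<Rightarrow> int \<Rightarrow> int \<Rightarrow> int \<Rightarrow> 'a \<Rightarrow> ('a list \<Rightarrow>\<^sub>0 int) set set cpx" where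
  "eN_red_cpx X star a c d t = quotcpx (reduced_cpx X star a c d t) (F0_red_chains X t)"


section \<open>The groups and exponents describing the homology\<close>

text \<open>
  \<open>cyclic_power m k\<close> is the direct sum of \<open>k\<close> copies of \<open>\<int>/m\<int>\<close>. It takes
  integer arguments; the sign of \<open>m\<close> is immaterial, and the exponents it is used
  with are non-negative by the two lemmas at the end, so the conversion of \<open>k\<close> never truncates.
\<close>

definition cyclic :: "int \<Rightarrow> int monoid" where
  "cyclic m = integer_mod_group (nat \<bar>m\<bar>)"

definition cyclic_power :: "int \<Rightarrow> int \<Rightarrow> (nat \<Rightarrow> int) monoid" where
  "cyclic_power m k = product_group {..<nat k} (\<lambda>_. cyclic m)"

definition u_seq :: "'a set \<Rightarrow> nat \<Rightarrow> int" where
  "u_seq X n = (\<Sum>i\<le>n. (-1) ^ (n - i) * int (card X) ^ i)"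

lemma u_seq_Suc: "u_seq X (Suc n) = int (card X) ^ Suc n - u_seq X n"
  by (simp add: u_seq_def Suc_diff_le sum_negf)

lemma u_seq_closed_form: "(int (card X) + 1) * u_seq X n = int (card X) ^ (n + 1) + (-1) ^ n"
proof (induction n)
  case 0
  then show ?case by (simp add: u_seq_def)
next
  case (Suc n)
  have "(int (card X) + 1) * u_seq X (Suc n)
      = (int (card X) + 1) * int (card X) ^ Suc n - (int (card X) + 1) * u_seq X n"
    by (simp add: u_seq_Suc right_diff_distrib)
  with Suc show ?case by (simp add: algebra_simps)
qed

lemma u_seq_nonneg:
  assumes "finite X" "X \<noteq> {}"
  shows "u_seq X n \<ge> (if even n then 1 else 0)"
proof -
  define q where "q = int (card X)"
  have q: "q \<ge> 1"
    using assms by (simp add: q_def Suc_le_eq card_gt_0_iff)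
  have v: "(q + 1) * u_seq X n = q ^ (n + 1) + (-1) ^ n"
    using u_seq_closed_form[of X n] by (simp add: q_def)
  have p: "q ^ (n + 1) \<ge> q"
    using q by (simp add: one_le_power)
  show ?thesis
  proof (cases "even n")
    case True
    then have "(q + 1) * 1 \<le> (q + 1) * u_seq X n"
      using p v by simp
    then show ?thesis
      using q True by (simp only: mult_le_cancel_left) simp
  next
    case False
    then have "(q + 1) * 0 \<le> (q + 1) * u_seq X n"
      using p q v by simp
    then show ?thesis
      using q False by (simp only: mult_le_cancel_left) simp
  qed
qed

lemma u_seq_diff_nonneg:
  assumes "finite X" "X \<noteq> {}"
  shows "u_seq X (n + 1) - u_seq X n + (-1) ^ n \<ge> 0"
proof -
  define q where "q = int (card X)"
  have q: "q \<ge> 1"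
    using assms by (simp add: q_def Suc_le_eq card_gt_0_iff)
  have v: "(q + 1) * u_seq X n = q ^ (n + 1) + (-1) ^ n"
    using u_seq_closed_form[of X n] by (simp add: q_def)
  have "(q + 1) * (u_seq X (n + 1) - u_seq X n + (-1) ^ n)
      = (q + 1) * q ^ (n + 1) - 2 * ((q + 1) * u_seq X n) + (q + 1) * (-1) ^ n"
    by (simp add: u_seq_Suc q_def algebra_simps)
  also have "\<dots> = (q - 1) * (q ^ (n + 1) + (-1) ^ n)"
    unfolding v by (simp add: algebra_simps)
  also have "\<dots> \<ge> 0"
    using q one_le_power[OF q, of "n + 1"]
    by (intro mult_nonneg_nonneg) (cases "even n"; simp)+
  finally show ?thesis
    using q by (simp add: zero_le_mult_iff)
qed

end

(*
  Besides the constant map to 1_r, the map q = s_0 d_0, (x_0,...,x_n) |-> (x_1,x_1,x_2,...,x_n),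
  (zero in degree 0) is a chain projection, with image F^0. The two projections split C(X) into three
  subcomplexes, isomorphic to the three complexes of (1).

  Appending an entry y is, up to sign, a homotopy from 0 to a x + c (x * y) + d (y,...,y). On the
  part where the constant map vanishes this is (a+c) x for y = 1_r and a x for y = 0_r; on F^0
  moreover s_0 is a null-homotopy of a+c+d. So multiplication by g is null-homotopic, with
  g = gcd(a,c,d) on the degenerate part and g = gcd(a,c) on the normalized part, where the d-part of
  the boundary vanishes. As the boundary is also divisible by g, the boundaries are exactly g Z_n
  for Z_n the free group of cycles, hence H_n = Z_n / g Z_n, and the ranks b_n of Z_n satisfy
  b_n + b_(n-1) = rank C_n.
*)

theory Submission
  imports Defs Complex_Main
begin

text \<open>Words are built up by their last letter. With a boundary defined on words of every
  length, the empty word included, one rule suffices: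
  \<open>bd (w y) = (bd w) y + (-1)^k M_y w\<close> for \<open>w\<close> of length \<open>k\<close>,
  where \<open>M_y\<close> gives the last face. As \<open>M_y\<close> is a combination of entrywise
  endomorphisms of the spindle, it commutes with the boundary, and most identities between boundary,
  projections and homotopies become inductions on appended letters. Elements of the reduced
  complexes are sets, or sets of sets, of chains. The computations are therefore made in subgroups
  of one free abelian group; cosets enter only through isomorphisms with complementary subcomplexes.
  The multiples \<open>c\<close> and \<open>d\<close> are reached as the differences
  \<open>(a + c) - a\<close> and \<open>(a + c + d) - (a + c)\<close>; null-homotopic multiples are
  closed under integer combinations, so Bezout gives the gcd. Ranks need no extension of scalars: on
  cycles a homotopy for \<open>g\<close> is a section of the boundary divided by \<open>g\<close>,
  which splits \<open>C_(n+1)\<close> into \<open>Z_(n+1)\<close> and a copy of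
  \<open>Z_n\<close>.\<close>

lemma FactGroup_iso_via_hom:
  assumes "group G" "group H" "h \<in> hom G H" "h ` carrier G = carrier H" "kernel G H h = N"
  shows "G Mod N \<cong> H"
proof -
  interpret group_hom G H h
    using assms by (simp add: group_hom_def group_hom_axioms_def)
  show ?thesis
    using FactGroup_iso_set[OF assms(4)] assms(5) by (auto simp: is_iso_def)
qed

lemma comm_group_subgroup:
  assumes "comm_group G" "subgroup H G"
  shows "comm_group (G\<lparr>carrier := H\<rparr>)"
proof -
  interpret comm_group G by fact
  have "group (G\<lparr>carrier := H\<rparr>)"
    using assms(2) by (rule subgroup_imp_group)
  then show ?thesis
    by (rule group.group_comm_groupI) (use assms(2) in \<open>auto intro: m_comm subgroup.mem_carrier\<close>)
qed

subsection \<open>Subcomplexes and isomorphisms of complexes\<close>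

definition subcomplex :: "'g cpx \<Rightarrow> (nat \<Rightarrow> 'g set) \<Rightarrow> bool" where
  "subcomplex C S \<longleftrightarrow>
     (\<forall>n. subgroup (S n) (grp C n)) \<and> (\<forall>n\<ge>1. \<forall>x\<in>S n. bdry C n x \<in> S (n - 1))"

definition complementary :: "'g cpx \<Rightarrow> (nat \<Rightarrow> 'g set) \<Rightarrow> (nat \<Rightarrow> 'g set) \<Rightarrow> bool" where
  "complementary C S K \<longleftrightarrow>
     (\<forall>n. S n \<inter> K n \<subseteq> {\<one>\<^bsub>grp C n\<^esub>} \<and>
          (\<forall>x\<in>carrier (grp C n). \<exists>s\<in>S n. \<exists>k\<in>K n. x = s \<otimes>\<^bsub>grp C n\<^esub> k))"

definition cpx_iso :: "(nat \<Rightarrow> 'g \<Rightarrow> 'h) \<Rightarrow> 'g cpx \<Rightarrow> 'h cpx \<Rightarrow> bool" where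
  "cpx_iso f C D \<longleftrightarrow>
     (\<forall>n. f n \<in> iso (grp C n) (grp D n)) \<and>
     (\<forall>n\<ge>1. \<forall>x\<in>carrier (grp C n). f (n - 1) (bdry C n x) = bdry D n (f n x))"

lemma isomorphic_cpx_iff: "isomorphic_cpx C D \<longleftrightarrow> (\<exists>f. cpx_iso f C D)"
  by (simp add: isomorphic_cpx_def cpx_iso_def)

lemma chain_complexD:
  assumes "chain_complex C"
  shows "comm_group (grp C n)" "group (grp C n)"
    and "n \<ge> 1 \<Longrightarrow> bdry C n \<in> hom (grp C n) (grp C (n - 1))"
    and "n \<ge> 1 \<Longrightarrow> x \<in> carrier (grp C n) \<Longrightarrow> bdry C n x \<in> carrier (grp C (n - 1))"
    and "n \<ge> 1 \<Longrightarrow> x \<in> carrier (grp C n) \<Longrightarrow> y \<in> carrier (grp C n) \<Longrightarrow>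
           bdry C n (x \<otimes>\<^bsub>grp C n\<^esub> y) = bdry C n x \<otimes>\<^bsub>grp C (n - 1)\<^esub> bdry C n y"
    and "n \<ge> 1 \<Longrightarrow> bdry C n \<one>\<^bsub>grp C n\<^esub> = \<one>\<^bsub>grp C (n - 1)\<^esub>"
    and "n \<ge> 2 \<Longrightarrow> x \<in> carrier (grp C n) \<Longrightarrow> bdry C (n - 1) (bdry C n x) = \<one>\<^bsub>grp C (n - 2)\<^esub>"
proof -
  show *: "comm_group (grp C n)" for n
    using assms by (auto simp: chain_complex_def)
  then show g: "group (grp C n)" for n
    by (simp add: comm_group.axioms)
  show h: "bdry C n \<in> hom (grp C n) (grp C (n - 1))" if "n \<ge> 1" for n
    using assms that by (auto simp: chain_complex_def)
  show "bdry C n \<one>\<^bsub>grp C n\<^esub> = \<one>\<^bsub>grp C (n - 1)\<^esub>" if "n \<ge> 1"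
    using hom_one[OF h[OF that] g g] .
qed (use assms in \<open>auto simp: chain_complex_def hom_def\<close>)

lemma subcomplexD:
  assumes "subcomplex C S"
  shows "subgroup (S n) (grp C n)" "n \<ge> 1 \<Longrightarrow> x \<in> S n \<Longrightarrow> bdry C n x \<in> S (n - 1)"
    "x \<in> S n \<Longrightarrow> x \<in> carrier (grp C n)"
    "\<one>\<^bsub>grp C n\<^esub> \<in> S n"
  using assms by (auto simp: subcomplex_def subgroup.one_closed intro: subgroup.mem_carrier)

lemma chain_complex_subcpx:
  assumes "chain_complex C" "subcomplex C S"
  shows "chain_complex (subcpx C S)"
  unfolding chain_complex_def
proof (intro conjI allI impI ballI)
  fix n
  show "comm_group (grp (subcpx C S) n)"
    using comm_group_subgroup[OF chain_complexD(1)[OF assms(1)] subcomplexD(1)[OF assms(2)]]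
    by (simp add: subcpx_def)
  show "bdry (subcpx C S) n \<in> hom (grp (subcpx C S) n) (grp (subcpx C S) (n - 1))" if "1 \<le> n"
    using that chain_complexD(5)[OF assms(1)] subcomplexD(2,3)[OF assms(2)]
    by (auto simp: subcpx_def hom_def)
  show "bdry (subcpx C S) (n - 1) (bdry (subcpx C S) n x) = \<one>\<^bsub>grp (subcpx C S) (n - 2)\<^esub>"
    if "2 \<le> n" "x \<in> carrier (grp (subcpx C S) n)" for x
    using that chain_complexD(7)[OF assms(1)] subcomplexD(3)[OF assms(2)] by (auto simp: subcpx_def)
qed

lemma cpx_iso_sym:
  assumes "chain_complex C" "cpx_iso f C D"
  shows "cpx_iso (\<lambda>n. inv_into (carrier (grp C n)) (f n)) D C"
  unfolding cpx_iso_def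
proof (intro conjI allI impI ballI)
  fix n
  have iso: "f n \<in> iso (grp C n) (grp D n)" for n
    using assms(2) by (simp add: cpx_iso_def)
  show "inv_into (carrier (grp C n)) (f n) \<in> iso (grp D n) (grp C n)"
    using group.iso_set_sym[OF chain_complexD(2)[OF assms(1)] iso] .
  fix y assume n: "1 \<le> n" and y: "y \<in> carrier (grp D n)"
  obtain x where x: "x \<in> carrier (grp C n)" "y = f n x"
    using y iso[of n] by (auto simp: iso_iff)
  have "bdry D n y = f (n - 1) (bdry C n x)"
    using assms(2) n x by (simp add: cpx_iso_def)
  moreover have "inj_on (f n) (carrier (grp C n))" for n
    using iso[of n] by (simp add: iso_iff)
  ultimately show "inv_into (carrier (grp C (n - 1))) (f (n - 1)) (bdry D n y) =
      bdry C n (inv_into (carrier (grp C n)) (f n) y)"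
    using x chain_complexD(4)[OF assms(1) n x(1)] by simp
qed

lemma isomorphic_cpx_sym:
  assumes "chain_complex C" "isomorphic_cpx C D"
  shows "isomorphic_cpx D C"
  using assms cpx_iso_sym unfolding isomorphic_cpx_iff by blast

lemma cpx_iso_trans:
  assumes "cpx_iso f C D" "cpx_iso g D E"
  shows "cpx_iso (\<lambda>n. g n \<circ> f n) C E"
  unfolding cpx_iso_def
proof (intro conjI allI impI ballI)
  have f: "f n \<in> iso (grp C n) (grp D n)" and g: "g n \<in> iso (grp D n) (grp E n)" for n
    using assms by (simp_all add: cpx_iso_def)
  show "g n \<circ> f n \<in> iso (grp C n) (grp E n)" for n
    using iso_set_trans[OF f g] .
  fix n x assume n: "1 \<le> n" and x: "x \<in> carrier (grp C n)"
  then have "f n x \<in> carrier (grp D n)"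
    using f by (auto simp: iso_iff)
  then show "(g (n - 1) \<circ> f (n - 1)) (bdry C n x) = bdry E n ((g n \<circ> f n) x)"
    using n x assms by (simp add: cpx_iso_def)
qed

lemma isomorphic_cpx_trans:
  assumes "isomorphic_cpx C D" "isomorphic_cpx D E"
  shows "isomorphic_cpx C E"
  using assms cpx_iso_trans unfolding isomorphic_cpx_iff by blast

text \<open>Every element of \<open>D\<close> is some \<open>f n x\<close>, so all laws are
  transported from \<open>C\<close>. An isomorphism sees only carriers and products; that the
  \<open>one\<close> field of \<open>D\<close> really is a unit has to be assumed.\<close>

lemma chain_complex_iso:
  assumes C: "chain_complex C" and f: "cpx_iso f C D" and D: "\<And>n. monoid (grp D n)"
  shows "chain_complex D"
  unfolding chain_complex_def
proof (intro conjI allI impI ballI)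
  have iso: "f n \<in> iso (grp C n) (grp D n)" for n
    using f by (simp add: cpx_iso_def)
  then have hom: "f n \<in> hom (grp C n) (grp D n)"
    and surj: "\<And>y. y \<in> carrier (grp D n) \<Longrightarrow> \<exists>x\<in>carrier (grp C n). y = f n x" for n
    by (auto simp: iso_iff image_iff)
  have bd: "bdry D n (f n x) = f (n - 1) (bdry C n x)" if "n \<ge> 1" "x \<in> carrier (grp C n)" for n x
    using f that by (simp add: cpx_iso_def)
  show cg: "comm_group (grp D n)" for n
    using comm_group.iso_imp_comm_group[OF chain_complexD(1)[OF C] is_isoI[OF iso] D] .
  fix n
  show "bdry D n \<in> hom (grp D n) (grp D (n - 1))" if n: "1 \<le> n"
  proof (rule homI)
    fix x assume "x \<in> carrier (grp D n)"
    then obtain x' where x': "x' \<in> carrier (grp C n)" "x = f n x'"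
      using surj by blast
    then show "bdry D n x \<in> carrier (grp D (n - 1))"
      using bd[OF n] chain_complexD(4)[OF C n] hom_in_carrier[OF hom] by simp
    fix y assume "y \<in> carrier (grp D n)"
    then obtain y' where y': "y' \<in> carrier (grp C n)" "y = f n y'"
      using surj by blast
    have "x \<otimes>\<^bsub>grp D n\<^esub> y = f n (x' \<otimes>\<^bsub>grp C n\<^esub> y')"
      using x' y' hom_mult[OF hom] by simp
    moreover have "x' \<otimes>\<^bsub>grp C n\<^esub> y' \<in> carrier (grp C n)"
      using x' y' chain_complexD(2)[OF C, of n] by (simp add: group.subgroup_self subgroup.m_closed)
    ultimately show "bdry D n (x \<otimes>\<^bsub>grp D n\<^esub> y) = bdry D n x \<otimes>\<^bsub>grp D (n - 1)\<^esub> bdry D n y"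
      using x' y' bd[OF n] chain_complexD(4,5)[OF C n] hom_mult[OF hom] by metis
  qed
  show "bdry D (n - 1) (bdry D n y) = \<one>\<^bsub>grp D (n - 2)\<^esub>"
    if n: "2 \<le> n" and y: "y \<in> carrier (grp D n)" for y
  proof -
    obtain x where x: "x \<in> carrier (grp C n)" "y = f n x"
      using surj y by blast
    have "bdry D (n - 1) (bdry D n y) = f (n - 1 - 1) (bdry C (n - 1) (bdry C n x))"
      using x n bd chain_complexD(4)[OF C, of n x] by simp
    also have "\<dots> = f (n - 2) \<one>\<^bsub>grp C (n - 2)\<^esub>"
      using chain_complexD(7)[OF C n x(1)] by (simp add: numeral_2_eq_2)
    also have "\<dots> = \<one>\<^bsub>grp D (n - 2)\<^esub>"
      using hom_one[OF hom chain_complexD(2)[OF C]] cg comm_group.axioms by blast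
    finally show ?thesis .
  qed
qed

lemma subcpx_subcpx [simp]: "subcpx (subcpx C S) T = subcpx C T"
  by (simp add: subcpx_def)

lemma cpx_iso_restrict:
  assumes C: "chain_complex C" and D: "chain_complex D" and f: "cpx_iso f C D" and S: "subcomplex C S"
  shows "cpx_iso f (subcpx C S) (subcpx D (\<lambda>n. f n ` S n))"
    and "subcomplex D (\<lambda>n. f n ` S n)"
proof -
  have iso: "f n \<in> iso (grp C n) (grp D n)" for n
    using f by (simp add: cpx_iso_def)
  have bd: "bdry D n (f n x) = f (n - 1) (bdry C n x)" if "n \<ge> 1" "x \<in> S n" for n x
    using f that subcomplexD(3)[OF S] by (simp add: cpx_iso_def)
  have sub: "S n \<subseteq> carrier (grp C n)" for n
    using subcomplexD(3)[OF S] by blast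
  show "cpx_iso f (subcpx C S) (subcpx D (\<lambda>n. f n ` S n))"
    unfolding cpx_iso_def
  proof (intro conjI allI impI ballI)
    show "f n \<in> iso (grp (subcpx C S) n) (grp (subcpx D (\<lambda>n. f n ` S n)) n)" for n
      using iso[of n] sub[of n] by (auto simp: subcpx_def iso_iff hom_def subset_iff intro: inj_on_subset)
  qed (simp add: subcpx_def bd)
  show "subcomplex D (\<lambda>n. f n ` S n)"
    unfolding subcomplex_def
  proof (intro conjI allI impI ballI)
    fix n
    have "group_hom (grp C n) (grp D n) (f n)"
      using iso[of n] chain_complexD(2)[OF C] chain_complexD(2)[OF D]
      by (simp add: group_hom_def group_hom_axioms_def iso_iff)
    then show "subgroup (f n ` S n) (grp D n)"
      using subcomplexD(1)[OF S, of n] by (rule group_hom.subgroup_img_is_subgroup)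
  qed (use bd subcomplexD(2)[OF S] in auto)
qed

lemma complementary_image:
  assumes C: "chain_complex C" and f: "cpx_iso f C D"
    and S: "subcomplex C S" and K: "subcomplex C K" and SK: "complementary C S K"
    and D: "chain_complex D"
  shows "complementary D (\<lambda>n. f n ` S n) (\<lambda>n. f n ` K n)"
  unfolding complementary_def
proof (intro conjI allI ballI)
  fix n
  have iso: "f n \<in> iso (grp C n) (grp D n)"
    using f by (simp add: cpx_iso_def)
  have *: "f n ` S n \<inter> f n ` K n = f n ` (S n \<inter> K n)"
    using iso subcomplexD(3)[OF S] subcomplexD(3)[OF K]
    by (intro inj_on_image_Int[symmetric, of _ "carrier (grp C n)"]) (auto simp: iso_iff)
  have "f n \<one>\<^bsub>grp C n\<^esub> = \<one>\<^bsub>grp D n\<^esub>"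
    using iso hom_one[OF _ chain_complexD(2)[OF C] chain_complexD(2)[OF D]] by (auto simp: iso_iff)
  then show "f n ` S n \<inter> f n ` K n \<subseteq> {\<one>\<^bsub>grp D n\<^esub>}"
    unfolding * using SK by (auto simp: complementary_def)
  fix y assume "y \<in> carrier (grp D n)"
  then obtain x where x: "x \<in> carrier (grp C n)" "y = f n x"
    using iso by (auto simp: iso_iff)
  then obtain s k where "s \<in> S n" "k \<in> K n" "x = s \<otimes>\<^bsub>grp C n\<^esub> k"
    using SK unfolding complementary_def by blast
  then have "y = f n s \<otimes>\<^bsub>grp D n\<^esub> f n k"
    using x iso subcomplexD(3)[OF S] subcomplexD(3)[OF K] by (auto simp: iso_iff hom_mult)
  then show "\<exists>s\<in>f n ` S n. \<exists>k\<in>f n ` K n. y = s \<otimes>\<^bsub>grp D n\<^esub> k"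
    using \<open>s \<in> S n\<close> \<open>k \<in> K n\<close> by blast
qed

lemma complement_unique:
  fixes G (structure)
  assumes "group G" "subgroup S G" "subgroup K G" "S \<inter> K \<subseteq> {\<one>\<^bsub>G\<^esub>}"
    and "s \<in> S" "s' \<in> S" "k \<in> K" "k' \<in> K" "s \<otimes>\<^bsub>G\<^esub> k = s' \<otimes>\<^bsub>G\<^esub> k'"
  shows "s = s'" "k = k'"
proof -
  interpret group G by fact
  have c: "s \<in> carrier G" "s' \<in> carrier G" "k \<in> carrier G" "k' \<in> carrier G"
    using assms subgroup.mem_carrier by metis+
  have "inv s' \<otimes> s = k' \<otimes> inv k"
    using c assms(9) by (metis inv_closed inv_solve_left inv_solve_right m_assoc m_closed)
  moreover have "inv s' \<otimes> s \<in> S" "k' \<otimes> inv k \<in> K"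
    using assms by (simp_all add: subgroup.m_closed subgroup.m_inv_closed)
  ultimately have "inv s' \<otimes> s = \<one>" "k' \<otimes> inv k = \<one>"
    using assms(4) by auto
  then show "s = s'" "k = k'"
    using c by (metis inv_equality inv_inv inv_closed, metis inv_equality inv_inv inv_closed)
qed

text \<open>Each coset of \<open>S\<close> contains exactly one element of the complement
  \<open>K\<close>.\<close>

lemma coset_map_iso:
  fixes G (structure)
  assumes "comm_group G" "subgroup S G" "subgroup K G" "S \<inter> K \<subseteq> {\<one>\<^bsub>G\<^esub>}"
    and sum: "\<And>x. x \<in> carrier G \<Longrightarrow> \<exists>s\<in>S. \<exists>k\<in>K. x = s \<otimes>\<^bsub>G\<^esub> k"
  shows "(\<lambda>x. S #>\<^bsub>G\<^esub> x) \<in> iso (G\<lparr>carrier := K\<rparr>) (G Mod S)"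
proof -
  interpret comm_group G by fact
  interpret N: normal S G
    using subgroup_imp_normal[OF assms(2)] .
  have Kc: "k \<in> carrier G" if "k \<in> K" for k
    using subgroup.mem_carrier[OF assms(3) that] .
  have "inj_on (\<lambda>x. S #> x) K"
  proof (rule inj_onI)
    fix x y assume xy: "x \<in> K" "y \<in> K" "S #> x = S #> y"
    then have "x \<in> S #> y"
      using rcos_self[OF Kc assms(2), of x] by simp
    then obtain s where "s \<in> S" "x = s \<otimes> y"
      by (auto simp: r_coset_def)
    \<comment> \<open>Padding with the unit gives two decompositions of one element, to which
      uniqueness applies.\<close>
    then have "\<one> \<otimes> x = s \<otimes> y"
      using Kc xy by simp
    then show "x = y"
      using complement_unique(2)[OF group_axioms assms(2-4), of "\<one>" s x y] xy \<open>s \<in> S\<close>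
        subgroup.one_closed[OF assms(2)] by simp
  qed
  moreover have "(\<lambda>x. S #> x) ` K = carrier (G Mod S)"
  proof -
    have "S #> x \<in> (\<lambda>x. S #> x) ` K" if x: "x \<in> carrier G" for x
    proof -
      obtain s k where sk: "s \<in> S" "k \<in> K" "x = s \<otimes> k"
        using sum[OF x] by blast
      then have "S #> x = S #> k"
        using coset_mult_assoc[OF N.subset N.mem_carrier[OF sk(1)] Kc[OF sk(2)]]
          coset_join2[OF N.mem_carrier[OF sk(1)] assms(2) sk(1)] by simp
      then show ?thesis using sk by auto
    qed
    then show ?thesis
      using Kc by (auto simp: carrier_FactGroup)
  qed
  moreover have "(\<lambda>x. S #> x) \<in> hom (G\<lparr>carrier := K\<rparr>) (G Mod S)"
    using N.r_coset_hom_Mod Kc by (auto simp: hom_def)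
  ultimately show ?thesis
    by (simp add: iso_iff)
qed

text \<open>Compatibility with the boundary is an equality of cosets as sets. One inclusion holds
  because \<open>x\<close> lies in its own coset, the other because the boundary maps
  \<open>S n\<close> into \<open>S (n - 1)\<close>.\<close>

lemma cpx_iso_quotcpx:
  assumes C: "chain_complex C" and S: "subcomplex C S" and K: "subcomplex C K"
    and SK: "complementary C S K"
  shows "cpx_iso (\<lambda>n x. S n #>\<^bsub>grp C n\<^esub> x) (subcpx C K) (quotcpx C S)"
  unfolding cpx_iso_def
proof (intro conjI allI impI ballI)
  show "(\<lambda>x. S n #>\<^bsub>grp C n\<^esub> x) \<in> iso (grp (subcpx C K) n) (grp (quotcpx C S) n)" for n
    using coset_map_iso[OF chain_complexD(1)[OF C] subcomplexD(1)[OF S] subcomplexD(1)[OF K]] SK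
    by (simp add: subcpx_def quotcpx_def complementary_def)
  fix n x assume n: "1 \<le> n" and "x \<in> carrier (grp (subcpx C K) n)"
  then have x: "x \<in> carrier (grp C n)"
    using subcomplexD(3)[OF K] by (simp add: subcpx_def)
  interpret G: comm_group "grp C (n - 1)"
    using chain_complexD(1)[OF C] .
  have SG: "subgroup (S (n - 1)) (grp C (n - 1))"
    using subcomplexD(1)[OF S] .
  have bx: "bdry C n x \<in> carrier (grp C (n - 1))"
    using chain_complexD(4)[OF C n x] .
  have bs: "bdry C n (s \<otimes>\<^bsub>grp C n\<^esub> x) = bdry C n s \<otimes>\<^bsub>grp C (n - 1)\<^esub> bdry C n x" if "s \<in> S n" for s
    using chain_complexD(5)[OF C n] that x subcomplexD(3)[OF S] by blast
  have "x = \<one>\<^bsub>grp C n\<^esub> \<otimes>\<^bsub>grp C n\<^esub> x"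
    using x chain_complexD(2)[OF C, of n] by (simp add: group.is_monoid)
  then have xin: "x \<in> S n #>\<^bsub>grp C n\<^esub> x"
    using subcomplexD(4)[OF S, of n] unfolding r_coset_def by blast
  show "S (n - 1) #>\<^bsub>grp C (n - 1)\<^esub> bdry (subcpx C K) n x = bdry (quotcpx C S) n (S n #>\<^bsub>grp C n\<^esub> x)"
  proof
    show "S (n - 1) #>\<^bsub>grp C (n - 1)\<^esub> bdry (subcpx C K) n x \<subseteq> bdry (quotcpx C S) n (S n #>\<^bsub>grp C n\<^esub> x)"
    proof
      fix y assume "y \<in> S (n - 1) #>\<^bsub>grp C (n - 1)\<^esub> bdry (subcpx C K) n x"
      then obtain t where "t \<in> S (n - 1)" "y = t \<otimes>\<^bsub>grp C (n - 1)\<^esub> bdry C n x"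
        by (auto simp: subcpx_def r_coset_def)
      with imageI[OF xin, of "bdry C n"] show "y \<in> bdry (quotcpx C S) n (S n #>\<^bsub>grp C n\<^esub> x)"
        unfolding quotcpx_def set_mult_def cpx.simps by blast
    qed
    show "bdry (quotcpx C S) n (S n #>\<^bsub>grp C n\<^esub> x) \<subseteq> S (n - 1) #>\<^bsub>grp C (n - 1)\<^esub> bdry (subcpx C K) n x"
    proof
      fix y assume "y \<in> bdry (quotcpx C S) n (S n #>\<^bsub>grp C n\<^esub> x)"
      then obtain t s where ts: "t \<in> S (n - 1)" "s \<in> S n"
          "y = t \<otimes>\<^bsub>grp C (n - 1)\<^esub> bdry C n (s \<otimes>\<^bsub>grp C n\<^esub> x)"
        by (auto simp: quotcpx_def r_coset_def set_mult_def)
      have bss: "bdry C n s \<in> S (n - 1)"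
        using subcomplexD(2)[OF S n] ts by blast
      have "y = (t \<otimes>\<^bsub>grp C (n - 1)\<^esub> bdry C n s) \<otimes>\<^bsub>grp C (n - 1)\<^esub> bdry C n x"
        using ts bs bx bss subcomplexD(3)[OF S] by (metis G.m_assoc)
      then show "y \<in> S (n - 1) #>\<^bsub>grp C (n - 1)\<^esub> bdry (subcpx C K) n x"
        using ts(1) bss subgroup.m_closed[OF SG] by (auto simp: subcpx_def r_coset_def)
    qed
  qed
qed

text \<open>The laws of the induced boundary are inherited from the complement \<open>K\<close>, not
  checked on cosets.\<close>

lemma chain_complex_quotcpx:
  assumes C: "chain_complex C" and S: "subcomplex C S" and K: "subcomplex C K"
    and SK: "complementary C S K"
  shows "chain_complex (quotcpx C S)"
proof (rule chain_complex_iso[OF chain_complex_subcpx[OF C K] cpx_iso_quotcpx[OF C S K SK]])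
  fix n
  show "monoid (grp (quotcpx C S) n)"
    using comm_group.abelian_FactGroup[OF chain_complexD(1)[OF C] subcomplexD(1)[OF S], of n]
    by (simp add: quotcpx_def comm_group.axioms group.is_monoid)
qed

subsection \<open>Direct sums\<close>

lemma chain_complex_dsumcpx:
  assumes C: "chain_complex C" and D: "chain_complex D"
  shows "chain_complex (dsumcpx C D)"
  unfolding chain_complex_def
proof (intro conjI allI impI ballI)
  fix n
  interpret C: comm_group "grp C n" using chain_complexD(1)[OF C] .
  interpret D: comm_group "grp D n" using chain_complexD(1)[OF D] .
  have "group (grp C n \<times>\<times> grp D n)"
    by (rule DirProd_group) (rule C.group_axioms, rule D.group_axioms)
  then show "comm_group (grp (dsumcpx C D) n)"
    unfolding dsumcpx_def
    by (simp, intro group.group_comm_groupI) (auto simp: C.m_comm D.m_comm)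
  show "bdry (dsumcpx C D) n \<in> hom (grp (dsumcpx C D) n) (grp (dsumcpx C D) (n - 1))" if "1 \<le> n"
    using that chain_complexD(4,5)[OF C] chain_complexD(4,5)[OF D]
    by (auto simp: dsumcpx_def hom_def)
  show "bdry (dsumcpx C D) (n - 1) (bdry (dsumcpx C D) n x) = \<one>\<^bsub>grp (dsumcpx C D) (n - 2)\<^esub>"
    if "2 \<le> n" "x \<in> carrier (grp (dsumcpx C D) n)" for x
    using that chain_complexD(7)[OF C] chain_complexD(7)[OF D] by (auto simp: dsumcpx_def)
qed

lemma isomorphic_dsumcpx:
  assumes C: "chain_complex C" and D: "chain_complex D"
    and "isomorphic_cpx C C'" "isomorphic_cpx D D'"
  shows "isomorphic_cpx (dsumcpx C D) (dsumcpx C' D')"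
proof -
  obtain f g where f: "cpx_iso f C C'" and g: "cpx_iso g D D'"
    using assms unfolding isomorphic_cpx_iff by blast
  have "cpx_iso (\<lambda>n. map_prod (f n) (g n)) (dsumcpx C D) (dsumcpx C' D')"
    unfolding cpx_iso_def
  proof (intro conjI allI impI ballI)
    show "map_prod (f n) (g n) \<in> iso (grp (dsumcpx C D) n) (grp (dsumcpx C' D') n)" for n
      using f g
      by (simp add: cpx_iso_def dsumcpx_def map_prod_def
          iso_paired2[OF chain_complexD(2)[OF C] chain_complexD(2)[OF D]])
  qed (use f g in \<open>auto simp: cpx_iso_def dsumcpx_def\<close>)
  then show ?thesis
    unfolding isomorphic_cpx_iff by blast
qed

lemma isomorphic_cpx_refl: "isomorphic_cpx C C"
  unfolding isomorphic_cpx_def by (intro exI[of _ "\<lambda>n x. x"]) (simp add: iso_set_refl)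

text \<open>The natural map goes the other way, adding the two components; its inverse is the
  claimed isomorphism.\<close>

lemma isomorphic_dsumcpx_complementary:
  assumes C: "chain_complex C" and S: "subcomplex C S" and K: "subcomplex C K"
    and SK: "complementary C S K"
  shows "isomorphic_cpx C (dsumcpx (subcpx C S) (subcpx C K))"
proof -
  let ?D = "dsumcpx (subcpx C S) (subcpx C K)"
  have "cpx_iso (\<lambda>n (s, k). s \<otimes>\<^bsub>grp C n\<^esub> k) ?D C"
    unfolding cpx_iso_def
  proof (intro conjI allI impI ballI)
    fix n
    interpret G: comm_group "grp C n" using chain_complexD(1)[OF C] .
    note c = subcomplexD(3)[OF S, of _ n] subcomplexD(3)[OF K, of _ n]
    have "inj_on (\<lambda>(s, k). s \<otimes>\<^bsub>grp C n\<^esub> k) (S n \<times> K n)"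
    proof (rule inj_onI, clarify)
      fix s k s' k' assume "s \<in> S n" "k \<in> K n" "s' \<in> S n" "k' \<in> K n"
        "s \<otimes>\<^bsub>grp C n\<^esub> k = s' \<otimes>\<^bsub>grp C n\<^esub> k'"
      moreover have "S n \<inter> K n \<subseteq> {\<one>\<^bsub>grp C n\<^esub>}"
        using SK by (simp add: complementary_def)
      ultimately show "s = s' \<and> k = k'"
        using complement_unique[OF G.group_axioms subcomplexD(1)[OF S] subcomplexD(1)[OF K]] by metis
    qed
    moreover have "(\<lambda>(s, k). s \<otimes>\<^bsub>grp C n\<^esub> k) ` (S n \<times> K n) = carrier (grp C n)"
    proof -
      have "x \<in> (\<lambda>(s, k). s \<otimes>\<^bsub>grp C n\<^esub> k) ` (S n \<times> K n)" if "x \<in> carrier (grp C n)" for x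
      proof -
        have "\<exists>s\<in>S n. \<exists>k\<in>K n. x = s \<otimes>\<^bsub>grp C n\<^esub> k"
          using SK that by (simp add: complementary_def)
        then show ?thesis by force
      qed
      then show ?thesis using c by auto
    qed
    moreover have "(\<lambda>(s, k). s \<otimes>\<^bsub>grp C n\<^esub> k) \<in> hom (grp ?D n) (grp C n)"
      using c by (auto simp: dsumcpx_def subcpx_def hom_def G.m_ac)
    ultimately show "(\<lambda>(s, k). s \<otimes>\<^bsub>grp C n\<^esub> k) \<in> iso (grp ?D n) (grp C n)"
      by (simp add: iso_iff dsumcpx_def subcpx_def)
  qed (use chain_complexD(5)[OF C] subcomplexD(3)[OF S] subcomplexD(3)[OF K]
      in \<open>auto simp: dsumcpx_def subcpx_def\<close>)
  moreover have "chain_complex ?D"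
    using assms by (intro chain_complex_dsumcpx chain_complex_subcpx)
  ultimately show ?thesis
    using isomorphic_cpx_sym isomorphic_cpx_iff by metis
qed

subsection \<open>Homology\<close>

lemma cycles_subgroup:
  assumes C: "chain_complex C"
  shows "subgroup (cycles C n) (grp C n)"
proof (cases "n = 0")
  case True
  then show ?thesis
    using chain_complexD(2)[OF C] by (simp add: cycles_def group.subgroup_self)
next
  case False
  then have "group_hom (grp C n) (grp C (n - 1)) (bdry C n)"
    using chain_complexD[OF C] by (simp add: group_hom_def group_hom_axioms_def)
  then show ?thesis
    using False by (simp add: cycles_def group_hom.subgroup_kernel)
qed

lemma boundaries_subgroup:
  assumes C: "chain_complex C"
  shows "subgroup (boundaries C n) ((grp C n)\<lparr>carrier := cycles C n\<rparr>)"
proof -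
  have "group_hom (grp C (n + 1)) (grp C n) (bdry C (n + 1))"
    using chain_complexD(2)[OF C] chain_complexD(3)[OF C, of "n + 1"]
    by (simp add: group_hom_def group_hom_axioms_def)
  then have "subgroup (boundaries C n) (grp C n)"
    unfolding boundaries_def by (rule group_hom.img_is_subgroup)
  moreover have "boundaries C n \<subseteq> cycles C n"
    using chain_complexD(4,7)[OF C, of "n + 1"]
    by (auto simp: boundaries_def cycles_def kernel_def numeral_2_eq_2)
  ultimately show ?thesis
    using group.subgroup_incl[OF chain_complexD(2)[OF C]] cycles_subgroup[OF C] by blast
qed

lemma homology_comm_group:
  assumes C: "chain_complex C"
  shows "comm_group (homology C n)"
  unfolding homology_def
  using comm_group.abelian_FactGroup[OF comm_group_subgroup[OF chain_complexD(1)[OF C] cycles_subgroup[OF C]]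
      boundaries_subgroup[OF C]] .

lemma coset_in_homology:
  assumes C: "chain_complex C"
  shows "(\<lambda>x. boundaries C n #>\<^bsub>(grp C n)\<lparr>carrier := cycles C n\<rparr>\<^esub> x) \<in> hom ((grp C n)\<lparr>carrier := cycles C n\<rparr>) (homology C n)"
    and "(\<lambda>x. boundaries C n #>\<^bsub>(grp C n)\<lparr>carrier := cycles C n\<rparr>\<^esub> x) ` cycles C n = carrier (homology C n)"
    and "x \<in> cycles C n \<Longrightarrow>
      boundaries C n #>\<^bsub>(grp C n)\<lparr>carrier := cycles C n\<rparr>\<^esub> x = \<one>\<^bsub>homology C n\<^esub> \<longleftrightarrow> x \<in> boundaries C n"
proof -
  let ?Z = "(grp C n)\<lparr>carrier := cycles C n\<rparr>"
  interpret Z: comm_group ?Z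
    using comm_group_subgroup[OF chain_complexD(1)[OF C] cycles_subgroup[OF C]] .
  interpret N: normal "boundaries C n" ?Z
    using Z.subgroup_imp_normal[OF boundaries_subgroup[OF C]] .
  show "(\<lambda>x. boundaries C n #>\<^bsub>?Z\<^esub> x) \<in> hom ?Z (homology C n)"
    unfolding homology_def by (rule N.r_coset_hom_Mod)
  show "(\<lambda>x. boundaries C n #>\<^bsub>?Z\<^esub> x) ` cycles C n = carrier (homology C n)"
    by (simp add: homology_def carrier_FactGroup)
  show "boundaries C n #>\<^bsub>?Z\<^esub> x = \<one>\<^bsub>homology C n\<^esub> \<longleftrightarrow> x \<in> boundaries C n" if "x \<in> cycles C n"
    using Z.coset_join1[OF _ _ N.subgroup_axioms] Z.coset_join2[OF _ N.subgroup_axioms] that N.subset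
    by (auto simp: homology_def)
qed

text \<open>The first isomorphism theorem on cycles. It allows homology to be computed from a map on
  cycles, so that no map on classes has to be shown well defined.\<close>

lemma homology_iso_via_hom:
  assumes C: "chain_complex C" and H: "group H"
    and h: "h \<in> hom ((grp C n)\<lparr>carrier := cycles C n\<rparr>) H"
    and surj: "\<And>y. y \<in> carrier H \<Longrightarrow> \<exists>x\<in>cycles C n. h x = y"
    and ker: "\<And>x. x \<in> cycles C n \<Longrightarrow> h x = \<one>\<^bsub>H\<^esub> \<longleftrightarrow> x \<in> boundaries C n"
  shows "homology C n \<cong> H"
  unfolding homology_def
proof (rule FactGroup_iso_via_hom[OF _ H h])
  show "group ((grp C n)\<lparr>carrier := cycles C n\<rparr>)"
    using comm_group_subgroup[OF chain_complexD(1)[OF C] cycles_subgroup[OF C]] by (rule comm_group.axioms)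
  show "h ` carrier ((grp C n)\<lparr>carrier := cycles C n\<rparr>) = carrier H"
    using surj hom_in_carrier[OF h] by (force simp: image_iff)
  show "kernel ((grp C n)\<lparr>carrier := cycles C n\<rparr>) H h = boundaries C n"
    using ker subgroup.subset[OF boundaries_subgroup[OF C, of n]] by (auto simp: kernel_def)
qed

lemma homology_isomorphic:
  assumes C: "chain_complex C" and D: "chain_complex D" and "isomorphic_cpx C D"
  shows "homology C n \<cong> homology D n"
proof -
  obtain f where f: "cpx_iso f C D"
    using assms(3) unfolding isomorphic_cpx_iff by blast
  have iso: "f n \<in> iso (grp C n) (grp D n)" for n
    using f by (simp add: cpx_iso_def)
  then have inj: "inj_on (f n) (carrier (grp C n))" and car: "f n ` carrier (grp C n) = carrier (grp D n)"
      and hom: "f n \<in> hom (grp C n) (grp D n)" for n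
    by (auto simp: iso_iff)
  have one: "f n \<one>\<^bsub>grp C n\<^esub> = \<one>\<^bsub>grp D n\<^esub>" for n
    using hom_one[OF hom] chain_complexD(2)[OF C] chain_complexD(2)[OF D] .
  have one': "f n x = \<one>\<^bsub>grp D n\<^esub> \<longleftrightarrow> x = \<one>\<^bsub>grp C n\<^esub>" if "x \<in> carrier (grp C n)" for n x
    using inj_onD[OF inj _ that, of "\<one>\<^bsub>grp C n\<^esub>"] one chain_complexD(2)[OF C, of n]
    by (auto simp: group.is_monoid)
  have bd: "bdry D n (f n x) = f (n - 1) (bdry C n x)" if "n \<ge> 1" "x \<in> carrier (grp C n)" for n x
    using f that by (simp add: cpx_iso_def)
  have cyc: "f n x \<in> cycles D n \<longleftrightarrow> x \<in> cycles C n" if "x \<in> carrier (grp C n)" for x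
    using that bd[of n x] one'[of "bdry C n x" "n - 1"] chain_complexD(4)[OF C, of n x] hom_in_carrier[OF hom]
    by (auto simp: cycles_def kernel_def)
  have bnd: "f n x \<in> boundaries D n \<longleftrightarrow> x \<in> boundaries C n" if "x \<in> carrier (grp C n)" for x
  proof
    assume "f n x \<in> boundaries D n"
    then obtain y where y: "y \<in> carrier (grp C (n + 1))" "f n x = bdry D (n + 1) (f (n + 1) y)"
      unfolding boundaries_def car[symmetric] by blast
    then have "f n x = f n (bdry C (n + 1) y)"
      using bd[of "n + 1" y] by simp
    then have "x = bdry C (n + 1) y"
      using inj_onD[OF inj _ that] chain_complexD(4)[OF C, of "n + 1" y] y(1) by simp
    then show "x \<in> boundaries C n"
      using y by (auto simp: boundaries_def)
  next
    assume "x \<in> boundaries C n"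
    then obtain y where y: "y \<in> carrier (grp C (n + 1))" "x = bdry C (n + 1) y"
      unfolding boundaries_def by blast
    then have "f n x = bdry D (n + 1) (f (n + 1) y)"
      using bd[of "n + 1" y] by simp
    then show "f n x \<in> boundaries D n"
      using y(1) hom_in_carrier[OF hom] unfolding boundaries_def by blast
  qed
  have cc: "x \<in> carrier (grp C n)" if "x \<in> cycles C n" for x
    using subgroup.mem_carrier[OF cycles_subgroup[OF C] that] .
  let ?B = "\<lambda>x. boundaries D n #>\<^bsub>(grp D n)\<lparr>carrier := cycles D n\<rparr>\<^esub> x"
  show ?thesis
  proof (rule homology_iso_via_hom[OF C, where h = "\<lambda>x. ?B (f n x)"])
    show "group (homology D n)"
      using homology_comm_group[OF D] by (rule comm_group.axioms)
    have "f n \<in> hom ((grp C n)\<lparr>carrier := cycles C n\<rparr>) ((grp D n)\<lparr>carrier := cycles D n\<rparr>)"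
      using hom_mult[OF hom] cc cyc by (auto simp: hom_def)
    then show "(\<lambda>x. ?B (f n x)) \<in> hom ((grp C n)\<lparr>carrier := cycles C n\<rparr>) (homology D n)"
      using hom_compose[OF _ coset_in_homology(1)[OF D]] by (simp add: comp_def)
    fix y assume "y \<in> carrier (homology D n)"
    then obtain z where z: "z \<in> cycles D n" "y = ?B z"
      using coset_in_homology(2)[OF D, of n] by blast
    then obtain x where x: "x \<in> carrier (grp C n)" "z = f n x"
      using subgroup.mem_carrier[OF cycles_subgroup[OF D] z(1)] unfolding car[symmetric] by blast
    with z show "\<exists>x\<in>cycles C n. ?B (f n x) = y"
      using cyc by auto
  next
    fix x assume "x \<in> cycles C n"
    then show "?B (f n x) = \<one>\<^bsub>homology D n\<^esub> \<longleftrightarrow> x \<in> boundaries C n"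
      using coset_in_homology(3)[OF D] cyc bnd cc by simp
  qed
qed

lemma homology_dsumcpx:
  assumes C: "chain_complex C" and D: "chain_complex D"
  shows "homology (dsumcpx C D) n \<cong> homology C n \<times>\<times> homology D n"
proof -
  let ?B = "\<lambda>x. boundaries C n #>\<^bsub>(grp C n)\<lparr>carrier := cycles C n\<rparr>\<^esub> x"
  let ?B' = "\<lambda>x. boundaries D n #>\<^bsub>(grp D n)\<lparr>carrier := cycles D n\<rparr>\<^esub> x"
  have cyc: "cycles (dsumcpx C D) n = cycles C n \<times> cycles D n"
    by (auto simp: cycles_def dsumcpx_def kernel_def)
  have bnd: "boundaries (dsumcpx C D) n = boundaries C n \<times> boundaries D n"
    by (auto simp: boundaries_def dsumcpx_def)
  note b = coset_in_homology[OF C, where n = n] and b' = coset_in_homology[OF D, where n = n]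
  show ?thesis
  proof (rule homology_iso_via_hom[OF chain_complex_dsumcpx[OF C D], where h = "map_prod ?B ?B'"])
    show "group (homology C n \<times>\<times> homology D n)"
      using homology_comm_group[OF C] homology_comm_group[OF D]
      by (intro DirProd_group comm_group.axioms)
    show "map_prod ?B ?B' \<in> hom ((grp (dsumcpx C D) n)\<lparr>carrier := cycles (dsumcpx C D) n\<rparr>)
        (homology C n \<times>\<times> homology D n)"
      using b(1) b'(1) unfolding cyc by (auto simp: hom_def dsumcpx_def)
    fix y assume "y \<in> carrier (homology C n \<times>\<times> homology D n)"
    then show "\<exists>x\<in>cycles (dsumcpx C D) n. map_prod ?B ?B' x = y"
      unfolding cyc carrier_DirProd b(2)[symmetric] b'(2)[symmetric] by force
  next
    fix x assume "x \<in> cycles (dsumcpx C D) n"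
    then show "map_prod ?B ?B' x = \<one>\<^bsub>homology C n \<times>\<times> homology D n\<^esub> \<longleftrightarrow> x \<in> boundaries (dsumcpx C D) n"
      unfolding cyc bnd using b(3) b'(3) by (cases x) simp
  qed
qed

subsection \<open>Free abelian groups of finite rank\<close>

text \<open>The group \<open>Z^k\<close>, encoded by sequences supported below \<open>k\<close>.
  Then \<open>ivec k\<close> is literally contained in \<open>ivec (Suc k)\<close>, and a subgroup
  can pass from one to the other without changing its elements.\<close>

definition ivec :: "nat \<Rightarrow> (nat \<Rightarrow> int) monoid" where
  "ivec k = \<lparr>carrier = {f. \<forall>i\<ge>k. f i = 0}, monoid.mult = (\<lambda>f g i. f i + g i), one = (\<lambda>_. 0)\<rparr>"

lemma ivec_simps [simp]:
  "carrier (ivec k) = {f. \<forall>i\<ge>k. f i = 0}"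
  "f \<otimes>\<^bsub>ivec k\<^esub> g = (\<lambda>i. f i + g i)"
  "\<one>\<^bsub>ivec k\<^esub> = (\<lambda>_. 0)"
  by (simp_all add: ivec_def)

lemma comm_group_ivec: "comm_group (ivec k)"
proof (rule comm_groupI)
  fix f assume "f \<in> carrier (ivec k)"
  then show "\<exists>g\<in>carrier (ivec k). g \<otimes>\<^bsub>ivec k\<^esub> f = \<one>\<^bsub>ivec k\<^esub>"
    by (intro bexI[of _ "\<lambda>i. - f i"]) auto
qed (auto simp: algebra_simps)

lemma group_ivec: "group (ivec k)"
  using comm_group_ivec by (rule comm_group.axioms)

lemma inv_ivec: "f \<in> carrier (ivec k) \<Longrightarrow> inv\<^bsub>ivec k\<^esub> f = (\<lambda>i. - f i)"
  by (rule group.inv_equality[OF group_ivec]) auto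

lemma int_pow_ivec:
  assumes "f \<in> carrier (ivec k)"
  shows "f [^]\<^bsub>ivec k\<^esub> (m :: int) = (\<lambda>i. m * f i)"
proof -
  have nat: "f [^]\<^bsub>ivec k\<^esub> n = (\<lambda>i. int n * f i)" for n :: nat
    by (induction n) (simp_all add: nat_pow_def algebra_simps)
  show ?thesis
  proof (cases "m < 0")
    case True
    have "inv\<^bsub>ivec k\<^esub> (f [^]\<^bsub>ivec k\<^esub> nat (- m)) = (\<lambda>i. - (int (nat (- m)) * f i))"
      unfolding nat using assms by (intro inv_ivec) simp
    then show ?thesis
      using True unfolding int_pow_def2 by simp
  next
    case False
    then show ?thesis
      unfolding int_pow_def2 nat by simp
  qed
qed

lemma free_Abelian_group_iso_ivec: "free_Abelian_group {..<k} \<cong> ivec k"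
proof (rule is_isoI, unfold iso_iff, intro conjI)
  show "Poly_Mapping.lookup \<in> hom (free_Abelian_group {..<k}) (ivec k)"
    by (auto simp: hom_def lookup_add in_keys_iff subset_iff not_less[symmetric] intro: ccontr)
  show "inj_on Poly_Mapping.lookup (carrier (free_Abelian_group {..<k}))"
    by (auto simp: inj_on_def lookup_inject)
  have "f \<in> Poly_Mapping.lookup ` carrier (free_Abelian_group {..<k})" if "\<forall>i\<ge>k. f i = 0" for f :: "nat \<Rightarrow> int"
  proof -
    have *: "{i. f i \<noteq> 0} \<subseteq> {..<k}"
      using that by (auto simp: not_less[symmetric])
    then have "finite {i. f i \<noteq> 0}"
      by (rule finite_subset) simp
    then have "Poly_Mapping.lookup (Abs_poly_mapping f) = f"
      by simp
    moreover from this have "Poly_Mapping.keys (Abs_poly_mapping f) \<subseteq> {..<k}"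
      using * by (simp add: keys.rep_eq)
    ultimately show ?thesis
      by (metis carrier_free_Abelian_group_iff image_eqI)
  qed
  then show "Poly_Mapping.lookup ` carrier (free_Abelian_group {..<k}) = carrier (ivec k)"
    by (auto simp: in_keys_iff subset_iff not_less[symmetric] intro: ccontr)
qed

text \<open>Both sides become free abelian groups on \<open>{..<k}\<close> and
  \<open>{..<l}\<close>, whose bases are then equipollent.\<close>

lemma rank_unique:
  assumes "group G" "G \<cong> ivec k" "G \<cong> ivec l"
  shows "k = l"
proof -
  have "free_Abelian_group {..<k} \<cong> free_Abelian_group {..<l}"
    by (meson assms group.iso_sym group_free_Abelian_group iso_trans free_Abelian_group_iso_ivec)
  then have "{..<k} \<approx> {..<l}"
    by (simp add: isomorphic_free_Abelian_groups)
  then show ?thesis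
    by (metis card_lessThan eqpoll_iff_card finite_lessThan)
qed

lemma ivec_DirProd: "ivec k \<times>\<times> ivec l \<cong> ivec (k + l)"
proof (rule is_isoI, rule group_isomorphisms_imp_iso)
  show "group_isomorphisms (ivec k \<times>\<times> ivec l) (ivec (k + l))
      (\<lambda>(f, g) i. if i < k then f i else g (i - k))
      (\<lambda>h. (\<lambda>i. if i < k then h i else 0, \<lambda>i. h (i + k)))"
    by (auto simp: group_isomorphisms_def hom_def fun_eq_iff)
qed

lemma DirProd_iso_cong:
  assumes "group G" "group H" "G \<cong> G'" "H \<cong> H'"
  shows "G \<times>\<times> H \<cong> G' \<times>\<times> H'"
  using assms iso_paired2[OF assms(1,2)] unfolding is_iso_def by blast

lemma split_extension:
  assumes "comm_group G" "group T" "p \<in> hom G T" "\<sigma> \<in> hom T G"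
    and sec: "\<And>t. t \<in> carrier T \<Longrightarrow> p (\<sigma> t) = t"
  shows "G\<lparr>carrier := kernel G T p\<rparr> \<times>\<times> T \<cong> G"
proof (rule is_isoI, rule group_isomorphisms_imp_iso)
  interpret G: comm_group G by fact
  interpret T: group T by fact
  interpret p: group_hom G T p
    using assms by (simp add: group_hom_def group_hom_axioms_def G.group_axioms)
  interpret s: group_hom T G \<sigma>
    using assms by (simp add: group_hom_def group_hom_axioms_def G.group_axioms)
  show "group_isomorphisms (G\<lparr>carrier := kernel G T p\<rparr> \<times>\<times> T) G
      (\<lambda>(z, t). z \<otimes>\<^bsub>G\<^esub> \<sigma> t) (\<lambda>x. (x \<otimes>\<^bsub>G\<^esub> inv\<^bsub>G\<^esub> (\<sigma> (p x)), p x))"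
    unfolding group_isomorphisms_def
  proof (intro conjI ballI)
    show "(\<lambda>(z, t). z \<otimes>\<^bsub>G\<^esub> \<sigma> t) \<in> hom (G\<lparr>carrier := kernel G T p\<rparr> \<times>\<times> T) G"
      by (auto simp: hom_def kernel_def G.m_ac)
    show "(\<lambda>x. (x \<otimes>\<^bsub>G\<^esub> inv\<^bsub>G\<^esub> (\<sigma> (p x)), p x)) \<in> hom G (G\<lparr>carrier := kernel G T p\<rparr> \<times>\<times> T)"
      by (auto simp: hom_def kernel_def G.m_ac G.inv_mult sec)
    fix x assume "x \<in> carrier (G\<lparr>carrier := kernel G T p\<rparr> \<times>\<times> T)"
    then show "(case case x of (z, t) \<Rightarrow> z \<otimes>\<^bsub>G\<^esub> \<sigma> t of x \<Rightarrow> (x \<otimes>\<^bsub>G\<^esub> inv\<^bsub>G\<^esub> (\<sigma> (p x)), p x)) = x"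
      by (auto simp: kernel_def sec G.m_assoc)
  next
    fix y assume "y \<in> carrier G"
    then show "(case (y \<otimes>\<^bsub>G\<^esub> inv\<^bsub>G\<^esub> (\<sigma> (p y)), p y) of (z, t) \<Rightarrow> z \<otimes>\<^bsub>G\<^esub> \<sigma> t) = y"
      by (auto simp: G.m_assoc)
  qed
qed

text \<open>Additivity of ranks in a split extension. It serves three times: for subgroups of
  \<open>Z^k\<close>, for kernels of projections, and for groups of cycles.\<close>

lemma rank_extension:
  assumes "comm_group G" "group T" "p \<in> hom G T" "\<sigma> \<in> hom T G"
    and "\<And>t. t \<in> carrier T \<Longrightarrow> p (\<sigma> t) = t"
    and "G\<lparr>carrier := kernel G T p\<rparr> \<cong> ivec k" "T \<cong> ivec l"
  shows "G \<cong> ivec (k + l)"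
proof -
  have G: "group G"
    using assms(1) by (rule comm_group.axioms)
  have "group_hom G T p"
    using assms G by (simp add: group_hom_def group_hom_axioms_def)
  then have K: "group (G\<lparr>carrier := kernel G T p\<rparr>)"
    using group.subgroup_imp_group[OF G] group_hom.subgroup_kernel by blast
  have "G \<cong> G\<lparr>carrier := kernel G T p\<rparr> \<times>\<times> T"
    using split_extension[OF assms(1-5)] DirProd_group[OF K assms(2)] group.iso_sym by blast
  also have "\<dots> \<cong> ivec k \<times>\<times> ivec l"
    using DirProd_iso_cong[OF K assms(2,6,7)] .
  also have "\<dots> \<cong> ivec (k + l)"
    by (rule ivec_DirProd)
  finally show ?thesis .
qed

lemma ivec_1: "integer_group \<cong> ivec 1"
proof (rule is_isoI, rule group_isomorphisms_imp_iso)
  show "group_isomorphisms integer_group (ivec 1) (\<lambda>j i. if i = 0 then j else 0) (\<lambda>f. f 0)"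
    by (auto simp: group_isomorphisms_def hom_def fun_eq_iff)
qed

text \<open>The values of the last coordinate on \<open>H\<close> form an ideal. If it is zero,
  \<open>H\<close> already lies in \<open>ivec k\<close>. Otherwise let \<open>m\<close> be its
  positive generator, attained at \<open>h\<close>: multiples of \<open>h\<close> split the map
  "last coordinate divided by \<open>m\<close>", whose kernel is covered by the induction
  hypothesis.\<close>

lemma subgroup_ivec_free:
  assumes "subgroup H (ivec k)"
  shows "\<exists>l. (ivec k)\<lparr>carrier := H\<rparr> \<cong> ivec l"
  using assms
proof (induction k arbitrary: H)
  case 0
  then have "H = carrier (ivec 0)"
    using subgroup.subset[OF 0] subgroup.one_closed[OF 0] by (auto simp: fun_eq_iff) (metis ext)
  then have "(ivec 0)\<lparr>carrier := H\<rparr> = ivec 0"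
    by (simp add: ivec_def)
  then show ?case
    using iso_refl by metis
next
  case (Suc k)
  let ?G = "(ivec (Suc k))\<lparr>carrier := H\<rparr>"
  have sub: "\<And>f i. f \<in> H \<Longrightarrow> i \<ge> Suc k \<Longrightarrow> f i = 0"
    using subgroup.subset[OF Suc.prems] by auto
  have zero: "(\<lambda>_. 0) \<in> H"
    using subgroup.one_closed[OF Suc.prems] by simp
  have add: "(\<lambda>i. f i + g i) \<in> H" if "f \<in> H" "g \<in> H" for f g
    using subgroup.m_closed[OF Suc.prems that] by simp
  have neg: "(\<lambda>i. - f i) \<in> H" if "f \<in> H" for f
    using subgroup.m_inv_closed[OF Suc.prems that] inv_ivec[of f "Suc k"] sub that by auto
  have mult: "(\<lambda>i. m * f i) \<in> H" if "f \<in> H" for f and m :: int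
  proof (induction m rule: int_induct[of _ 0])
    case base
    then show ?case using zero by simp
  next
    case (step1 i)
    then show ?case using add[OF step1(2) that] by (simp add: algebra_simps)
  next
    case (step2 i)
    then show ?case using add[OF step2(2) neg[OF that]] by (simp add: algebra_simps)
  qed
  define H0 where "H0 = {f \<in> H. f k = 0}"
  have H0: "subgroup H0 (ivec k)"
  proof (rule group.subgroupI[OF group_ivec])
    show "H0 \<subseteq> carrier (ivec k)"
    proof
      fix f assume f: "f \<in> H0"
      have "f i = 0" if "i \<ge> k" for i
        using that f sub[of f i] by (cases "i = k") (auto simp: H0_def)
      then show "f \<in> carrier (ivec k)" by simp
    qed
    then show "inv\<^bsub>ivec k\<^esub> f \<in> H0" if "f \<in> H0" for f
      using that neg inv_ivec[of f k] by (auto simp: H0_def)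
  qed (use zero add in \<open>auto simp: H0_def\<close>)
  obtain l where l: "(ivec k)\<lparr>carrier := H0\<rparr> \<cong> ivec l"
    using Suc.IH[OF H0] by blast
  have eq: "(ivec (Suc k))\<lparr>carrier := H0\<rparr> = (ivec k)\<lparr>carrier := H0\<rparr>"
    by (simp add: ivec_def)
  show ?case
  proof (cases "H \<subseteq> H0")
    case True
    then have "H = H0" by (auto simp: H0_def)
    then show ?thesis using l eq by auto
  next
    case False
    then obtain f0 where f0: "f0 \<in> H" "f0 k \<noteq> 0"
      by (auto simp: H0_def)
    define P where "P m \<longleftrightarrow> m > 0 \<and> (\<exists>f\<in>H. f k = int m)" for m
    have "P (nat \<bar>f0 k\<bar>)"
      using f0 neg[OF f0(1)] unfolding P_def by (cases "f0 k > 0") force+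
    then have "P (LEAST m. P m)" by (rule LeastI)
    then obtain m h where m: "m = (LEAST m. P m)" "m > 0" "h \<in> H" "h k = int m"
      unfolding P_def by auto
    have dvd: "int m dvd f k" if f: "f \<in> H" for f
    proof (rule ccontr)
      assume "\<not> int m dvd f k"
      then have "f k mod int m \<noteq> 0"
        by (simp add: mod_eq_0_iff_dvd)
      then have "f k mod int m > 0"
        using m(2) pos_mod_sign[of "int m" "f k"] by linarith
      \<comment> \<open>The remainder is again a last coordinate of an element of \<open>H\<close>,
        but smaller than the least positive one.\<close>
      moreover have "f k + - (f k div int m) * h k = f k mod int m"
        unfolding m(4) by (simp add: minus_div_mult_eq_mod)
      ultimately have "P (nat (f k mod int m))"
        unfolding P_def using add[OF f mult[OF m(3), of "- (f k div int m)"]] by force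
      then have "m \<le> nat (f k mod int m)"
        unfolding m(1) by (rule Least_le)
      then show False
        using m(2) pos_mod_bound[of "int m" "f k"] by linarith
    qed
    have "?G \<cong> ivec (l + 1)"
    proof (rule rank_extension[where T = integer_group and p = "\<lambda>f. f k div int m"
          and \<sigma> = "\<lambda>j i. j * h i"])
      show "comm_group ?G"
        using comm_group_subgroup[OF comm_group_ivec Suc.prems] .
      show "(\<lambda>f. f k div int m) \<in> hom ?G integer_group"
        using dvd by (auto simp: hom_def div_plus_div_distrib_dvd_left)
      show "(\<lambda>j i. j * h i) \<in> hom integer_group ?G"
        using mult[OF m(3)] by (auto simp: hom_def algebra_simps)
      show "t * h k div int m = t" for t
        using m by simp
      have "kernel ?G integer_group (\<lambda>f. f k div int m) = H0"
        using dvd m(2) by (auto simp: kernel_def H0_def dvd_div_eq_0_iff)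
      then show "?G\<lparr>carrier := kernel ?G integer_group (\<lambda>f. f k div int m)\<rparr> \<cong> ivec l"
        using l eq by simp
      show "integer_group \<cong> ivec 1"
        by (rule ivec_1)
    qed simp
    then show ?thesis by blast
  qed
qed

lemma subgroup_free:
  assumes "group G" "G \<cong> ivec k" "subgroup H G"
  shows "\<exists>l. G\<lparr>carrier := H\<rparr> \<cong> ivec l"
proof -
  obtain f where f: "f \<in> iso G (ivec k)"
    using assms(2) by (auto simp: is_iso_def)
  have "subgroup (f ` H) (ivec k)"
    using subgroup.iso_subgroup[OF assms(3,1) group_ivec f] .
  then obtain l where l: "(ivec k)\<lparr>carrier := f ` H\<rparr> \<cong> ivec l"
    using subgroup_ivec_free by blast
  have "H \<subseteq> carrier G"
    using subgroup.subset[OF assms(3)] .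
  then have "f \<in> iso (G\<lparr>carrier := H\<rparr>) ((ivec k)\<lparr>carrier := f ` H\<rparr>)"
    using f by (auto simp: iso_iff hom_def subset_iff intro: inj_on_subset)
  then show ?thesis
    using l is_isoI iso_trans by blast
qed

text \<open>In coordinates the \<open>g\<close>-th powers are the vectors divisible by
  \<open>g\<close>, so reduction of each coordinate modulo \<open>\<bar>g\<bar>\<close> has the
  right kernel. This includes \<open>g = 0\<close>, where \<open>x mod 0 = x\<close> agrees with
  \<open>cyclic 0\<close> being the integers.\<close>

lemma Mod_powers_iso:
  assumes "comm_group G" "G \<cong> ivec b"
  shows "G Mod ((\<lambda>z. z [^]\<^bsub>G\<^esub> (g :: int)) ` carrier G) \<cong> cyclic_power g (int b)"
proof -
  interpret G: comm_group G by fact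
  obtain \<kappa> where \<kappa>: "\<kappa> \<in> iso G (ivec b)"
    using assms(2) by (auto simp: is_iso_def)
  then have hom: "\<kappa> \<in> hom G (ivec b)" and inj: "inj_on \<kappa> (carrier G)"
    and car: "\<kappa> ` carrier G = carrier (ivec b)"
    by (auto simp: iso_iff)
  have supp: "\<kappa> x i = 0" if "x \<in> carrier G" "i \<ge> b" for x i
    using hom_in_carrier[OF hom that(1)] that(2) by simp
  interpret \<kappa>: group_hom G "ivec b" \<kappa>
    using hom group_ivec by (simp add: group_hom_def group_hom_axioms_def G.group_axioms)
  have pow: "\<kappa> (z [^]\<^bsub>G\<^esub> g) = (\<lambda>i. g * \<kappa> z i)" if "z \<in> carrier G" for z
    using \<kappa>.hom_int_pow[OF that] int_pow_ivec[OF hom_in_carrier[OF hom that]] by simp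
  define h where "h x = (\<lambda>i\<in>{..<b}. \<kappa> x i mod \<bar>g\<bar>)" for x
  have mod: "v mod \<bar>g\<bar> \<in> carrier (cyclic g)" for v
    by (simp add: cyclic_def carrier_integer_mod_group)
  show ?thesis
  proof (rule FactGroup_iso_via_hom[where h = h])
    show "group (cyclic_power g (int b))"
      by (simp add: cyclic_power_def cyclic_def)
    have one: "\<one>\<^bsub>cyclic_power g (int b)\<^esub> = (\<lambda>i\<in>{..<b}. 0)"
      by (simp add: cyclic_power_def cyclic_def)
    show "h \<in> hom G (cyclic_power g (int b))"
    proof (rule homI)
      show "h x \<in> carrier (cyclic_power g (int b))" for x
        using mod by (simp add: h_def cyclic_power_def)
      show "h (x \<otimes>\<^bsub>G\<^esub> y) = h x \<otimes>\<^bsub>cyclic_power g (int b)\<^esub> h y"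
        if "x \<in> carrier G" "y \<in> carrier G" for x y
        using that hom_mult[OF hom that]
        by (auto simp: h_def cyclic_power_def cyclic_def mod_add_eq intro!: restrict_ext)
    qed
    show "h ` carrier G = carrier (cyclic_power g (int b))"
    proof
      show "h ` carrier G \<subseteq> carrier (cyclic_power g (int b))"
        using mod by (auto simp: h_def cyclic_power_def split: if_splits)
      show "carrier (cyclic_power g (int b)) \<subseteq> h ` carrier G"
      proof
        fix f assume f: "f \<in> carrier (cyclic_power g (int b))"
        then have f': "f i \<in> carrier (cyclic g)" if "i < b" for i
          using that by (auto simp: cyclic_power_def)
        have "(\<lambda>i. if i < b then f i else 0) \<in> carrier (ivec b)" by simp
        then obtain x where x': "(\<lambda>i. if i < b then f i else 0) = \<kappa> x" "x \<in> carrier G"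
          unfolding car[symmetric] by (rule imageE)
        note x = x'(2) x'(1)[symmetric]
        have "h x i = f i" for i
        proof (cases "i < b")
          case True
          then show ?thesis
            using x f'[OF True] by (auto simp: h_def cyclic_def carrier_integer_mod_group split: if_splits)
        next
          case False
          then show ?thesis
            using f PiE_arb[of f "{..<b}" "\<lambda>_. carrier (cyclic g)" i] by (simp add: h_def cyclic_power_def)
        qed
        then show "f \<in> h ` carrier G"
          using x(1) by (intro image_eqI[of _ _ x]) (auto intro: ext)
      qed
    qed
    have "h x = \<one>\<^bsub>cyclic_power g (int b)\<^esub> \<longleftrightarrow> x \<in> (\<lambda>z. z [^]\<^bsub>G\<^esub> g) ` carrier G"
      if x: "x \<in> carrier G" for x
    proof
      assume a: "h x = \<one>\<^bsub>cyclic_power g (int b)\<^esub>"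
      have "g dvd \<kappa> x i" for i
      proof (cases "i < b")
        case True
        then have "\<kappa> x i mod \<bar>g\<bar> = 0"
          using fun_cong[OF a[unfolded one h_def], of i] by simp
        then show ?thesis
          by (simp only: mod_eq_0_iff_dvd abs_dvd_iff)
      qed (use supp[OF x, of i] in simp)
      then have d: "g * (\<kappa> x i div g) = \<kappa> x i" for i
        by simp
      have "(\<lambda>i. \<kappa> x i div g) \<in> carrier (ivec b)"
        using supp[OF x] by simp
      then obtain z where z': "(\<lambda>i. \<kappa> x i div g) = \<kappa> z" "z \<in> carrier G"
        unfolding car[symmetric] by (rule imageE)
      note z = z'(2) z'(1)[symmetric]
      then have "\<kappa> (z [^]\<^bsub>G\<^esub> g) = \<kappa> x"
        using pow d by simp
      then have "z [^]\<^bsub>G\<^esub> g = x"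
        using inj_onD[OF inj] x z(1) by simp
      then show "x \<in> (\<lambda>z. z [^]\<^bsub>G\<^esub> g) ` carrier G"
        using z(1) by blast
    next
      assume "x \<in> (\<lambda>z. z [^]\<^bsub>G\<^esub> g) ` carrier G"
      then show "h x = \<one>\<^bsub>cyclic_power g (int b)\<^esub>"
        using pow unfolding one by (auto simp: h_def)
    qed
    then show "kernel G (cyclic_power g (int b)) h = (\<lambda>z. z [^]\<^bsub>G\<^esub> g) ` carrier G"
      by (auto simp: kernel_def)
  qed (rule G.group_axioms)
qed

subsection \<open>Homology of complexes with a null-homotopic multiple of the identity\<close>

lemma additive_frag_cmul:
  fixes f :: "('b \<Rightarrow>\<^sub>0 int) \<Rightarrow> ('c \<Rightarrow>\<^sub>0 int)"
  assumes "additive f"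
  shows "f (frag_cmul m x) = frag_cmul m (f x)"
proof -
  interpret additive f by fact
  show ?thesis
  proof (induction m rule: int_induct[of _ 0])
    case (step1 i)
    then show ?case by (simp add: frag_cmul_distrib add)
  next
    case (step2 i)
    then show ?case by (simp add: frag_cmul_diff_distrib diff)
  qed (simp add: zero)
qed

lemma frag_cmul_cancel:
  assumes "g \<noteq> 0" "frag_cmul g x = frag_cmul g y"
  shows "x = y"
proof (rule poly_mapping_eqI)
  fix k
  show "Poly_Mapping.lookup x k = Poly_Mapping.lookup y k"
    using assms(1) arg_cong[OF assms(2), of "\<lambda>z. Poly_Mapping.lookup z k"] by simp
qed

text \<open>Complexes of subgroups of one ambient free abelian group. The boundary is additive on
  the whole ambient group, so sums and multiples can be pulled out of it without membership
  conditions.\<close>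

locale frag_complex =
  fixes C :: "('b \<Rightarrow>\<^sub>0 int) cpx" and S :: "nat \<Rightarrow> ('b \<Rightarrow>\<^sub>0 int) set"
  assumes complex: "chain_complex C"
    and grp: "grp C n = (free_Abelian_group UNIV)\<lparr>carrier := S n\<rparr>"
    and sub: "subgroup (S n) (free_Abelian_group UNIV)"
    and additive: "additive (bdry C n)"
begin

lemma closed:
  "0 \<in> S n" "x \<in> S n \<Longrightarrow> y \<in> S n \<Longrightarrow> x + y \<in> S n" "x \<in> S n \<Longrightarrow> frag_cmul m x \<in> S n"
proof -
  show "0 \<in> S n"
    using subgroup.one_closed[OF sub, of n] by simp
  show "x + y \<in> S n" if "x \<in> S n" "y \<in> S n"
    using subgroup.m_closed[OF sub that] by simp
  show "frag_cmul m x \<in> S n" if "x \<in> S n"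
    using group.subgroup_int_pow_closed[OF group_free_Abelian_group sub that, of m] by simp
qed

lemma bdry_bdry: "x \<in> S (Suc (Suc n)) \<Longrightarrow> bdry C (Suc n) (bdry C (Suc (Suc n)) x) = 0"
  using chain_complexD(7)[OF complex, of "Suc (Suc n)" x] by (simp add: grp)

text \<open>Multiplication by \<open>m\<close> is chain homotopic to zero inside the complex. In
  degree \<open>0\<close> the second term is missing because the complex is not augmented.\<close>

definition null_homotopic :: "int \<Rightarrow> bool" where
  "null_homotopic m \<longleftrightarrow>
     (\<exists>h. \<forall>n. additive (h n) \<and> (\<forall>x\<in>S n. h n x \<in> S (Suc n) \<and>
        bdry C (Suc n) (h n x) + (if n = 0 then 0 else h (n - 1) (bdry C n x)) = frag_cmul m x))"

lemma null_homotopic_add: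
  assumes "null_homotopic m" "null_homotopic m'"
  shows "null_homotopic (u * m + v * m')"
proof -
  obtain h h' where
    h: "\<And>n. additive (h n)" "\<And>n x. x \<in> S n \<Longrightarrow> h n x \<in> S (Suc n)"
      "\<And>n x. x \<in> S n \<Longrightarrow>
         bdry C (Suc n) (h n x) + (if n = 0 then 0 else h (n - 1) (bdry C n x)) = frag_cmul m x"
    and h': "\<And>n. additive (h' n)" "\<And>n x. x \<in> S n \<Longrightarrow> h' n x \<in> S (Suc n)"
      "\<And>n x. x \<in> S n \<Longrightarrow>
         bdry C (Suc n) (h' n x) + (if n = 0 then 0 else h' (n - 1) (bdry C n x)) = frag_cmul m' x"
    using assms unfolding null_homotopic_def by metis
  define H where "H n x = frag_cmul u (h n x) + frag_cmul v (h' n x)" for n x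
  have "additive (H n)" for n
    using h(1)[of n] h'(1)[of n] by (simp add: additive_def H_def frag_cmul_distrib2)
  moreover have "H n x \<in> S (Suc n)" if "x \<in> S n" for n x
    using that h(2) h'(2) by (simp add: H_def closed)
  moreover have "bdry C (Suc n) (H n x) + (if n = 0 then 0 else H (n - 1) (bdry C n x))
      = frag_cmul (u * m + v * m') x" if "x \<in> S n" for n x
  proof -
    have "bdry C (Suc n) (H n x) + (if n = 0 then 0 else H (n - 1) (bdry C n x))
      = frag_cmul u (bdry C (Suc n) (h n x) + (if n = 0 then 0 else h (n - 1) (bdry C n x)))
      + frag_cmul v (bdry C (Suc n) (h' n x) + (if n = 0 then 0 else h' (n - 1) (bdry C n x)))"
      using additive.add[OF additive] by (simp add: H_def additive_frag_cmul[OF additive] frag_cmul_distrib2)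
    also have "\<dots> = frag_cmul (u * m + v * m') x"
      unfolding h(3)[OF that] h'(3)[OF that] by (simp add: frag_cmul_distrib)
    finally show ?thesis .
  qed
  ultimately show ?thesis
    unfolding null_homotopic_def by blast
qed

lemma null_homotopic_gcd:
  assumes "null_homotopic m" "null_homotopic m'"
  shows "null_homotopic (gcd m m')"
proof -
  obtain u v where "u * m + v * m' = gcd m m'"
    using bezout_int by blast
  then show ?thesis
    using null_homotopic_add[OF assms, of u v] by simp
qed

lemma cycles_eq: "cycles C n = {x \<in> S n. n = 0 \<or> bdry C n x = 0}"
  by (auto simp: cycles_def kernel_def grp)

text \<open>On a cycle the homotopy reads \<open>bdry (h x) = g x\<close>, so \<open>g Z_n\<close>
  consists of boundaries; \<open>div\<close> gives the converse inclusion. In degree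
  \<open>0\<close> everything is a cycle, which starts the recursion for the ranks
  \<open>b\<close>.\<close>

theorem homology_torsion:
  assumes null: "null_homotopic g"
    and div: "\<And>n x. x \<in> S (Suc n) \<Longrightarrow> \<exists>y\<in>S n. bdry C (Suc n) x = frag_cmul g y"
    and g: "g \<noteq> 0"
    and rank: "\<And>n. grp C n \<cong> ivec (s n)"
  obtains b where "b 0 = s 0" "\<And>n. b (Suc n) + b n = s (Suc n)"
    "\<And>n. homology C n \<cong> cyclic_power g (int (b n))"
proof -
  obtain h where h_add: "\<And>n. additive (h n)" and h: "\<And>n x. x \<in> S n \<Longrightarrow> h n x \<in> S (Suc n)"
    and htpy: "\<And>n x. x \<in> S n \<Longrightarrow>
      bdry C (Suc n) (h n x) + (if n = 0 then 0 else h (n - 1) (bdry C n x)) = frag_cmul g x"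
    using null unfolding null_homotopic_def by metis
  let ?Z = "\<lambda>n. (grp C n)\<lparr>carrier := cycles C n\<rparr>"
  have Zgrp: "comm_group (?Z n)" for n
    using comm_group_subgroup[OF chain_complexD(1)[OF complex] cycles_subgroup[OF complex]] .
  have htpyZ: "bdry C (Suc n) (h n x) = frag_cmul g x" if "x \<in> cycles C n" for n x
    using that htpy[of x n] additive.zero[OF h_add, of "n - 1"] by (auto simp: cycles_eq split: if_splits)
  have bnd: "boundaries C n = frag_cmul g ` cycles C n" for n
  proof
    show "frag_cmul g ` cycles C n \<subseteq> boundaries C n"
    proof clarify
      fix x assume x: "x \<in> cycles C n"
      then have "h n x \<in> S (Suc n)"
        using h by (simp add: cycles_eq)
      then show "frag_cmul g x \<in> boundaries C n"
        using htpyZ[OF x] by (auto simp: boundaries_def grp intro!: image_eqI[of _ _ "h n x"])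
    qed
    show "boundaries C n \<subseteq> frag_cmul g ` cycles C n"
    proof
      fix y assume "y \<in> boundaries C n"
      then obtain w where w: "w \<in> S (Suc n)" "y = bdry C (Suc n) w"
        by (auto simp: boundaries_def grp)
      then obtain y' where y': "y' \<in> S n" "y = frag_cmul g y'"
        using div by blast
      \<comment> \<open>A boundary divided by \<open>g\<close> is still a cycle, since chains are
        torsion-free.\<close>
      have "bdry C n y' = 0" if n: "n \<noteq> 0"
      proof -
        obtain m where m: "n = Suc m"
          using n not0_implies_Suc by blast
        then have "bdry C n y = 0"
          using bdry_bdry w by simp
        then have "frag_cmul g (bdry C n y') = frag_cmul g 0"
          using y'(2) by (simp add: additive_frag_cmul[OF additive])
        then show ?thesis
          by (rule frag_cmul_cancel[OF g])
      qed
      then show "y \<in> frag_cmul g ` cycles C n"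
        using y' by (auto simp: cycles_eq)
    qed
  qed
  have "\<exists>l. ?Z n \<cong> ivec l" for n
    using subgroup_free[OF chain_complexD(2)[OF complex] rank cycles_subgroup[OF complex]] .
  then obtain b where b: "\<And>n. ?Z n \<cong> ivec (b n)"
    by metis
  have pow: "z [^]\<^bsub>?Z n\<^esub> g = frag_cmul g z" if "z \<in> cycles C n" for n z
  proof -
    have "subgroup (cycles C n) (free_Abelian_group UNIV)"
      using group.incl_subgroup[OF group_free_Abelian_group sub[of n], of "cycles C n"]
        cycles_subgroup[OF complex, of n] by (simp add: grp)
    then show ?thesis
      using group.int_pow_consistent[OF group_free_Abelian_group _ that, of UNIV g] by (simp add: grp)
  qed
  show thesis
  proof
    have "?Z 0 = grp C 0"
      by (simp add: cycles_def)
    then show "b 0 = s 0"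
      using rank_unique[OF chain_complexD(2)[OF complex]] b[of 0] rank[of 0] by metis
    show "homology C n \<cong> cyclic_power g (int (b n))" for n
    proof -
      have "boundaries C n = (\<lambda>z. z [^]\<^bsub>?Z n\<^esub> g) ` carrier (?Z n)"
        unfolding bnd using pow by simp
      then show ?thesis
        unfolding homology_def using Mod_powers_iso[OF Zgrp b] by metis
    qed
    show "b (Suc n) + b n = s (Suc n)" for n
    proof -
      \<comment> \<open>The boundary divided by \<open>g\<close>, coefficient by coefficient. It
        maps onto the cycles of degree \<open>n\<close>, with section \<open>h n\<close>, and its
        kernel is the group of cycles of degree \<open>Suc n\<close>.\<close>
      define p where "p x = Poly_Mapping.map (\<lambda>v. v div g) (bdry C (Suc n) x)" for x
      have "Poly_Mapping.map (\<lambda>v. v div g) (frag_cmul g y) = y" for y :: "'b \<Rightarrow>\<^sub>0 int"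
        by (rule poly_mapping_eqI) (use g in \<open>auto simp: map.rep_eq when_def\<close>)
      then have p: "p x = y" if "bdry C (Suc n) x = frag_cmul g y" for x y
        using that by (simp add: p_def)
      have p': "bdry C (Suc n) x = frag_cmul g (p x)" "p x \<in> cycles C n" if x: "x \<in> S (Suc n)" for x
      proof -
        have "bdry C (Suc n) x \<in> boundaries C n"
          using x by (auto simp: boundaries_def grp)
        then obtain y where "y \<in> cycles C n" "bdry C (Suc n) x = frag_cmul g y"
          unfolding bnd by blast
        then show "bdry C (Suc n) x = frag_cmul g (p x)" "p x \<in> cycles C n"
          using p by auto
      qed
      have "grp C (Suc n) \<cong> ivec (b (Suc n) + b n)"
      proof (rule rank_extension[where T = "?Z n" and p = p and \<sigma> = "h n"])
        show "comm_group (grp C (Suc n))" "group (?Z n)"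
          using chain_complexD(1)[OF complex] Zgrp by (auto intro: comm_group.axioms)
        show "p \<in> hom (grp C (Suc n)) (?Z n)"
        proof (rule homI)
          fix x y assume "x \<in> carrier (grp C (Suc n))" "y \<in> carrier (grp C (Suc n))"
          then have "bdry C (Suc n) (x + y) = frag_cmul g (p x + p y)"
            using p'(1)[of x] p'(1)[of y] by (simp add: additive.add[OF additive] frag_cmul_distrib2 grp)
          then show "p (x \<otimes>\<^bsub>grp C (Suc n)\<^esub> y) = p x \<otimes>\<^bsub>?Z n\<^esub> p y"
            using p by (simp add: grp)
        qed (use p'(2) in \<open>simp add: grp\<close>)
        show "h n \<in> hom (?Z n) (grp C (Suc n))"
          using h additive.add[OF h_add] by (auto simp: hom_def grp cycles_eq)
        show "p (h n t) = t" if "t \<in> carrier (?Z n)" for t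
          using p[OF htpyZ] that by simp
        have "p x = 0 \<longleftrightarrow> bdry C (Suc n) x = 0" if "x \<in> S (Suc n)" for x
          using p'(1)[OF that] p[of x 0] by auto
        then have "kernel (grp C (Suc n)) (?Z n) p = cycles C (Suc n)"
          by (auto simp: kernel_def cycles_eq grp)
        then show "(grp C (Suc n))\<lparr>carrier := kernel (grp C (Suc n)) (?Z n) p\<rparr> \<cong> ivec (b (Suc n))"
          using b[of "Suc n"] by simp
      qed (rule b)
      then show ?thesis
        using rank_unique[OF chain_complexD(2)[OF complex] _ rank] by blast
    qed
  qed
qed

end

subsection \<open>The boundary in terms of appending an entry\<close>

definition frag_map :: "('b \<Rightarrow> 'c) \<Rightarrow> ('b \<Rightarrow>\<^sub>0 int) \<Rightarrow> ('c \<Rightarrow>\<^sub>0 int)" where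
  "frag_map f = frag_extend (frag_of \<circ> f)"

lemma frag_map_simps [simp]:
  "frag_map f (frag_of x) = frag_of (f x)"
  "frag_map f 0 = 0"
  "frag_map f (v + w) = frag_map f v + frag_map f w"
  "frag_map f (v - w) = frag_map f v - frag_map f w"
  "frag_map f (frag_cmul m v) = frag_cmul m (frag_map f v)"
  by (simp_all add: frag_map_def frag_extend_add frag_extend_diff frag_extend_cmul)

lemma additive_frag_map: "additive (frag_map f)"
  by (simp add: additive_def)

lemma frag_map_frag_map: "frag_map f (frag_map g w) = frag_map (f \<circ> g) w"
  unfolding frag_map_def frag_extend_compose by (simp add: comp_assoc)

lemma keys_frag_map: "Poly_Mapping.keys (frag_map f w) \<subseteq> f ` Poly_Mapping.keys w"
  using keys_frag_extend[of "frag_of \<circ> f" w] by (auto simp: frag_map_def keys_frag_of)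

lemma frag_map_cong:
  assumes "\<And>x. x \<in> Poly_Mapping.keys w \<Longrightarrow> f x = g x"
  shows "frag_map f w = frag_map g w"
  unfolding frag_map_def by (rule frag_extend_eq) (simp add: assms)

lemma frag_cmul_diff_right: "frag_cmul m (v - w) = frag_cmul m v - frag_cmul m w"
  by (rule poly_mapping_eqI) (simp add: lookup_minus right_diff_distrib)

lemma frag_map_id: "frag_map (\<lambda>x. x) w = w"
  by (simp add: frag_map_def comp_def flip: frag_expansion)

lemma additive_eqI:
  fixes f g :: "('b \<Rightarrow>\<^sub>0 int) \<Rightarrow> 'c :: ab_group_add"
  assumes "additive f" "additive g" "Poly_Mapping.keys w \<subseteq> T" "\<And>x. x \<in> T \<Longrightarrow> f (frag_of x) = g (frag_of x)"
  shows "f w = g w"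
  using assms(3)
proof (induction w rule: frag_induction)
  case zero
  then show ?case
    using additive.zero[OF assms(1)] additive.zero[OF assms(2)] by simp
next
  case (diff v w)
  then show ?case
    using additive.diff[OF assms(1)] additive.diff[OF assms(2)] by simp
qed (rule assms(4))

text \<open>Indexed by length instead of degree, to make room for the empty word; degree
  \<open>n\<close> means length \<open>Suc n\<close>.\<close>

definition words :: "'a set \<Rightarrow> nat \<Rightarrow> 'a list set" where
  "words X k = {xs. length xs = k \<and> set xs \<subseteq> X}"

definition wchains :: "'a set \<Rightarrow> nat \<Rightarrow> ('a list \<Rightarrow>\<^sub>0 int) set" where
  "wchains X k = {w. Poly_Mapping.keys w \<subseteq> words X k}"

lemma wchains_closed [simp]:
  "0 \<in> wchains X k"
  "v \<in> wchains X k \<Longrightarrow> w \<in> wchains X k \<Longrightarrow> v + w \<in> wchains X k"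
  "v \<in> wchains X k \<Longrightarrow> w \<in> wchains X k \<Longrightarrow> v - w \<in> wchains X k"
  "w \<in> wchains X k \<Longrightarrow> frag_cmul m w \<in> wchains X k"
  using keys_add[of v w] keys_diff[of v w] keys_cmul[of m w] by (auto simp: wchains_def)

lemma frag_of_wchains [simp]: "frag_of xs \<in> wchains X k \<longleftrightarrow> length xs = k \<and> set xs \<subseteq> X"
  by (simp add: wchains_def words_def keys_frag_of)

lemma frag_map_wchains:
  assumes "w \<in> wchains X k" "\<And>xs. length xs = k \<Longrightarrow> set xs \<subseteq> X \<Longrightarrow> length (f xs) = l \<and> set (f xs) \<subseteq> Y"
  shows "frag_map f w \<in> wchains Y l"
  using assms keys_frag_map[of f w] by (fastforce simp: wchains_def words_def)

lemma wchains_eqI: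
  assumes "w \<in> wchains X k" "additive f" "additive g"
    and "\<And>xs. length xs = k \<Longrightarrow> set xs \<subseteq> X \<Longrightarrow> f (frag_of xs) = g (frag_of xs)"
  shows "f w = g w"
  by (rule additive_eqI[OF assms(2,3), where T = "words X k"]) (use assms(1,4) in \<open>auto simp: wchains_def words_def\<close>)

lemma frag_map_eqI:
  assumes "w \<in> wchains X k" "\<And>xs. length xs = k \<Longrightarrow> set xs \<subseteq> X \<Longrightarrow> f xs = g xs"
  shows "frag_map f w = frag_map g w"
  using assms by (intro frag_map_cong) (auto simp: wchains_def words_def)

abbreviation snoc :: "'a \<Rightarrow> ('a list \<Rightarrow>\<^sub>0 int) \<Rightarrow> ('a list \<Rightarrow>\<^sub>0 int)" where
  "snoc y \<equiv> frag_map (\<lambda>xs. xs @ [y])"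

lemma snoc_wchains: "w \<in> wchains X k \<Longrightarrow> y \<in> X \<Longrightarrow> snoc y w \<in> wchains X (Suc k)"
  by (erule frag_map_wchains) auto

lemma length_Suc_snocE:
  assumes "length xs = Suc k"
  obtains ys y where "xs = ys @ [y]" "length ys = k"
  using assms by (cases xs rule: rev_cases) auto

context
  fixes star :: "'a \<Rightarrow> 'a \<Rightarrow> 'a"
begin

text \<open>The last face, without its sign, of the chain obtained by appending \<open>y\<close> to
  \<open>w\<close>.\<close>

definition top_face :: "int \<Rightarrow> int \<Rightarrow> int \<Rightarrow> 'a \<Rightarrow> ('a list \<Rightarrow>\<^sub>0 int) \<Rightarrow> ('a list \<Rightarrow>\<^sub>0 int)" where
  "top_face a c d y w =
     frag_cmul a w + frag_cmul c (frag_map (map (\<lambda>x. star x y)) w) + frag_cmul d (frag_map (map (\<lambda>x. y)) w)"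

definition face :: "int \<Rightarrow> int \<Rightarrow> int \<Rightarrow> nat \<Rightarrow> 'a list \<Rightarrow> ('a list \<Rightarrow>\<^sub>0 int)" where
  "face a c d i xs =
     frag_cmul a (frag_of (spindle_face (\<lambda>x y. x) i xs)) +
     frag_cmul c (frag_of (spindle_face star i xs)) +
     frag_cmul d (frag_of (spindle_face (\<lambda>x y. y) i xs))"

text \<open>
  The augmented version of the boundary, defined in all degrees at once: it sends a
  one-letter word to \<open>a + c + d\<close> times the empty word.
\<close>

definition bd :: "int \<Rightarrow> int \<Rightarrow> int \<Rightarrow> ('a list \<Rightarrow>\<^sub>0 int) \<Rightarrow> ('a list \<Rightarrow>\<^sub>0 int)" where
  "bd a c d = frag_extend (\<lambda>xs. \<Sum>i<length xs. frag_cmul ((-1) ^ i) (face a c d i xs))"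

lemma top_face_simps [simp]:
  "top_face a c d y 0 = 0"
  "top_face a c d y (v + w) = top_face a c d y v + top_face a c d y w"
  "top_face a c d y (v - w) = top_face a c d y v - top_face a c d y w"
  "top_face a c d y (frag_cmul m v) = frag_cmul m (top_face a c d y v)"
  by (simp_all add: top_face_def frag_cmul_distrib2 frag_cmul_diff_right mult.commute)

lemma bd_simps [simp]:
  "bd a c d 0 = 0"
  "bd a c d (v + w) = bd a c d v + bd a c d w"
  "bd a c d (v - w) = bd a c d v - bd a c d w"
  "bd a c d (frag_cmul m v) = frag_cmul m (bd a c d v)"
  by (simp_all add: bd_def frag_extend_add frag_extend_diff frag_extend_cmul)

lemma frag_map_sum: "frag_map f (sum g I) = (\<Sum>i\<in>I. frag_map f (g i))"
  by (rule additive.sum[OF additive_frag_map])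

lemma bd_Nil [simp]: "bd a c d (frag_of []) = 0"
  by (simp add: bd_def)

text \<open>A face of index below \<open>length xs\<close> acts in front of \<open>y\<close> and
  keeps \<open>y\<close> at the end; the face of index \<open>length xs\<close> removes
  \<open>y\<close> and acts with it on all of \<open>xs\<close>.\<close>

lemma bd_snoc_word:
  "bd a c d (frag_of (xs @ [y])) =
     snoc y (bd a c d (frag_of xs)) + frag_cmul ((-1) ^ length xs) (top_face a c d y (frag_of xs))"
proof -
  have "face a c d i (xs @ [y]) = snoc y (face a c d i xs)" if "i < length xs" for i
    using that by (simp add: face_def spindle_face_def nth_append)
  moreover have "face a c d (length xs) (xs @ [y]) = top_face a c d y (frag_of xs)"
    by (simp add: face_def spindle_face_def top_face_def)
  ultimately show ?thesis
    by (simp add: bd_def frag_map_sum)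
qed

lemma bd_snoc:
  assumes "w \<in> wchains X k"
  shows "bd a c d (snoc y w) = snoc y (bd a c d w) + frag_cmul ((-1) ^ k) (top_face a c d y w)"
  using assms
  by (rule wchains_eqI) (simp_all add: additive_def frag_cmul_distrib2 bd_snoc_word)

text \<open>Degree \<open>0\<close> is left out because \<open>acd_boundary\<close> vanishes there,
  whereas \<open>bd\<close> is the augmentation.\<close>

lemma acd_boundary_eq_bd:
  assumes "n \<ge> 1" "w \<in> wchains X (Suc n)"
  shows "acd_boundary star a c d n w = bd a c d w"
  using assms(2)
proof (rule wchains_eqI)
  fix xs :: "'a list" assume xs: "length xs = Suc n"
  have sf: "spindle_face s 0 xs = tl xs" for s :: "'a \<Rightarrow> 'a \<Rightarrow> 'a"
    by (simp add: spindle_face_def drop_Suc)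
  have op: "op_boundary s n (frag_of xs) = (\<Sum>i\<le>n. frag_cmul ((-1) ^ i) (frag_of (spindle_face s i xs)))"
    for s :: "'a \<Rightarrow> 'a \<Rightarrow> 'a"
    using assms(1) sum.atMost_shift[of "\<lambda>i. frag_cmul ((-1) ^ i) (frag_of (spindle_face s i xs))" n]
    by (simp add: op_boundary_def sf sum.atLeast1_atMost_eq)
  show "acd_boundary star a c d n (frag_of xs) = bd a c d (frag_of xs)"
    unfolding acd_boundary_def op
    by (simp add: bd_def xs face_def frag_cmul_sum sum.distrib frag_cmul_distrib2 mult.commute lessThan_Suc_atMost)
qed (use assms(1) in \<open>auto simp: additive_def acd_boundary_def op_boundary_def frag_extend_add frag_cmul_distrib2\<close>)

lemma additive_acd_boundary: "additive (acd_boundary star a c d n)"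
  by (auto simp: additive_def acd_boundary_def op_boundary_def frag_extend_add frag_cmul_distrib2)

end

section \<open>Endomorphisms of the spindle and the square of the boundary\<close>

locale pointed_spindle =
  fixes X :: "'a set" and star :: "'a \<Rightarrow> 'a \<Rightarrow> 'a" and e z :: 'a
  assumes spindle: "spindle X star" and unit: "right_unit X star e" and proj: "right_projector X star z"
begin

lemma star_facts [simp]:
  "x \<in> X \<Longrightarrow> y \<in> X \<Longrightarrow> star x y \<in> X" "x \<in> X \<Longrightarrow> star x x = x"
  "e \<in> X" "z \<in> X" "x \<in> X \<Longrightarrow> star x e = x" "x \<in> X \<Longrightarrow> star x z = z"
  using spindle unit proj by (auto simp: spindle_def right_unit_def right_projector_def)

lemma star_distrib: "x \<in> X \<Longrightarrow> y \<in> X \<Longrightarrow> t \<in> X \<Longrightarrow> star (star x y) t = star (star x t) (star y t)"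
  using spindle unfolding spindle_def by blast

abbreviation M where "M \<equiv> top_face star"

abbreviation bdy where "bdy \<equiv> bd star"

lemma top_face_wchains: "w \<in> wchains X k \<Longrightarrow> y \<in> X \<Longrightarrow> M a c d y w \<in> wchains X k"
  unfolding top_face_def
  by (intro wchains_closed) (auto elim!: frag_map_wchains intro!: star_facts(1))

lemma bd_wchains: "w \<in> wchains X (Suc k) \<Longrightarrow> bdy a c d w \<in> wchains X k"
proof -
  have *: "bdy a c d (frag_of xs) \<in> wchains X k" if "length xs = Suc k" "set xs \<subseteq> X" for xs k
    using that
  proof (induction xs arbitrary: k rule: rev_induct)
    case (snoc y xs)
    have "snoc y (bdy a c d (frag_of xs)) \<in> wchains X k"
    proof (cases k)
      case (Suc l)
      then show ?thesis
        using snoc.IH[of l] snoc.prems by (simp add: snoc_wchains)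
    qed (use snoc.prems in simp)
    then show ?case
      using snoc.prems by (simp add: bd_snoc_word top_face_wchains)
  qed simp
  assume "w \<in> wchains X (Suc k)"
  then have "Poly_Mapping.keys w \<subseteq> words X (Suc k)"
    by (simp add: wchains_def)
  then show ?thesis
    by (induction w rule: frag_induction) (auto simp: words_def *)
qed

text \<open>Any map respects the operations \<open>\<lambda>x y. x\<close> and
  \<open>\<lambda>x y. y\<close>, so respecting \<open>star\<close> makes the entrywise map
  compatible with all three boundaries.\<close>

definition endo :: "('a \<Rightarrow> 'a) \<Rightarrow> bool" where
  "endo f \<longleftrightarrow> (\<forall>x\<in>X. f x \<in> X) \<and> (\<forall>x\<in>X. \<forall>y\<in>X. f (star x y) = star (f x) (f y))"

text \<open>Here both spindle axioms enter: self-distributivity for right translations, idempotence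
  for constant maps.\<close>

lemma endo_intros: "endo (\<lambda>x. x)" "y \<in> X \<Longrightarrow> endo (\<lambda>x. star x y)" "y \<in> X \<Longrightarrow> endo (\<lambda>x. y)"
  unfolding endo_def by (intro conjI ballI star_distrib | simp)+

lemma map_top_face:
  assumes f: "endo f" and w: "w \<in> wchains X k" and y: "y \<in> X"
  shows "frag_map (map f) (M a c d y w) = M a c d (f y) (frag_map (map f) w)"
proof -
  have "frag_map (map f \<circ> map (\<lambda>x. star x y)) w = frag_map (map (\<lambda>x. star x (f y)) \<circ> map f) w"
    using w by (rule frag_map_eqI) (use f y in \<open>auto simp: endo_def\<close>)
  moreover have "frag_map (map f \<circ> map (\<lambda>x. y)) w = frag_map (map (\<lambda>x. f y) \<circ> map f) w"
    using w by (rule frag_map_eqI) simp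
  ultimately show ?thesis
    by (simp add: top_face_def frag_map_frag_map)
qed

lemma bd_map_word:
  assumes f: "endo f"
  shows "set xs \<subseteq> X \<Longrightarrow> bdy a c d (frag_of (map f xs)) = frag_map (map f) (bdy a c d (frag_of xs))"
proof (induction xs rule: rev_induct)
  case (snoc y xs)
  have "snoc (f y) (frag_map (map f) w) = frag_map (map f) (snoc y w)" for w
    by (simp add: frag_map_frag_map comp_def)
  moreover have "M a c d (f y) (frag_of (map f xs)) = frag_map (map f) (M a c d y (frag_of xs))"
    using map_top_face[OF f, of "frag_of xs" "length xs" y a c d] snoc.prems by simp
  ultimately show ?case
    using snoc by (simp add: bd_snoc_word)
qed simp

lemma bd_map:
  assumes "endo f" "w \<in> wchains X k"
  shows "bdy a c d (frag_map (map f) w) = frag_map (map f) (bdy a c d w)"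
  using assms(2) by (rule wchains_eqI) (simp_all add: additive_def bd_map_word[OF assms(1)])

text \<open>The three summands of a top face apply the identity, a right translation and a constant
  map entrywise, and all three are endomorphisms.\<close>

lemma bd_top_face:
  assumes "w \<in> wchains X k" "y \<in> X"
  shows "bdy a c d (M a' c' d' y w) = M a' c' d' y (bdy a c d w)"
  using bd_map[OF endo_intros(2)[OF assms(2)] assms(1)] bd_map[OF endo_intros(3)[OF assms(2)] assms(1)]
  by (simp add: top_face_def)

lemma bd_word1: "bdy a c d (frag_of [x]) = frag_cmul (a + c + d) (frag_of [])"
  using bd_snoc_word[of star a c d "[]" x] by (simp add: top_face_def frag_cmul_distrib)

text \<open>Expanding \<open>bd (bd (w y))\<close> for \<open>w\<close> of length \<open>k\<close>
  leaves, besides the induction hypothesis, the term \<open>M_y (bd w)\<close> once with sign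
  \<open>(-1)^(k-1)\<close> and once with \<open>(-1)^k\<close>.\<close>

lemma bd_bd:
  assumes "w \<in> wchains X k"
  shows "bdy a c d (bdy a c d w) = 0"
proof -
  have *: "bdy a c d (bdy a c d (frag_of xs)) = 0" if "set xs \<subseteq> X" for xs
    using that
  proof (induction xs rule: rev_induct)
    case (snoc y xs)
    let ?w = "frag_of xs"
    have w: "?w \<in> wchains X (length xs)" "y \<in> X"
      using snoc.prems by auto
    show ?case
    proof (cases "length xs")
      case 0
      then show ?thesis
        by (simp add: bd_word1)
    next
      case (Suc l)
      then have "bdy a c d ?w \<in> wchains X l"
        using bd_wchains w by simp
      note * = bd_snoc[OF this, of star a c d y]
      show ?thesis
        using snoc bd_top_face[OF w, of a c d a c d]
        by (simp add: bd_snoc_word * Suc flip: frag_cmul_distrib)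
    qed
  qed simp
  show ?thesis
    using assms by (rule wchains_eqI[where g = "\<lambda>_. 0"]) (simp_all add: additive_def *)
qed

subsection \<open>The projection onto the early degenerate part\<close>

text \<open>Meaningful on words of at least two letters only, since \<open>hd (tl xs)\<close> is
  unspecified for shorter ones; hence the lengths \<open>Suc (Suc k)\<close> below.\<close>

abbreviation Q :: "('a list \<Rightarrow>\<^sub>0 int) \<Rightarrow> ('a list \<Rightarrow>\<^sub>0 int)" where
  "Q \<equiv> frag_map (\<lambda>xs. hd (tl xs) # tl xs)"

text \<open>On chains of one fixed length, \<open>R w\<close> is the coefficient sum of
  \<open>w\<close> times the constant word, so \<open>R w = 0\<close> says that this sum
  vanishes.\<close>

abbreviation R :: "('a list \<Rightarrow>\<^sub>0 int) \<Rightarrow> ('a list \<Rightarrow>\<^sub>0 int)" where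
  "R \<equiv> frag_map (map (\<lambda>x. e))"

lemma s0_eq: "s0 = frag_map (\<lambda>xs. hd xs # xs)"
  by (simp add: s0_def frag_map_def comp_def)

lemma Q_wchains: "w \<in> wchains X (Suc (Suc k)) \<Longrightarrow> Q w \<in> wchains X (Suc (Suc k))"
  by (erule frag_map_wchains) (auto simp: length_Suc_conv)

lemma R_wchains: "w \<in> wchains X k \<Longrightarrow> R w \<in> wchains X k"
  by (erule frag_map_wchains) auto

lemma s0_wchains: "w \<in> wchains X (Suc k) \<Longrightarrow> s0 w \<in> wchains X (Suc (Suc k))"
  unfolding s0_eq by (erule frag_map_wchains) (auto simp: length_Suc_conv)

lemma Q_Q: "w \<in> wchains X (Suc (Suc k)) \<Longrightarrow> Q (Q w) = Q w"
  unfolding frag_map_frag_map by (erule frag_map_eqI) (auto simp: length_Suc_conv)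

lemma R_R [simp]: "R (R w) = R w"
  by (simp add: frag_map_frag_map comp_def)

lemma R_Q: "w \<in> wchains X (Suc (Suc k)) \<Longrightarrow> R (Q w) = R w"
  unfolding frag_map_frag_map by (erule frag_map_eqI) (auto simp: length_Suc_conv)

lemma Q_R: "w \<in> wchains X (Suc (Suc k)) \<Longrightarrow> Q (R w) = R w"
  unfolding frag_map_frag_map by (erule frag_map_eqI) (auto simp: length_Suc_conv)

lemma Q_snoc: "w \<in> wchains X (Suc (Suc k)) \<Longrightarrow> Q (snoc y w) = snoc y (Q w)"
  unfolding frag_map_frag_map by (erule frag_map_eqI) (auto simp: length_Suc_conv)

lemma R_snoc: "R (snoc y w) = snoc e (R w)"
  by (simp add: frag_map_frag_map comp_def)

lemma Q_s0: "w \<in> wchains X (Suc k) \<Longrightarrow> Q (s0 w) = s0 w"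
  unfolding s0_eq frag_map_frag_map by (erule frag_map_eqI) simp

lemma Q_eq_s0: "Q w = s0 (frag_map tl w)"
  by (simp add: s0_eq frag_map_frag_map comp_def)

lemma R_s0: "w \<in> wchains X (Suc k) \<Longrightarrow> R (s0 w) = s0 (R w)"
  unfolding s0_eq frag_map_frag_map by (erule frag_map_eqI) (auto simp: length_Suc_conv)

text \<open>An \<open>f\<close> that merely rearranges, repeats or drops positions commutes with
  every entrywise map, and top faces are made of entrywise maps.\<close>

lemma frag_map_top_face:
  assumes w: "w \<in> wchains X k"
    and f: "\<And>g xs. length xs = k \<Longrightarrow> set xs \<subseteq> X \<Longrightarrow> f (map g xs) = map g (f xs)"
  shows "frag_map f (M a c d y w) = M a c d y (frag_map f w)"
proof -
  have "frag_map (f \<circ> map g) w = frag_map (map g \<circ> f) w" for g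
    using w by (rule frag_map_eqI) (simp add: f)
  then show ?thesis
    by (simp add: top_face_def frag_map_frag_map)
qed

lemma Q_top_face: "w \<in> wchains X (Suc (Suc k)) \<Longrightarrow> Q (M a c d y w) = M a c d y (Q w)"
  by (erule frag_map_top_face) (auto simp: length_Suc_conv)

lemma s0_top_face: "w \<in> wchains X (Suc k) \<Longrightarrow> s0 (M a c d y w) = M a c d y (s0 w)"
  unfolding s0_eq by (erule frag_map_top_face) (auto simp: length_Suc_conv)

lemma s0_snoc: "w \<in> wchains X (Suc k) \<Longrightarrow> s0 (snoc y w) = snoc y (s0 w)"
  unfolding s0_eq frag_map_frag_map by (erule frag_map_eqI) (auto simp: length_Suc_conv)

text \<open>The parameter \<open>d\<close> drops out: for the operation
  \<open>\<lambda>x y. y\<close> both faces of \<open>[x, y]\<close> are \<open>[y]\<close>.\<close>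

lemma bd_word2:
  "bdy a c d (frag_of [x, y]) =
     frag_cmul (a + c) (frag_of [y]) - frag_cmul a (frag_of [x]) - frag_cmul c (frag_of [star x y])"
  using bd_snoc_word[of star a c d "[x]" y]
  by (simp add: bd_word1 top_face_def frag_cmul_distrib algebra_simps flip: minus_frag_cmul)

text \<open>By idempotence the coefficients in the boundary of \<open>[y, y]\<close> cancel.
  Therefore \<open>Q\<close>, continued by zero in degree \<open>0\<close>, is a chain map.\<close>

lemma bd_Q1: "w \<in> wchains X (Suc (Suc 0)) \<Longrightarrow> bdy a c d (Q w) = 0"
  by (erule wchains_eqI[where g = "\<lambda>_. 0"])
    (auto simp: additive_def length_Suc_conv bd_word2 frag_cmul_distrib)

text \<open>\<open>Q\<close> commutes with appending a letter only if two letters are already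
  present. This puts the base case at length three and forces the direct computation there.\<close>

lemma bd_Q:
  assumes "w \<in> wchains X (Suc (Suc (Suc k)))"
  shows "bdy a c d (Q w) = Q (bdy a c d w)"
proof -
  have *: "bdy a c d (Q (frag_of xs)) = Q (bdy a c d (frag_of xs))"
    if "length xs = Suc (Suc (Suc k))" "set xs \<subseteq> X" for xs k
    using that
  proof (induction k arbitrary: xs)
    case 0
    then obtain x y t where xs: "xs = [x, y] @ [t]"
      by (auto simp: length_Suc_conv)
    have w: "frag_of [x, y] \<in> wchains X (Suc (Suc 0))"
      using 0 xs by simp
    have "bdy a c d (frag_of [y, y]) = 0"
      using 0 xs by (simp add: bd_word2 frag_cmul_distrib)
    \<comment> \<open>On two-letter words \<open>Q\<close> forgets the first letter, so only the
      coefficient sum \<open>(a + c) - a - c\<close> survives.\<close>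
    moreover have "Q (snoc t (bdy a c d (frag_of [x, y]))) = 0"
      by (simp add: bd_word2 frag_cmul_distrib)
    ultimately show ?case
      using bd_snoc_word[of star a c d "[y, y]" t] Q_top_face[OF w, of a c d t] bd_snoc_word[of star a c d "[x, y]" t]
      unfolding xs by simp
  next
    case (Suc k)
    obtain ys y where xs: "xs = ys @ [y]" "length ys = Suc (Suc (Suc k))"
      using Suc.prems(1) by (rule length_Suc_snocE)
    then have w: "frag_of ys \<in> wchains X (Suc (Suc (Suc k)))"
      using Suc.prems by simp
    have "Q (frag_of xs) = snoc y (Q (frag_of ys))"
      using Q_snoc[OF w, of y] xs by simp
    then show ?case
      using Suc.IH[of ys] Suc.prems xs bd_snoc[OF Q_wchains[OF w], of star a c d y]
        Q_top_face[OF w, of a c d y] Q_snoc[OF bd_wchains[OF w], of y a c d]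
      by (simp add: bd_snoc_word)
  qed
  show ?thesis
    using assms by (rule wchains_eqI) (simp_all add: additive_def * del: frag_map_simps(1))
qed

lemma bd_s0:
  assumes "w \<in> wchains X (Suc (Suc k))" "Q w = w"
  shows "bdy a c d (s0 w) + s0 (bdy a c d w) = frag_cmul (a + c + d) w"
proof -
  have *: "bdy a c d (s0 (frag_of xs)) + s0 (bdy a c d (frag_of xs)) = frag_cmul (a + c + d) (frag_of xs)"
    if "xs = x # x # ys" "set xs \<subseteq> X" for xs x ys
    using that
  proof (induction ys arbitrary: xs rule: rev_induct)
    case Nil
    then have "bdy a c d (frag_of [x, x]) = 0"
      by (simp add: bd_word2 frag_cmul_distrib)
    then show ?case
      using Nil bd_snoc_word[of star a c d "[x, x]" x] by (simp add: s0_eq top_face_def frag_cmul_distrib)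
  next
    case (snoc y ys)
    let ?w = "frag_of (x # x # ys)"
    have w: "?w \<in> wchains X (Suc (Suc (length ys)))"
      using snoc.prems by simp
    have IH: "bdy a c d (s0 ?w) + s0 (bdy a c d ?w) = frag_cmul (a + c + d) ?w"
      using snoc by simp
    have xs: "frag_of xs = snoc y ?w"
      using snoc.prems by simp
    \<comment> \<open>The two top-face terms cancel: \<open>s0\<close> lengthens the word by one, so
      they carry opposite signs.\<close>
    have "bdy a c d (s0 (frag_of xs)) + s0 (bdy a c d (frag_of xs)) =
        snoc y (bdy a c d (s0 ?w) + s0 (bdy a c d ?w))"
      unfolding xs s0_snoc[OF w] bd_snoc[OF s0_wchains[OF w]] bd_snoc[OF w]
      using s0_snoc[OF bd_wchains[OF w], of y a c d] s0_top_face[OF w, of a c d y]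
      by (simp add: s0_eq flip: minus_frag_cmul)
    then show ?case
      unfolding IH xs by simp
  qed
  \<comment> \<open>With \<open>Q w\<close> in place of \<open>w\<close> both sides are additive in
    an unrestricted \<open>w\<close>, so words suffice.\<close>
  have "bdy a c d (s0 (Q w)) + s0 (bdy a c d (Q w)) = frag_cmul (a + c + d) (Q w)"
    using assms(1)
  proof (rule wchains_eqI)
    fix xs assume "length xs = Suc (Suc k)" "set xs \<subseteq> X"
    then show "bdy a c d (s0 (Q (frag_of xs))) + s0 (bdy a c d (Q (frag_of xs))) = frag_cmul (a + c + d) (Q (frag_of xs))"
      using *[of "hd (tl xs) # tl xs" "hd (tl xs)" "tl (tl xs)"] by (auto simp: length_Suc_conv)
  qed (simp_all add: additive_def s0_eq frag_cmul_distrib2)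
  then show ?thesis
    using assms(2) by simp
qed

section \<open>The \<open>d\<close>-part of the boundary, and top faces at the unit and at the
  projector\<close>

lemma bd_tilde1: "w \<in> wchains X (Suc (Suc 0)) \<Longrightarrow> bdy 0 0 d w = 0"
  by (erule wchains_eqI[where g = "\<lambda>_. 0"]) (auto simp: additive_def length_Suc_conv bd_word2)

text \<open>For the operation \<open>\<lambda>x y. y\<close> the faces of index \<open>0\<close> and
  \<open>1\<close> coincide and cancel, and every later face begins with two equal letters.\<close>

lemma Q_bd_tilde:
  assumes "w \<in> wchains X (Suc (Suc (Suc k)))"
  shows "Q (bdy 0 0 d w) = bdy 0 0 d w"
proof -
  have *: "Q (bdy 0 0 d (frag_of xs)) = bdy 0 0 d (frag_of xs)"
    if "length xs = Suc (Suc (Suc k))" "set xs \<subseteq> X" for xs k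
    using that
  proof (induction k arbitrary: xs)
    case 0
    then obtain x y t where xs: "xs = [x, y] @ [t]"
      by (auto simp: length_Suc_conv)
    show ?case
      using bd_snoc_word[of star 0 0 d "[x, y]" t] unfolding xs by (simp add: bd_word2 top_face_def)
  next
    case (Suc k)
    obtain ys y where xs: "xs = ys @ [y]" "length ys = Suc (Suc (Suc k))"
      using Suc.prems(1) by (rule length_Suc_snocE)
    then have w: "frag_of ys \<in> wchains X (Suc (Suc (Suc k)))"
      using Suc.prems by simp
    have "Q (M 0 0 d y (frag_of ys)) = M 0 0 d y (frag_of ys)"
      using xs(2) by (auto simp: top_face_def length_Suc_conv)
    then show ?case
      using Suc.IH[of ys] Suc.prems xs Q_snoc[OF bd_wchains[OF w], of y 0 0 d] by (simp add: bd_snoc_word)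
  qed
  show ?thesis
    using assms by (rule wchains_eqI) (simp_all add: additive_def *)
qed

lemma bd_split: "bdy a c d w = bdy a c 0 w + bdy 0 0 d w"
proof -
  have "Poly_Mapping.keys w \<subseteq> UNIV" by simp
  then show ?thesis
    by (rule additive_eqI[rotated 2])
      (simp_all add: additive_def bd_def face_def frag_cmul_distrib2 frag_extend_add sum.distrib)
qed

lemma bd_cmul: "bdy (g * a) (g * c) (g * d) w = frag_cmul g (bdy a c d w)"
proof -
  have "Poly_Mapping.keys w \<subseteq> UNIV" by simp
  then show ?thesis
    by (rule additive_eqI[rotated 2])
      (simp_all add: additive_def bd_def face_def frag_cmul_distrib2 frag_extend_add sum.distrib frag_cmul_sum mult_ac)
qed

text \<open>At \<open>y = e\<close> the \<open>c\<close>-term is \<open>c w\<close> by the unit law,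
  and the \<open>d\<close>-term is a multiple of \<open>R w\<close>.\<close>

lemma top_face_unit:
  assumes "w \<in> wchains X k" "R w = 0"
  shows "M a c d e w = frag_cmul (a + c) w"
proof -
  have "frag_map (map (\<lambda>x. star x e)) w = w"
    using frag_map_eqI[OF assms(1), of "map (\<lambda>x. star x e)" "\<lambda>xs. xs"]
    by (simp add: frag_map_id map_idI subset_iff)
  then show ?thesis
    using assms(2) by (simp add: top_face_def frag_cmul_distrib)
qed

text \<open>As \<open>x * z = z\<close>, the \<open>c\<close>- and the \<open>d\<close>-term both
  come from the constant map to \<open>z\<close>, which factors through \<open>R\<close>.\<close>

lemma top_face_projector:
  assumes "w \<in> wchains X k" "R w = 0"
  shows "M a c d z w = frag_cmul a w"
proof -
  have "frag_map (map (\<lambda>x. z)) w = frag_map (map (\<lambda>x. z)) (R w)"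
    by (simp add: frag_map_frag_map comp_def)
  then have "frag_map (map (\<lambda>x. z)) w = 0"
    using assms(2) by simp
  moreover have "frag_map (map (\<lambda>x. star x z)) w = frag_map (map (\<lambda>x. z)) w"
    using assms(1) by (rule frag_map_eqI) auto
  ultimately show ?thesis
    by (simp add: top_face_def)
qed

lemma bd_R: "w \<in> wchains X k \<Longrightarrow> bdy a c d (R w) = R (bdy a c d w)"
  by (rule bd_map[OF endo_intros(3)]) auto

text \<open>\<open>R\<close> fixes the empty word, so \<open>bd w = R (bd w) = bd (R w) = 0\<close>.
  Thus the augmentation contained in \<open>bd\<close> does no harm to reduced chains in degree
  \<open>0\<close>.\<close>

lemma bd_reduced1:
  assumes "w \<in> wchains X (Suc 0)" "R w = 0"
  shows "bdy a c d w = 0"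
proof -
  have "R (bdy a c d w) = frag_map (\<lambda>xs. xs) (bdy a c d w)"
    using bd_wchains[OF assms(1)] by (rule frag_map_eqI) simp
  then show ?thesis
    using bd_R[OF assms(1), of a c d] assms(2) by (simp add: frag_map_id)
qed

end

subsection \<open>The three summands\<close>

abbreviation frag_group :: "('b \<Rightarrow>\<^sub>0 int) set \<Rightarrow> ('b \<Rightarrow>\<^sub>0 int) monoid" where
  "frag_group H \<equiv> (free_Abelian_group UNIV)\<lparr>carrier := H\<rparr>"

lemma subgroup_frag:
  assumes "0 \<in> H" "\<And>v w. v \<in> H \<Longrightarrow> w \<in> H \<Longrightarrow> v - w \<in> H"
  shows "subgroup H (free_Abelian_group UNIV)"
proof (rule group.subgroupI[OF group_free_Abelian_group])
  have neg: "- v \<in> H" if "v \<in> H" for v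
    using assms(2)[OF assms(1) that] by simp
  then show "inv\<^bsub>free_Abelian_group UNIV\<^esub> v \<in> H" if "v \<in> H" for v
    using that by simp
  show "v \<otimes>\<^bsub>free_Abelian_group UNIV\<^esub> w \<in> H" if "v \<in> H" "w \<in> H" for v w
    using assms(2)[OF that(1) neg[OF that(2)]] by simp
qed (use assms(1) in auto)

lemma chains_eq: "chains X n = frag_group (wchains X (Suc n))"
  by (auto simp: chains_def free_Abelian_group_def wchains_def words_def tuples_def)

lemma chains_rank:
  assumes "finite X"
  shows "chains X n \<cong> ivec (card X ^ Suc n)"
proof -
  have "tuples X n = {xs. set xs \<subseteq> X \<and> length xs = Suc n}"
    by (auto simp: tuples_def)
  then have "finite (tuples X n)" "card (tuples X n) = card X ^ Suc n"
    using assms finite_lists_length_eq card_lists_length_eq by metis+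
  then have "tuples X n \<approx> {..<card X ^ Suc n}"
    by (simp add: eqpoll_iff_card)
  then show ?thesis
    unfolding chains_def using isomorphic_free_Abelian_groups free_Abelian_group_iso_ivec iso_trans by blast
qed

text \<open>\<open>p\<close> retracts \<open>H\<close> onto \<open>H'\<close>. The kernel is free of
  some rank \<open>l\<close>, being a subgroup of a free group, and \<open>k = l + k'\<close> by
  uniqueness of ranks; in particular \<open>k - k'\<close> is not truncated.\<close>

lemma rank_kernel_projection:
  assumes H: "subgroup H (free_Abelian_group UNIV)" and H': "subgroup H' (free_Abelian_group UNIV)"
    and "frag_group H \<cong> ivec k" "frag_group H' \<cong> ivec k'"
    and p: "additive p" "\<And>w. w \<in> H \<Longrightarrow> p w \<in> H'" "\<And>w. w \<in> H' \<Longrightarrow> w \<in> H \<and> p w = w"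
  shows "frag_group {w \<in> H. p w = 0} \<cong> ivec (k - k')"
proof -
  note cg = comm_group_subgroup[OF abelian_free_Abelian_group]
  have ker: "kernel (frag_group H) (frag_group H') p = {w \<in> H. p w = 0}"
    by (simp add: kernel_def)
  have hom: "p \<in> hom (frag_group H) (frag_group H')"
    using p by (auto simp: hom_def additive_def)
  then have "group_hom (frag_group H) (frag_group H') p"
    using cg[OF H] cg[OF H'] by (simp add: group_hom_def group_hom_axioms_def comm_group.axioms)
  then have "subgroup {w \<in> H. p w = 0} (frag_group H)"
    unfolding ker[symmetric] by (rule group_hom.subgroup_kernel)
  then obtain l where l: "frag_group {w \<in> H. p w = 0} \<cong> ivec l"
    using subgroup_free[OF comm_group.axioms(2)[OF cg[OF H]] assms(3)] by auto
  have "frag_group H \<cong> ivec (l + k')"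
    by (rule rank_extension[where T = "frag_group H'" and p = p and \<sigma> = "\<lambda>w. w"])
      (use cg[OF H] comm_group.axioms(2)[OF cg[OF H']] hom p(3) l ker assms(4) in \<open>auto simp: hom_def\<close>)
  then have "k = l + k'"
    using rank_unique[OF comm_group.axioms(2)[OF cg[OF H]] assms(3)] by blast
  then show ?thesis
    using l by simp
qed

context pointed_spindle
begin

text \<open>The value in degree \<open>0\<close> matches the convention
  \<open>F0_chains X 0 = {0}\<close>.\<close>

definition proj :: "nat \<Rightarrow> ('a list \<Rightarrow>\<^sub>0 int) \<Rightarrow> ('a list \<Rightarrow>\<^sub>0 int)" where
  "proj n w = (if n = 0 then 0 else Q w)"

text \<open>A complement of the point chains, hence a model of the reduced complex without cosets.
  Below, \<open>early\<close> is a fixed-point description of \<open>F0_chains\<close>, and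
  \<open>deg\<close> and \<open>nondeg\<close> are the image and the kernel of \<open>proj\<close>
  inside \<open>red\<close>.\<close>

definition red where "red n = {w \<in> wchains X (Suc n). R w = 0}"

definition early where "early n = {w \<in> wchains X (Suc n). proj n w = w}"

definition deg where "deg n = {w \<in> early n. R w = 0}"

definition nondeg where "nondeg n = {w \<in> red n. proj n w = 0}"

lemma proj_diff: "proj n (v - w) = proj n v - proj n w" and proj_0: "proj n 0 = 0"
  by (simp_all add: proj_def)

lemma proj_wchains: "w \<in> wchains X (Suc n) \<Longrightarrow> proj n w \<in> wchains X (Suc n)"
  by (cases n) (simp_all add: proj_def Q_wchains)

lemma proj_proj: "w \<in> wchains X (Suc n) \<Longrightarrow> proj n (proj n w) = proj n w"
  by (cases n) (simp_all add: proj_def Q_Q)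

lemma bd_proj: "w \<in> wchains X (Suc (Suc n)) \<Longrightarrow> bdy a c d (proj (Suc n) w) = proj n (bdy a c d w)"
  by (cases n) (simp_all add: proj_def bd_Q1 bd_Q)

lemma point_chains_eq: "point_chains e n = {w \<in> wchains X (Suc n). R w = w}"
proof -
  have "w \<in> wchains X (Suc n) \<and> R w = w" if w: "w \<in> wchains {e} (Suc n)" for w
  proof
    have "frag_map (\<lambda>xs. xs) w \<in> wchains X (Suc n)"
      using w by (rule frag_map_wchains) (use star_facts(3) in blast)
    then show "w \<in> wchains X (Suc n)"
      by (simp add: frag_map_id)
    show "R w = w"
      using frag_map_eqI[OF w, of "map (\<lambda>x. e)" "\<lambda>xs. xs"] by (auto simp: frag_map_id intro: map_idI)
  qed
  moreover have "R w \<in> wchains {e} (Suc n)" if "w \<in> wchains X (Suc n)" for w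
    using that by (rule frag_map_wchains) auto
  ultimately show ?thesis
    by (auto simp: point_chains_def chains_eq) metis
qed

lemma early_eq: "F0_chains X n = early n"
proof (cases n)
  case 0
  then show ?thesis by (auto simp: F0_chains_def early_def proj_def)
next
  case (Suc k)
  have "w \<in> s0 ` wchains X (Suc k)" if "w \<in> wchains X (Suc (Suc k))" "Q w = w" for w
  proof (rule image_eqI)
    show "w = s0 (frag_map tl w)"
      using that(2) Q_eq_s0 by simp
    show "frag_map tl w \<in> wchains X (Suc k)"
      using that(1) by (rule frag_map_wchains) (auto simp: length_Suc_conv)
  qed
  then show ?thesis
    using Suc by (auto simp: F0_chains_def early_def proj_def chains_eq s0_wchains Q_s0)
qed

lemma subgroups:
  "subgroup (wchains X k) (free_Abelian_group UNIV)"
  "subgroup (point_chains e n) (free_Abelian_group UNIV)"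
  "subgroup (red n) (free_Abelian_group UNIV)"
  "subgroup (early n) (free_Abelian_group UNIV)"
  "subgroup (deg n) (free_Abelian_group UNIV)"
  "subgroup (nondeg n) (free_Abelian_group UNIV)"
  unfolding point_chains_eq red_def early_def deg_def nondeg_def
  by (auto intro!: subgroup_frag simp: proj_diff proj_0)

lemma subgroup_inside:
  assumes "subgroup H (free_Abelian_group UNIV)" "subgroup H' (free_Abelian_group UNIV)" "H' \<subseteq> H"
  shows "subgroup H' (frag_group H)"
  using group.subgroup_incl[OF group_free_Abelian_group assms(2,1,3)] .

lemma bd_red: "w \<in> red (Suc n) \<Longrightarrow> bdy a c d w \<in> red n"
  using bd_wchains bd_R[of w "Suc (Suc n)" a c d] by (simp add: red_def)

lemma bd_point: "w \<in> point_chains e (Suc n) \<Longrightarrow> bdy a c d w \<in> point_chains e n"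
  using bd_wchains bd_R[of w "Suc (Suc n)" a c d] by (simp add: point_chains_eq)

lemma bd_deg: "w \<in> deg (Suc n) \<Longrightarrow> bdy a c d w \<in> deg n"
  using bd_wchains bd_R[of w "Suc (Suc n)" a c d] bd_proj[of w n a c d] by (simp add: deg_def early_def)

lemma bd_nondeg: "w \<in> nondeg (Suc n) \<Longrightarrow> bdy a c d w \<in> nondeg n"
  using bd_red[of w n a c d] bd_proj[of w n a c d] by (simp add: nondeg_def red_def)

lemma complex_simps [simp]:
  "grp (spindle_cpx X star a c d) n = frag_group (wchains X (Suc n))"
  "bdry (spindle_cpx X star a c d) = acd_boundary star a c d"
  "grp (subcpx C S) n = (grp C n)\<lparr>carrier := S n\<rparr>"
  "bdry (subcpx C S) = bdry C"
  by (simp_all add: spindle_cpx_def chains_eq subcpx_def)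

lemma acd_bd: "w \<in> wchains X (Suc (Suc n)) \<Longrightarrow> acd_boundary star a c d (Suc n) w = bdy a c d w"
  by (rule acd_boundary_eq_bd) simp_all

lemma chain_complex_spindle: "chain_complex (spindle_cpx X star a c d)"
  unfolding chain_complex_def
proof (intro conjI allI impI ballI)
  fix n
  show "comm_group (grp (spindle_cpx X star a c d) n)"
    using comm_group_subgroup[OF abelian_free_Abelian_group subgroups(1)] by simp
  show "bdry (spindle_cpx X star a c d) n
      \<in> hom (grp (spindle_cpx X star a c d) n) (grp (spindle_cpx X star a c d) (n - 1))" if n: "1 \<le> n"
  proof -
    obtain k where "n = Suc k" using n by (cases n) auto
    then show ?thesis
      using additive.add[OF additive_acd_boundary] by (auto simp: hom_def acd_bd bd_wchains)
  qed
  show "bdry (spindle_cpx X star a c d) (n - 1) (bdry (spindle_cpx X star a c d) n w) =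
      \<one>\<^bsub>grp (spindle_cpx X star a c d) (n - 2)\<^esub>"
    if n: "2 \<le> n" and "w \<in> carrier (grp (spindle_cpx X star a c d) n)" for w
  proof -
    obtain k where "n = Suc (Suc k)"
      using n by (metis add_2_eq_Suc le_Suc_ex)
    then show ?thesis
      using that(2) by (simp add: acd_bd bd_wchains bd_bd)
  qed
qed

lemma subcomplex_spindle:
  assumes "\<And>n. subgroup (S n) (free_Abelian_group UNIV)" "\<And>n. S n \<subseteq> T n"
    and T: "\<And>n. subgroup (T n) (free_Abelian_group UNIV)" "\<And>n. T n \<subseteq> wchains X (Suc n)"
    and "\<And>n w. w \<in> S (Suc n) \<Longrightarrow> bdy a c d w \<in> S n"
  shows "subcomplex (subcpx (spindle_cpx X star a c d) T) S"
  unfolding subcomplex_def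
proof (intro conjI allI impI ballI)
  show "subgroup (S n) (grp (subcpx (spindle_cpx X star a c d) T) n)" for n
    using subgroup_inside[OF T(1) assms(1,2), of n] by simp
  fix n w assume n: "1 \<le> n" and w: "w \<in> S n"
  obtain k where "n = Suc k" using n by (cases n) auto
  then show "bdry (subcpx (spindle_cpx X star a c d) T) n w \<in> S (n - 1)"
    using w assms(2)[of n] T(2)[of n] assms(5)[of w k] by (auto simp: acd_bd subset_iff)
qed

lemma spindle_subcpx_wchains:
  "subcpx (spindle_cpx X star a c d) (\<lambda>n. wchains X (Suc n)) = spindle_cpx X star a c d"
proof -
  have "chains X = (\<lambda>n. frag_group (wchains X (Suc n)))"
    by (rule ext) (rule chains_eq)
  then show ?thesis
    by (simp add: subcpx_def spindle_cpx_def)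
qed

lemma subcomplexes:
  "subcomplex (spindle_cpx X star a c d) (point_chains e)"
  "subcomplex (spindle_cpx X star a c d) red"
  "subcomplex (subcpx (spindle_cpx X star a c d) red) deg"
  "subcomplex (subcpx (spindle_cpx X star a c d) red) nondeg"
proof -
  have "subcomplex (subcpx (spindle_cpx X star a c d) (\<lambda>n. wchains X (Suc n))) (point_chains e)"
    by (rule subcomplex_spindle[OF subgroups(2) _ subgroups(1) _ bd_point]) (auto simp: point_chains_eq)
  then show "subcomplex (spindle_cpx X star a c d) (point_chains e)"
    by (simp only: spindle_subcpx_wchains)
  have "subcomplex (subcpx (spindle_cpx X star a c d) (\<lambda>n. wchains X (Suc n))) red"
    by (rule subcomplex_spindle[OF subgroups(3) _ subgroups(1) _ bd_red]) (auto simp: red_def)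
  then show "subcomplex (spindle_cpx X star a c d) red"
    by (simp only: spindle_subcpx_wchains)
  show "subcomplex (subcpx (spindle_cpx X star a c d) red) deg"
    by (rule subcomplex_spindle[OF subgroups(5) _ subgroups(3) _ bd_deg])
      (auto simp: red_def deg_def early_def)
  show "subcomplex (subcpx (spindle_cpx X star a c d) red) nondeg"
    by (rule subcomplex_spindle[OF subgroups(6) _ subgroups(3) _ bd_nondeg])
      (auto simp: red_def nondeg_def)
qed

lemma complementary_point_red: "complementary (spindle_cpx X star a c d) (point_chains e) red"
  unfolding complementary_def
proof (intro conjI allI ballI)
  show "point_chains e n \<inter> red n \<subseteq> {\<one>\<^bsub>grp (spindle_cpx X star a c d) n\<^esub>}" for n
    by (auto simp: point_chains_eq red_def)
  fix n w assume "w \<in> carrier (grp (spindle_cpx X star a c d) n)"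
  then have w: "w \<in> wchains X (Suc n)" by simp
  show "\<exists>v\<in>point_chains e n. \<exists>u\<in>red n. w = v \<otimes>\<^bsub>grp (spindle_cpx X star a c d) n\<^esub> u"
    by (intro bexI[of _ "R w"] bexI[of _ "w - R w"])
      (use w R_wchains in \<open>auto simp: point_chains_eq red_def\<close>)
qed

lemma R_proj: "w \<in> red n \<Longrightarrow> R (proj n w) = 0"
  by (cases n) (auto simp: proj_def red_def R_Q)

lemma complementary_deg_nondeg: "complementary (subcpx (spindle_cpx X star a c d) red) deg nondeg"
  unfolding complementary_def
proof (intro conjI allI ballI)
  show "deg n \<inter> nondeg n \<subseteq> {\<one>\<^bsub>grp (subcpx (spindle_cpx X star a c d) red) n\<^esub>}" for n
    by (auto simp: deg_def early_def nondeg_def)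
  fix n w assume "w \<in> carrier (grp (subcpx (spindle_cpx X star a c d) red) n)"
  then have w: "w \<in> red n" by simp
  have "proj n w \<in> deg n" "w - proj n w \<in> nondeg n"
    using w R_proj[OF w] proj_wchains[of w n] proj_proj[of w n]
    by (auto simp: deg_def early_def nondeg_def red_def proj_diff)
  then show "\<exists>v\<in>deg n. \<exists>u\<in>nondeg n. w = v \<otimes>\<^bsub>grp (subcpx (spindle_cpx X star a c d) red) n\<^esub> u"
    by (intro bexI[of _ "proj n w"] bexI[of _ "w - proj n w"]) simp_all
qed

text \<open>Modulo point chains \<open>w\<close> and \<open>w - R w\<close> agree, and in positive
  degree the constant word \<open>R w\<close> is itself early degenerate. So every class of an early
  chain has a representative in \<open>deg\<close>.\<close>

lemma F0_red_chains_eq: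
  "F0_red_chains X e n = (\<lambda>w. point_chains e n #>\<^bsub>grp (spindle_cpx X star a c d) n\<^esub> w) ` deg n"
proof -
  let ?cos = "\<lambda>w. point_chains e n #>\<^bsub>frag_group (wchains X (Suc n))\<^esub> w"
  have cos: "?cos w = (\<lambda>p. p + w) ` point_chains e n" for w
    by (auto simp: r_coset_def)
  have "?cos w \<in> ?cos ` deg n" if w: "w \<in> early n" for w
  proof (cases n)
    case 0
    then have "w \<in> deg n"
      using w by (auto simp: deg_def early_def proj_def)
    then show ?thesis by blast
  next
    case (Suc k)
    then have w': "w \<in> wchains X (Suc n)" "Q w = w"
      using w by (auto simp: early_def proj_def)
    then have "w - R w \<in> deg n"
      using Suc R_wchains Q_R by (auto simp: deg_def early_def proj_def)
    moreover have "?cos w = ?cos (w - R w)"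
      unfolding cos
    proof
      have Rw: "R w \<in> point_chains e n"
        using w' R_wchains by (simp add: point_chains_eq)
      show "(\<lambda>p. p + w) ` point_chains e n \<subseteq> (\<lambda>p. p + (w - R w)) ` point_chains e n"
      proof clarify
        fix p assume "p \<in> point_chains e n"
        then have "p + R w \<in> point_chains e n"
          using Rw by (auto simp: point_chains_eq)
        then show "p + w \<in> (\<lambda>p. p + (w - R w)) ` point_chains e n"
          by (intro image_eqI[of _ _ "p + R w"]) auto
      qed
      show "(\<lambda>p. p + (w - R w)) ` point_chains e n \<subseteq> (\<lambda>p. p + w) ` point_chains e n"
      proof clarify
        fix p assume "p \<in> point_chains e n"
        then have "p - R w \<in> point_chains e n"
          using Rw by (auto simp: point_chains_eq)
        then show "p + (w - R w) \<in> (\<lambda>p. p + w) ` point_chains e n"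
          by (intro image_eqI[of _ _ "p - R w"]) auto
      qed
    qed
    ultimately show ?thesis by blast
  qed
  then have "?cos ` early n = ?cos ` deg n"
    by (auto simp: deg_def)
  then show ?thesis
    by (simp add: F0_red_chains_def early_eq chains_eq)
qed

text \<open>The coset map on \<open>red\<close> carries the decomposition into \<open>deg\<close>
  and \<open>nondeg\<close> over to the reduced complex. There \<open>F0_red_chains\<close> is the
  image of \<open>deg\<close>, so the second quotient is isomorphic to the image of
  \<open>nondeg\<close>.\<close>

lemma summand_complexes:
  shows "chain_complex (F0_red_cpx X star a c d e)"
    and "chain_complex (eN_red_cpx X star a c d e)"
    and "isomorphic_cpx (subcpx (spindle_cpx X star a c d) deg) (F0_red_cpx X star a c d e)"
    and "isomorphic_cpx (subcpx (spindle_cpx X star a c d) nondeg) (eN_red_cpx X star a c d e)"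
proof -
  let ?C = "spindle_cpx X star a c d"
  let ?f = "\<lambda>n w. point_chains e n #>\<^bsub>grp ?C n\<^esub> w"
  let ?D = "reduced_cpx X star a c d e"
  have C1: "chain_complex (subcpx ?C red)"
    using chain_complex_subcpx[OF chain_complex_spindle subcomplexes(2)] .
  have D: "chain_complex ?D"
    unfolding reduced_cpx_def
    using chain_complex_quotcpx[OF chain_complex_spindle subcomplexes(1,2) complementary_point_red] .
  have f: "cpx_iso ?f (subcpx ?C red) ?D"
    unfolding reduced_cpx_def
    using cpx_iso_quotcpx[OF chain_complex_spindle subcomplexes(1,2) complementary_point_red] .
  have F0: "F0_red_chains X e = (\<lambda>n. ?f n ` deg n)"
    using F0_red_chains_eq by (intro ext) blast
  note deg = cpx_iso_restrict[OF C1 D f subcomplexes(3)]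
  note nondeg = cpx_iso_restrict[OF C1 D f subcomplexes(4)]
  have compl: "complementary ?D (F0_red_chains X e) (\<lambda>n. ?f n ` nondeg n)"
    unfolding F0 using complementary_image[OF C1 f subcomplexes(3,4) complementary_deg_nondeg D] .
  have sub: "subcomplex ?D (F0_red_chains X e)"
    unfolding F0 by (rule deg(2))
  show "chain_complex (F0_red_cpx X star a c d e)"
    unfolding F0_red_cpx_def using chain_complex_subcpx[OF D sub] .
  show "chain_complex (eN_red_cpx X star a c d e)"
    unfolding eN_red_cpx_def using chain_complex_quotcpx[OF D sub nondeg(2) compl] .
  show "isomorphic_cpx (subcpx ?C deg) (F0_red_cpx X star a c d e)"
    using deg(1) unfolding F0_red_cpx_def F0 isomorphic_cpx_iff by auto
  show "isomorphic_cpx (subcpx ?C nondeg) (eN_red_cpx X star a c d e)"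
    using cpx_iso_trans[OF nondeg(1) cpx_iso_quotcpx[OF D sub nondeg(2) compl]]
    unfolding eN_red_cpx_def isomorphic_cpx_iff by auto
qed

lemma chain_complex_point: "chain_complex (point_cpx X star a c d e)"
  unfolding point_cpx_def using chain_complex_subcpx[OF chain_complex_spindle subcomplexes(1)] .

lemma splitting:
  "isomorphic_cpx (spindle_cpx X star a c d)
     (dsumcpx (point_cpx X star a c d e) (dsumcpx (F0_red_cpx X star a c d e) (eN_red_cpx X star a c d e)))"
proof -
  let ?C = "spindle_cpx X star a c d"
  have C1: "chain_complex (subcpx ?C red)"
    using chain_complex_subcpx[OF chain_complex_spindle subcomplexes(2)] .
  have AB: "chain_complex (subcpx ?C deg)" "chain_complex (subcpx ?C nondeg)"
    using chain_complex_subcpx[OF C1 subcomplexes(3)] chain_complex_subcpx[OF C1 subcomplexes(4)] by simp_all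
  have P_R: "isomorphic_cpx ?C (dsumcpx (point_cpx X star a c d e) (subcpx ?C red))"
    unfolding point_cpx_def
    using isomorphic_dsumcpx_complementary[OF chain_complex_spindle subcomplexes(1,2) complementary_point_red] .
  have A_B: "isomorphic_cpx (subcpx ?C red) (dsumcpx (subcpx ?C deg) (subcpx ?C nondeg))"
    using isomorphic_dsumcpx_complementary[OF C1 subcomplexes(3,4) complementary_deg_nondeg] by simp
  have "isomorphic_cpx (subcpx ?C red) (dsumcpx (F0_red_cpx X star a c d e) (eN_red_cpx X star a c d e))"
    using isomorphic_cpx_trans[OF A_B isomorphic_dsumcpx[OF AB summand_complexes(3,4)]] .
  then show ?thesis
    using isomorphic_cpx_trans[OF P_R isomorphic_dsumcpx[OF chain_complex_point C1 isomorphic_cpx_refl]] by blast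
qed

subsection \<open>Homology of the three summands\<close>

lemma frag_complex_deg: "frag_complex (subcpx (spindle_cpx X star a c d) deg) deg"
  using chain_complex_subcpx[OF chain_complex_subcpx[OF chain_complex_spindle subcomplexes(2)] subcomplexes(3)]
  by (intro frag_complex.intro) (simp_all add: subgroups additive_acd_boundary)

lemma frag_complex_nondeg: "frag_complex (subcpx (spindle_cpx X star a c d) nondeg) nondeg"
  using chain_complex_subcpx[OF chain_complex_subcpx[OF chain_complex_spindle subcomplexes(2)] subcomplexes(4)]
  by (intro frag_complex.intro) (simp_all add: subgroups additive_acd_boundary)

lemma deg_0: "deg 0 = {0}"
  by (auto simp: deg_def early_def proj_def)

lemma deg_Suc: "w \<in> deg (Suc n) \<longleftrightarrow> w \<in> wchains X (Suc (Suc n)) \<and> Q w = w \<and> R w = 0"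
  by (auto simp: deg_def early_def proj_def)

text \<open>Appending \<open>y\<close> preserves the conditions \<open>Q w = w\<close> and
  \<open>R w = 0\<close>. The sign is minus one to the word length, so it cancels the sign of the
  last face, and the two copies of \<open>snoc y (bd w)\<close> cancel each other.\<close>

lemma null_homotopic_deg_snoc:
  assumes y: "y \<in> X" and m: "\<And>k w. w \<in> wchains X k \<Longrightarrow> R w = 0 \<Longrightarrow> M a c d y w = frag_cmul m w"
  shows "frag_complex.null_homotopic (subcpx (spindle_cpx X star a c d) deg) deg m"
  unfolding frag_complex.null_homotopic_def[OF frag_complex_deg]
proof (intro exI[of _ "\<lambda>n w. frag_cmul ((-1) ^ Suc n) (snoc y w)"] allI conjI ballI)
  show "additive (\<lambda>w. frag_cmul ((-1) ^ Suc n) (snoc y w))" for n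
    by (simp add: additive_def frag_cmul_distrib2)
  fix n w assume w: "w \<in> deg n"
  have "frag_cmul ((-1) ^ Suc n) (snoc y w) \<in> deg (Suc n) \<and>
    bdy a c d (frag_cmul ((-1) ^ Suc n) (snoc y w)) +
      (if n = 0 then 0 else frag_cmul ((-1) ^ n) (snoc y (acd_boundary star a c d n w))) = frag_cmul m w"
  proof (cases n)
    case 0
    then have "w = 0" using w deg_0 by simp
    then show ?thesis using 0 by (simp add: deg_Suc)
  next
    case (Suc k)
    then have w': "w \<in> wchains X (Suc (Suc k))" "Q w = w" "R w = 0"
      using w deg_Suc by auto
    then show ?thesis
      using Suc y by (simp add: deg_Suc snoc_wchains Q_snoc[OF w'(1)] R_snoc acd_bd bd_snoc[OF w'(1)] m frag_cmul_distrib2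
          flip: frag_cmul_distrib add.assoc)
  qed
  moreover from this have "frag_cmul ((-1) ^ Suc n) (snoc y w) \<in> wchains X (Suc (Suc n))"
    by (simp only: deg_Suc)
  ultimately show "frag_cmul ((-1) ^ Suc n) (snoc y w) \<in> deg (Suc n)"
    "bdry (subcpx (spindle_cpx X star a c d) deg) (Suc n) (frag_cmul ((-1) ^ Suc n) (snoc y w)) +
      (if n = 0 then 0 else frag_cmul ((-1) ^ Suc (n - 1)) (snoc y (bdry (subcpx (spindle_cpx X star a c d) deg) n w)))
      = frag_cmul m w"
    by (simp_all only: complex_simps acd_bd) (cases n; simp)
qed

lemma null_homotopic_deg_s0:
  "frag_complex.null_homotopic (subcpx (spindle_cpx X star a c d) deg) deg (a + c + d)"
  unfolding frag_complex.null_homotopic_def[OF frag_complex_deg]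
proof (intro exI[of _ "\<lambda>n. s0"] allI conjI ballI)
  show "additive s0"
    by (simp add: s0_eq additive_frag_map)
  fix n w assume w: "w \<in> deg n"
  have "s0 w \<in> deg (Suc n) \<and>
    bdy a c d (s0 w) + (if n = 0 then 0 else s0 (acd_boundary star a c d n w)) = frag_cmul (a + c + d) w"
  proof (cases n)
    case 0
    then have "w = 0" using w deg_0 by simp
    then show ?thesis using 0 by (simp add: deg_Suc s0_eq)
  next
    case (Suc k)
    then have w': "w \<in> wchains X (Suc (Suc k))" "Q w = w" "R w = 0"
      using w deg_Suc by auto
    have "s0 (0 :: 'a list \<Rightarrow>\<^sub>0 int) = 0" by (simp add: s0_eq)
    then show ?thesis
      using Suc w' s0_wchains[OF w'(1)] Q_s0[OF w'(1)] R_s0[OF w'(1)] bd_s0[OF w'(1,2), of a c d]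
      by (simp add: deg_Suc acd_bd)
  qed
  moreover from this have "s0 w \<in> wchains X (Suc (Suc n))"
    by (simp only: deg_Suc)
  ultimately show "s0 w \<in> deg (Suc n)"
    "bdry (subcpx (spindle_cpx X star a c d) deg) (Suc n) (s0 w) +
      (if n = 0 then 0 else s0 (bdry (subcpx (spindle_cpx X star a c d) deg) n w)) = frag_cmul (a + c + d) w"
    by (auto simp: acd_bd split: if_splits)
qed

lemma nondeg_Suc: "w \<in> nondeg (Suc n) \<longleftrightarrow> w \<in> wchains X (Suc (Suc n)) \<and> Q w = 0 \<and> R w = 0"
  by (auto simp: nondeg_def red_def proj_def)

lemma nondeg_0: "w \<in> nondeg 0 \<longleftrightarrow> w \<in> wchains X (Suc 0) \<and> R w = 0"
  by (auto simp: nondeg_def red_def proj_def)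

text \<open>Appending a letter to a one-letter word may leave the kernel of \<open>Q\<close>, whence
  the correction by \<open>Q (snoc y w)\<close>. It matters in degree \<open>0\<close> only, where
  its boundary is zero by \<open>bd_Q1\<close>; from degree \<open>1\<close> on,
  \<open>Q (snoc y w) = snoc y (Q w) = 0\<close>.\<close>

lemma null_homotopic_nondeg:
  assumes y: "y \<in> X" and m: "\<And>k w. w \<in> wchains X k \<Longrightarrow> R w = 0 \<Longrightarrow> M a c d y w = frag_cmul m w"
  shows "frag_complex.null_homotopic (subcpx (spindle_cpx X star a c d) nondeg) nondeg m"
  unfolding frag_complex.null_homotopic_def[OF frag_complex_nondeg]
proof (intro exI[of _ "\<lambda>n w. frag_cmul ((-1) ^ Suc n) (snoc y w - Q (snoc y w))"] allI conjI ballI)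
  show "additive (\<lambda>w. frag_cmul ((-1) ^ Suc n) (snoc y w - Q (snoc y w)))" for n
    by (simp add: additive_def algebra_simps flip: frag_cmul_distrib2)
  fix n w assume w: "w \<in> nondeg n"
  then have w': "w \<in> wchains X (Suc n)" "R w = 0"
    by (auto simp: nondeg_def red_def)
  have sw: "snoc y w \<in> wchains X (Suc (Suc n))"
    using snoc_wchains[OF w'(1) y] .
  show in_n: "frag_cmul ((-1) ^ Suc n) (snoc y w - Q (snoc y w)) \<in> nondeg (Suc n)"
    using sw Q_wchains[OF sw] Q_Q[OF sw] R_Q[OF sw] w'(2) R_snoc[of y w]
    unfolding nondeg_Suc by (simp only: wchains_closed frag_map_simps) simp
  have "bdy a c d (frag_cmul ((-1) ^ Suc n) (snoc y w - Q (snoc y w))) +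
      (if n = 0 then 0 else frag_cmul ((-1) ^ n)
        (snoc y (acd_boundary star a c d n w) - Q (snoc y (acd_boundary star a c d n w)))) = frag_cmul m w"
  proof (cases n)
    case 0
    then show ?thesis
      using sw w' by (simp add: bd_Q1 bd_snoc[OF w'(1)] bd_reduced1 m)
  next
    case (Suc k)
    then have Qw: "Q w = 0" "w \<in> wchains X (Suc (Suc k))"
      using w nondeg_Suc by auto
    have "bdy a c d (snoc y w - Q (snoc y w)) = bdy a c d (snoc y w) - Q (bdy a c d (snoc y w))"
      using sw Suc by (simp only: bd_simps bd_Q)
    also have "bdy a c d (snoc y w) = snoc y (bdy a c d w) + frag_cmul ((-1) ^ Suc n) (M a c d y w)"
      by (rule bd_snoc[OF w'(1)])
    also have "Q \<dots> = Q (snoc y (bdy a c d w))"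
      using Q_top_face[OF Qw(2), of a c d y] Qw(1) by (simp only: frag_map_simps) simp
    finally have "bdy a c d (snoc y w - Q (snoc y w)) = (snoc y (bdy a c d w) - Q (snoc y (bdy a c d w)))
      + frag_cmul ((-1) ^ Suc n) (frag_cmul m w)"
      using m[OF w'] by (simp only: algebra_simps)
    moreover have "acd_boundary star a c d n w = bdy a c d w"
      using acd_bd Suc w'(1) by simp
    ultimately show ?thesis
      using Suc by (simp only: bd_simps frag_cmul_distrib2)
        (simp flip: frag_cmul_distrib add.assoc)
  qed
  then show "bdry (subcpx (spindle_cpx X star a c d) nondeg) (Suc n)
        (frag_cmul ((-1) ^ Suc n) (snoc y w - Q (snoc y w))) +
      (if n = 0 then 0 else frag_cmul ((-1) ^ Suc (n - 1))
        (snoc y (bdry (subcpx (spindle_cpx X star a c d) nondeg) n w) -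
         Q (snoc y (bdry (subcpx (spindle_cpx X star a c d) nondeg) n w)))) = frag_cmul m w"
    using in_n acd_bd[of "frag_cmul ((-1) ^ Suc n) (snoc y w - Q (snoc y w))" n a c d] unfolding nondeg_Suc
    by (simp only: complex_simps) (cases n; simp)
qed

text \<open>Dividing the parameters by their gcd gives another boundary of the same kind, which
  again preserves \<open>deg\<close>.\<close>

lemma divisible_deg:
  assumes "w \<in> deg (Suc n)"
  shows "\<exists>v\<in>deg n. acd_boundary star a c d (Suc n) w = frag_cmul (gcd a (gcd c d)) v"
proof -
  let ?g = "gcd a (gcd c d)"
  obtain a' c' d' where "a = ?g * a'" "c = ?g * c'" "d = ?g * d'"
    by (metis dvdE gcd_dvd1 gcd_dvd2 dvd_trans)
  then have "bdy a c d w = frag_cmul ?g (bdy a' c' d' w)"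
    using bd_cmul[of ?g a' c' d' w] by metis
  then show ?thesis
    using bd_deg[OF assms, of a' c' d'] assms by (auto simp: acd_bd deg_Suc)
qed

lemma divisible_nondeg:
  assumes "w \<in> nondeg (Suc n)"
  shows "\<exists>v\<in>nondeg n. acd_boundary star a c d (Suc n) w = frag_cmul (gcd a c) v"
proof -
  let ?g = "gcd a c"
  obtain a' c' where ac: "a = ?g * a'" "c = ?g * c'"
    by (metis dvdE gcd_dvd1 gcd_dvd2)
  have w: "w \<in> wchains X (Suc (Suc n))" "Q w = 0"
    using assms nondeg_Suc by auto
  \<comment> \<open>The \<open>d\<close>-part of a boundary is fixed by \<open>Q\<close>; but
    \<open>Q\<close> commutes with it and kills \<open>w\<close>, so it is also mapped to
    zero.\<close>
  have "bdy 0 0 d w = 0"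
  proof (cases n)
    case 0
    then show ?thesis using w bd_tilde1 by simp
  next
    case (Suc k)
    then show ?thesis
      using w Q_bd_tilde[of w k d] bd_Q[of w k 0 0 d] by simp
  qed
  then have "bdy a c d w = bdy a c 0 w"
    using bd_split[of a c d w] by simp
  also have "\<dots> = frag_cmul ?g (bdy a' c' 0 w)"
    using bd_cmul[of ?g a' c' 0 w] ac by simp
  finally show ?thesis
    using bd_nondeg[OF assms, of a' c' 0] w by (auto simp: acd_bd)
qed

section \<open>Ranks of the chain groups\<close>

lemma card_pos: "finite X \<Longrightarrow> 0 < card X"
  using star_facts(3) card_gt_0_iff by blast

lemma point_rank: "frag_group (point_chains e n) \<cong> ivec 1"
  using chains_rank[of "{e}" n] by (simp add: chains_eq point_chains_def)

text \<open>Deleting the first letter inverts \<open>s0\<close>, so \<open>F^0\<close> in degree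
  \<open>n + 1\<close> is a copy of the chains of degree \<open>n\<close>.\<close>

lemma early_rank:
  assumes "finite X"
  shows "frag_group (early (Suc n)) \<cong> ivec (card X ^ Suc n)"
proof -
  have "group_isomorphisms (frag_group (early (Suc n))) (chains X n) (frag_map tl) s0"
    unfolding group_isomorphisms_def
  proof (intro conjI ballI)
    have tl: "frag_map tl w \<in> wchains X (Suc n)" if "w \<in> wchains X (Suc (Suc n))" for w
      using that by (rule frag_map_wchains) (auto simp: length_Suc_conv)
    then show "frag_map tl \<in> hom (frag_group (early (Suc n))) (chains X n)"
      by (auto simp: hom_def chains_eq early_def)
    show "s0 \<in> hom (chains X n) (frag_group (early (Suc n)))"
      using s0_wchains Q_s0 by (auto simp: hom_def chains_eq early_def proj_def s0_eq)
    show "s0 (frag_map tl w) = w" if "w \<in> carrier (frag_group (early (Suc n)))" for w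
      using that Q_eq_s0[of w] by (simp add: early_def proj_def)
    show "frag_map tl (s0 w) = w" for w :: "'a list \<Rightarrow>\<^sub>0 int"
      by (simp add: s0_eq frag_map_frag_map comp_def frag_map_id)
  qed
  then have "frag_group (early (Suc n)) \<cong> chains X n"
    using group_isomorphisms_imp_iso is_isoI by blast
  then show ?thesis
    using chains_rank[OF assms] iso_trans by blast
qed

text \<open>In positive degree the constant word is early degenerate, so \<open>R\<close> retracts
  \<open>early\<close> onto a group of rank one.\<close>

lemma deg_rank:
  assumes "finite X"
  shows "frag_group (deg n) \<cong> ivec (if n = 0 then 0 else card X ^ n - 1)"
proof (cases n)
  case 0
  have "group_isomorphisms (frag_group (deg 0)) (ivec 0) (\<lambda>_ _. 0) (\<lambda>_. 0)"
    by (auto simp: group_isomorphisms_def hom_def deg_0)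
  then have "frag_group (deg 0) \<cong> ivec 0"
    by (rule is_isoI[OF group_isomorphisms_imp_iso])
  then show ?thesis
    using 0 by simp
next
  case (Suc k)
  have "frag_group {w \<in> early (Suc k). R w = 0} \<cong> ivec (card X ^ Suc k - 1)"
  proof (rule rank_kernel_projection[OF subgroups(4,2) early_rank[OF assms] point_rank additive_frag_map])
    show "R w \<in> point_chains e (Suc k)" if "w \<in> early (Suc k)" for w
      using that R_wchains by (auto simp: point_chains_eq early_def)
    show "w \<in> early (Suc k) \<and> R w = w" if "w \<in> point_chains e (Suc k)" for w
      using that Q_R[of w k] by (auto simp: point_chains_eq early_def proj_def)
  qed
  then show ?thesis
    using Suc by (simp add: deg_def)
qed

text \<open>In degree \<open>0\<close> the only condition is \<open>R w = 0\<close>, which costs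
  one. In positive degree it follows from \<open>Q w = 0\<close> because
  \<open>R w = R (Q w)\<close>, and the loss is the rank of \<open>early\<close>.\<close>

lemma nondeg_rank:
  assumes "finite X"
  shows "frag_group (nondeg n) \<cong> ivec (card X ^ Suc n - (if n = 0 then 1 else card X ^ n))"
proof (cases n)
  case 0
  have "frag_group {w \<in> wchains X (Suc 0). R w = 0} \<cong> ivec (card X ^ Suc 0 - 1)"
  proof (rule rank_kernel_projection[OF subgroups(1) subgroups(2)[of 0] _ point_rank additive_frag_map])
    show "frag_group (wchains X (Suc 0)) \<cong> ivec (card X ^ Suc 0)"
      using chains_rank[OF assms, of 0] by (simp add: chains_eq)
  qed (use R_wchains in \<open>auto simp: point_chains_eq\<close>)
  moreover have "nondeg n = {w \<in> wchains X (Suc 0). R w = 0}"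
    using 0 nondeg_0 by blast
  ultimately show ?thesis
    using 0 by simp
next
  case (Suc k)
  have "frag_group {w \<in> wchains X (Suc n). Q w = 0} \<cong> ivec (card X ^ Suc n - card X ^ Suc k)"
  proof (rule rank_kernel_projection[OF subgroups(1,4) _ early_rank[OF assms] additive_frag_map])
    show "frag_group (wchains X (Suc n)) \<cong> ivec (card X ^ Suc n)"
      using chains_rank[OF assms, of n] by (simp add: chains_eq)
  qed (use Suc Q_wchains Q_Q in \<open>auto simp: early_def proj_def\<close>)
  moreover have "R w = 0" if "w \<in> wchains X (Suc n)" "Q w = 0" for w
    using R_Q[of w k] that Suc by simp
  then have "nondeg n = {w \<in> wchains X (Suc n). Q w = 0}"
    using Suc nondeg_Suc by blast
  ultimately show ?thesis
    using Suc by simp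
qed

section \<open>Homology of the degenerate and of the normalized part\<close>

lemma homology_F0_red:
  assumes X: "finite X" and nz: "a \<noteq> 0 \<or> c \<noteq> 0 \<or> d \<noteq> 0"
  shows "homology (F0_red_cpx X star a c d e) n \<cong>
    cyclic_power (gcd a (gcd c d)) (if even n then u_seq X n - 1 else u_seq X n)"
proof -
  let ?C = "subcpx (spindle_cpx X star a c d) deg"
  interpret D: frag_complex ?C deg
    by (rule frag_complex_deg)
  have a: "D.null_homotopic a"
    by (rule null_homotopic_deg_snoc[of z]) (simp_all add: top_face_projector)
  have ac: "D.null_homotopic (a + c)"
    by (rule null_homotopic_deg_snoc[of e]) (simp_all add: top_face_unit)
  have "D.null_homotopic c" "D.null_homotopic d"
    using D.null_homotopic_add[OF ac a, of 1 "- 1"]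
      D.null_homotopic_add[OF null_homotopic_deg_s0 ac, of 1 "- 1"] by simp_all
  then have null: "D.null_homotopic (gcd a (gcd c d))"
    using D.null_homotopic_gcd a by blast
  obtain b where b: "b 0 = 0" "\<And>n. b (Suc n) + b n = card X ^ Suc n - 1"
    "\<And>n. homology ?C n \<cong> cyclic_power (gcd a (gcd c d)) (int (b n))"
  proof (rule D.homology_torsion[OF null])
    show "\<exists>v\<in>deg n. bdry ?C (Suc n) w = frag_cmul (gcd a (gcd c d)) v" if "w \<in> deg (Suc n)" for n w
      using divisible_deg[OF that, of a c d] by simp
    show "gcd a (gcd c d) \<noteq> 0"
      using nz by auto
    show "grp ?C n \<cong> ivec (if n = 0 then 0 else card X ^ n - 1)" for n
      using deg_rank[OF X, of n] by simp
  qed auto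
  \<comment> \<open>As \<open>u_(n+1) + u_n = \<bar>X\<bar>^(n+1)\<close>, the recursion for
    \<open>b\<close> differs by \<open>-1\<close>. One of two consecutive degrees is even, and that
    one absorbs it; \<open>b 0 = 0\<close> fixes the parity.\<close>
  have b_n: "int (b n) = (if even n then u_seq X n - 1 else u_seq X n)"
  proof (induction n)
    case 0
    then show ?case by (simp add: b u_seq_def)
  next
    case (Suc n)
    have "0 < card X ^ Suc n" using card_pos[OF X] by simp
    then have "int (b (Suc n)) + int (b n) = int (card X) ^ Suc n - 1"
      using b(2)[of n] by (simp add: of_nat_diff flip: of_nat_add of_nat_power of_nat_mult)
    with Suc show ?case
      by (auto simp: u_seq_Suc split: if_splits)
  qed
  have "homology (F0_red_cpx X star a c d e) n \<cong> homology ?C n"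
    using homology_isomorphic[OF summand_complexes(1) D.complex isomorphic_cpx_sym[OF D.complex summand_complexes(3)]] .
  then show ?thesis
    by (rule iso_trans[OF _ b(3)[of n, unfolded b_n]])
qed

lemma homology_eN_red:
  assumes X: "finite X" and nz: "a \<noteq> 0 \<or> c \<noteq> 0"
  shows "homology (eN_red_cpx X star a c d e) n \<cong>
    cyclic_power (gcd a c) (u_seq X (n + 1) - u_seq X n + (-1) ^ n)"
proof -
  let ?C = "subcpx (spindle_cpx X star a c d) nondeg"
  interpret D: frag_complex ?C nondeg
    by (rule frag_complex_nondeg)
  have a: "D.null_homotopic a"
    by (rule null_homotopic_nondeg[of z]) (simp_all add: top_face_projector)
  have ac: "D.null_homotopic (a + c)"
    by (rule null_homotopic_nondeg[of e]) (simp_all add: top_face_unit)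
  have "D.null_homotopic c"
    using D.null_homotopic_add[OF ac a, of 1 "- 1"] by simp
  then have null: "D.null_homotopic (gcd a c)"
    using D.null_homotopic_gcd a by blast
  obtain b where b: "b 0 = card X - 1" "\<And>n. b (Suc n) + b n = card X ^ Suc (Suc n) - card X ^ Suc n"
    "\<And>n. homology ?C n \<cong> cyclic_power (gcd a c) (int (b n))"
  proof (rule D.homology_torsion[OF null])
    show "\<exists>v\<in>nondeg n. bdry ?C (Suc n) w = frag_cmul (gcd a c) v" if "w \<in> nondeg (Suc n)" for n w
      using divisible_nondeg[OF that, of a c d] by simp
    show "gcd a c \<noteq> 0"
      using nz by auto
    show "grp ?C n \<cong> ivec (card X ^ Suc n - (if n = 0 then 1 else card X ^ n))" for n
      using nondeg_rank[OF X, of n] by simp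
  qed auto
  \<comment> \<open>\<open>u_(n+1) - u_n\<close> obeys the recursion of \<open>b\<close> but starts
    at \<open>\<bar>X\<bar> - 2\<close>. The alternating sign, which solves the homogeneous
    recursion, corrects the initial value to \<open>\<bar>X\<bar> - 1\<close>.\<close>
  have b_n: "int (b n) = u_seq X (n + 1) - u_seq X n + (-1) ^ n"
  proof (induction n)
    case 0
    have "int (card X - 1) = int (card X) - 1"
      using card_pos[OF X] by simp
    then show ?case by (simp add: b u_seq_def)
  next
    case (Suc n)
    have "card X ^ Suc n \<le> card X ^ Suc (Suc n)" using card_pos[OF X] by simp
    then have "int (b (Suc n)) + int (b n) = int (card X) ^ Suc (Suc n) - int (card X) ^ Suc n"
      using b(2)[of n] by (metis of_nat_add of_nat_diff of_nat_power)
    with Suc show ?case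
      using u_seq_Suc[of X "Suc n"] u_seq_Suc[of X n] by simp
  qed
  have "homology (eN_red_cpx X star a c d e) n \<cong> homology ?C n"
    using homology_isomorphic[OF summand_complexes(2) D.complex isomorphic_cpx_sym[OF D.complex summand_complexes(4)]] .
  then show ?thesis
    by (rule iso_trans[OF _ b(3)[of n, unfolded b_n]])
qed

section \<open>Homology of the point\<close>

lemma bd_constant_word:
  "bdy a c d (frag_of (replicate (Suc n) e)) =
     frag_cmul (if even n then a + c + d else 0) (frag_of (replicate n e))"
proof (induction n)
  case 0
  then show ?case by (simp add: bd_word1)
next
  case (Suc n)
  have r: "replicate (Suc k) e = replicate k e @ [e]" for k
    by (simp add: replicate_append_same)
  have "M a c d e (frag_of (replicate (Suc n) e)) = frag_cmul (a + c + d) (frag_of (replicate (Suc n) e))"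
    by (simp add: top_face_def frag_cmul_distrib map_replicate_const)
  then show ?case
    unfolding r[of "Suc n"] bd_snoc_word Suc.IH
    by (cases "even n") (simp_all add: replicate_append_same algebra_simps flip: frag_cmul_distrib)
qed

lemma point_chain_eq:
  assumes "w \<in> point_chains e n"
  shows "w = frag_cmul (Poly_Mapping.lookup w (replicate (Suc n) e)) (frag_of (replicate (Suc n) e))"
proof -
  have w: "w \<in> wchains {e} (Suc n)"
    using assms by (simp add: point_chains_def chains_eq)
  define x where "x = replicate (Suc n) e"
  have x: "xs = x" if "length xs = Suc n" "set xs \<subseteq> {e}" for xs
    using that unfolding x_def by (intro replicate_eqI) auto
  have "w = frag_cmul (Poly_Mapping.lookup w x) (frag_of x)"
  proof (rule wchains_eqI[OF w, where f = "\<lambda>w. w" and g = "\<lambda>w. frag_cmul (Poly_Mapping.lookup w x) (frag_of x)"])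
    show "frag_of xs = frag_cmul (Poly_Mapping.lookup (frag_of xs) x) (frag_of x)"
      if "length xs = Suc n" "set xs \<subseteq> {e}" for xs
      using x[OF that] by simp
  qed (simp_all add: additive_def lookup_add frag_cmul_distrib)
  then show ?thesis
    unfolding x_def .
qed

text \<open>Here \<open>n\<close> is the degree of the target and the word has \<open>n + 2\<close>
  letters. Its faces all agree up to sign, so they cancel in pairs unless their number is
  odd.\<close>

lemma point_boundary:
  assumes "w \<in> point_chains e (Suc n)"
  shows "acd_boundary star a c d (Suc n) w =
    frag_cmul (Poly_Mapping.lookup w (replicate (Suc (Suc n)) e) * (if odd n then a + c + d else 0))
      (frag_of (replicate (Suc n) e))"
proof -
  have "acd_boundary star a c d (Suc n) w = bdy a c d w"
    using assms by (simp add: acd_bd point_chains_eq)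
  also have "\<dots> = frag_cmul (Poly_Mapping.lookup w (replicate (Suc (Suc n)) e))
      (bdy a c d (frag_of (replicate (Suc (Suc n)) e)))"
    using point_chain_eq[OF assms] by (metis bd_simps(4))
  finally show ?thesis
    unfolding bd_constant_word by simp
qed

lemma point_word: "frag_cmul k (frag_of (replicate (Suc n) e)) \<in> point_chains e n"
  by (simp add: point_chains_eq map_replicate_const del: replicate.simps)

lemma cycles_point:
  "cycles (point_cpx X star a c d e) n =
     (if n = 0 \<or> odd n \<or> a + c + d = 0 then point_chains e n else {0})"
proof (cases n)
  case 0
  then show ?thesis by (simp add: cycles_def point_cpx_def)
next
  case (Suc k)
  have "cycles (point_cpx X star a c d e) n = {w \<in> point_chains e n. acd_boundary star a c d n w = 0}"
    using Suc by (auto simp: cycles_def point_cpx_def kernel_def)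
  moreover have "acd_boundary star a c d n w = 0 \<longleftrightarrow>
      even k \<or> a + c + d = 0 \<or> w = 0" if w: "w \<in> point_chains e n" for w
  proof -
    have "w = 0 \<longleftrightarrow> Poly_Mapping.lookup w (replicate (Suc n) e) = 0"
      using point_chain_eq[OF w] by (metis frag_cmul_eq_0_iff lookup_zero)
    then show ?thesis
      using point_boundary[of w k a c d] w Suc by auto
  qed
  moreover have "0 \<in> point_chains e n"
    by (simp add: point_chains_eq)
  ultimately show ?thesis
    using Suc by auto
qed

lemma boundaries_point:
  "boundaries (point_cpx X star a c d e) n =
     {w \<in> point_chains e n. (if odd n then a + c + d else 0) dvd Poly_Mapping.lookup w (replicate (Suc n) e)}"
    (is "_ = {w \<in> _. ?m dvd _}")
proof -
  let ?x = "\<lambda>n. replicate (Suc n) e"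
  have "boundaries (point_cpx X star a c d e) n = acd_boundary star a c d (Suc n) ` point_chains e (Suc n)"
    by (simp add: boundaries_def point_cpx_def)
  also have "\<dots> = {w \<in> point_chains e n. ?m dvd Poly_Mapping.lookup w (?x n)}"
  proof (intro equalityI subsetI)
    fix v assume "v \<in> acd_boundary star a c d (Suc n) ` point_chains e (Suc n)"
    then obtain k where "v = frag_cmul (k * ?m) (frag_of (?x n))"
      using point_boundary by blast
    then show "v \<in> {w \<in> point_chains e n. ?m dvd Poly_Mapping.lookup w (?x n)}"
      using point_word by (simp del: replicate.simps)
  next
    fix v assume "v \<in> {w \<in> point_chains e n. ?m dvd Poly_Mapping.lookup w (?x n)}"
    then obtain k where k: "v = frag_cmul (k * ?m) (frag_of (?x n))"
      using point_chain_eq[of v n] by (metis (no_types, lifting) dvdE mem_Collect_eq mult.commute)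
    then have "v = acd_boundary star a c d (Suc n) (frag_cmul k (frag_of (?x (Suc n))))"
      using point_boundary[OF point_word[of k "Suc n"], of a c d] by (simp del: replicate.simps)
    then show "v \<in> acd_boundary star a c d (Suc n) ` point_chains e (Suc n)"
      using point_word by blast
  qed
  finally show ?thesis .
qed

text \<open>The hypothesis singles out the degrees in which every chain is a cycle. The class is
  then the single coefficient modulo the incoming factor, and a factor \<open>0\<close> means no
  reduction.\<close>

lemma homology_point:
  assumes "n = 0 \<or> odd n \<or> a + c + d = 0"
  shows "homology (point_cpx X star a c d e) n \<cong> cyclic (if odd n then a + c + d else 0)"
proof -
  let ?m = "if odd n then a + c + d else 0" and ?x = "replicate (Suc n) e"
  let ?C = "point_cpx X star a c d e"
  have cyc: "cycles ?C n = point_chains e n"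
    using assms cycles_point by simp
  show ?thesis
  proof (rule homology_iso_via_hom[OF chain_complex_point, where h = "\<lambda>w. Poly_Mapping.lookup w ?x mod \<bar>?m\<bar>"])
    show "group (cyclic ?m)"
      by (simp add: cyclic_def)
    show "(\<lambda>w. Poly_Mapping.lookup w ?x mod \<bar>?m\<bar>) \<in> hom ((grp ?C n)\<lparr>carrier := cycles ?C n\<rparr>) (cyclic ?m)"
      by (rule homI) (simp_all add: cyclic_def carrier_integer_mod_group point_cpx_def lookup_add mod_add_eq)
    show "\<exists>w\<in>cycles ?C n. Poly_Mapping.lookup w ?x mod \<bar>?m\<bar> = y" if "y \<in> carrier (cyclic ?m)" for y
      unfolding cyc using that
      by (intro bexI[OF _ point_word[of y n]])
        (auto simp: cyclic_def carrier_integer_mod_group split: if_splits simp del: replicate.simps)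
    show "Poly_Mapping.lookup w ?x mod \<bar>?m\<bar> = \<one>\<^bsub>cyclic ?m\<^esub> \<longleftrightarrow> w \<in> boundaries ?C n" if "w \<in> cycles ?C n" for w
    proof -
      have "Poly_Mapping.lookup w ?x mod \<bar>?m\<bar> = 0 \<longleftrightarrow> ?m dvd Poly_Mapping.lookup w ?x"
        by (simp only: mod_eq_0_iff_dvd abs_dvd_iff)
      then show ?thesis
        using that unfolding cyc boundaries_point by (simp add: cyclic_def)
    qed
  qed
qed

lemma homology_point_trivial:
  assumes "n > 0" "even n" "a + c + d \<noteq> 0"
  shows "trivial_group (homology (point_cpx X star a c d e) n)"
proof -
  let ?C = "point_cpx X star a c d e"
  have cyc: "cycles ?C n = {0}"
    using assms cycles_point by simp
  have "0 \<in> boundaries ?C n"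
    unfolding boundaries_point by (simp add: point_chains_eq)
  then have "carrier (homology ?C n) = {\<one>\<^bsub>homology ?C n\<^esub>}"
    using coset_in_homology(2)[OF chain_complex_point, of a c d n]
      coset_in_homology(3)[OF chain_complex_point, of 0 a c d n] unfolding cyc by simp
  then show ?thesis
    using homology_comm_group[OF chain_complex_point] by (simp add: trivial_group_def comm_group.axioms)
qed

section \<open>Assembly of the homology of the whole complex\<close>

lemma homology_spindle:
  "homology (spindle_cpx X star a c d) n \<cong>
     homology (point_cpx X star a c d e) n \<times>\<times>
       (homology (F0_red_cpx X star a c d e) n \<times>\<times> homology (eN_red_cpx X star a c d e) n)"
proof -
  let ?P = "point_cpx X star a c d e" and ?F = "F0_red_cpx X star a c d e" and ?N = "eN_red_cpx X star a c d e"
  note cc = chain_complex_point summand_complexes(1,2)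
  have FN: "chain_complex (dsumcpx ?F ?N)"
    using chain_complex_dsumcpx[OF cc(2,3)] .
  have "homology (spindle_cpx X star a c d) n \<cong> homology (dsumcpx ?P (dsumcpx ?F ?N)) n"
    using homology_isomorphic[OF chain_complex_spindle chain_complex_dsumcpx[OF cc(1) FN] splitting] .
  also have "\<dots> \<cong> homology ?P n \<times>\<times> homology (dsumcpx ?F ?N) n"
    using homology_dsumcpx[OF cc(1) FN] .
  also have "\<dots> \<cong> homology ?P n \<times>\<times> (homology ?F n \<times>\<times> homology ?N n)"
    using homology_dsumcpx[OF cc(2,3)] homology_comm_group[OF cc(1)] homology_comm_group[OF FN]
    by (intro DirProd_iso_cong iso_refl comm_group.axioms)
  finally show ?thesis .
qed

end

lemma cyclic_0: "cyclic 0 = integer_group"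
  by (simp add: cyclic_def integer_mod_group_def)

lemma group_cyclic_power: "group (cyclic_power m k)" and group_cyclic: "group (cyclic m)"
  by (simp_all add: cyclic_power_def cyclic_def)

lemma trivial_DirProd_iso:
  assumes "trivial_group G" "group H"
  shows "G \<times>\<times> H \<cong> H"
proof (rule is_isoI, rule group_isomorphisms_imp_iso)
  interpret H: group H by fact
  have "group G" "carrier G = {\<one>\<^bsub>G\<^esub>}"
    using assms by (auto simp: trivial_group_def)
  then show "group_isomorphisms (G \<times>\<times> H) H snd (\<lambda>h. (\<one>\<^bsub>G\<^esub>, h))"
    by (auto simp: group_isomorphisms_def hom_def group.is_monoid)
qed

lemma trivial_cyclic_power_0: "trivial_group (cyclic_power m 0)"
  by (simp add: cyclic_power_def trivial_product_group)

theorem theorem9p2: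
  fixes X :: "'a set" and star :: "'a \<Rightarrow> 'a \<Rightarrow> 'a" and one_r zero_r :: 'a and a c d :: int
  assumes "spindle X star"
    and "right_unit X star one_r"
    and "right_projector X star zero_r"
  shows
    \<comment> \<open>(1)\<close>
    "(chain_complex (spindle_cpx X star a c d) \<and>
      chain_complex (point_cpx X star a c d one_r) \<and>
      chain_complex (F0_red_cpx X star a c d one_r) \<and>
      chain_complex (eN_red_cpx X star a c d one_r) \<and>
      isomorphic_cpx (spindle_cpx X star a c d)
        (dsumcpx (point_cpx X star a c d one_r)
          (dsumcpx (F0_red_cpx X star a c d one_r) (eN_red_cpx X star a c d one_r)))) \<and>
     \<comment> \<open>(2)\<close>
     (a + c + d \<noteq> 0 \<longrightarrow>
        homology (point_cpx X star a c d one_r) 0 \<cong> integer_group \<and>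
        (\<forall>n>0. even n \<longrightarrow> trivial_group (homology (point_cpx X star a c d one_r) n)) \<and>
        (\<forall>n. odd n \<longrightarrow> homology (point_cpx X star a c d one_r) n \<cong> cyclic (a + c + d))) \<and>
     (a + c + d = 0 \<longrightarrow>
        (\<forall>n. homology (point_cpx X star a c d one_r) n \<cong> integer_group)) \<and>
     \<comment> \<open>(3)\<close>
     (finite X \<and> (a \<noteq> 0 \<or> c \<noteq> 0 \<or> d \<noteq> 0) \<longrightarrow>
        (\<forall>n. homology (F0_red_cpx X star a c d one_r) n \<cong>
               cyclic_power (gcd a (gcd c d)) (if even n then u_seq X n - 1 else u_seq X n))) \<and>
     \<comment> \<open>(4)\<close>
     (finite X \<and> (a \<noteq> 0 \<or> c \<noteq> 0) \<longrightarrow>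
        (\<forall>n. homology (eN_red_cpx X star a c d one_r) n \<cong>
               cyclic_power (gcd a c) (u_seq X (n + 1) - u_seq X n + (-1) ^ n))) \<and>
     \<comment> \<open>(5)\<close>
     (finite X \<and> (a \<noteq> 0 \<or> c \<noteq> 0) \<and> a + c + d \<noteq> 0 \<longrightarrow>
        homology (spindle_cpx X star a c d) 0 \<cong>
          integer_group \<times>\<times> cyclic_power (gcd a c) (int (card X) - 1) \<and>
        (\<forall>n>0. even n \<longrightarrow>
           homology (spindle_cpx X star a c d) n \<cong>
             cyclic_power (gcd a c) (u_seq X (n + 1) - u_seq X n + 1) \<times>\<times>
             cyclic_power (gcd a (gcd c d)) (u_seq X n - 1)) \<and>
        (\<forall>n. odd n \<longrightarrow>
           homology (spindle_cpx X star a c d) n \<cong>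
             cyclic (a + c + d) \<times>\<times>
             cyclic_power (gcd a c) (u_seq X (n + 1) - u_seq X n - 1) \<times>\<times>
             cyclic_power (gcd a (gcd c d)) (u_seq X n)))"
proof -
  interpret pointed_spindle X star one_r zero_r
    using assms by unfold_locales
  let ?P = "point_cpx X star a c d one_r" and ?F = "F0_red_cpx X star a c d one_r"
    and ?N = "eN_red_cpx X star a c d one_r"
  note H = homology_F0_red[of a c d] homology_eN_red[of a c d]
  note gP = comm_group.axioms(2)[OF homology_comm_group[OF chain_complex_point]]
    and gF = comm_group.axioms(2)[OF homology_comm_group[OF summand_complexes(1)]]
    and gN = comm_group.axioms(2)[OF homology_comm_group[OF summand_complexes(2)]]
  \<comment> \<open>The splitting lists the degenerate part first, the final formulas list the
    normalized part first.\<close>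
  have swap: "homology ?F n \<times>\<times> homology ?N n \<cong> N \<times>\<times> F"
    if "homology ?F n \<cong> F" "homology ?N n \<cong> N" for n and F N :: "(nat \<Rightarrow> int) monoid"
    using iso_trans[OF DirProd_commute_iso DirProd_iso_cong[OF gN gF that(2,1)]] .
  have H5: "homology (spindle_cpx X star a c d) n \<cong> homology ?P n \<times>\<times>
      (cyclic_power (gcd a c) (u_seq X (n + 1) - u_seq X n + (-1) ^ n) \<times>\<times>
       cyclic_power (gcd a (gcd c d)) (if even n then u_seq X n - 1 else u_seq X n))"
    if "finite X" "a \<noteq> 0 \<or> c \<noteq> 0" for n
    using iso_trans[OF homology_spindle DirProd_iso_cong[OF gP DirProd_group[OF gF gN] iso_refl swap[OF H]]] that
    by blast
  have p0: "homology ?P 0 \<cong> integer_group"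
    using homology_point[of 0 a c d] cyclic_0 by simp
  have podd: "homology ?P n \<cong> cyclic (a + c + d)" if "odd n" for n
    using homology_point[of n a c d] that by simp
  have pzero: "homology ?P n \<cong> integer_group" if "a + c + d = 0" for n
  proof -
    have "(if odd n then a + c + d else 0) = 0"
      using that by simp
    then show ?thesis
      using homology_point[of n a c d] that cyclic_0 by metis
  qed
  have r0: "homology (spindle_cpx X star a c d) 0 \<cong>
      integer_group \<times>\<times> cyclic_power (gcd a c) (int (card X) - 1)" if "finite X" "a \<noteq> 0 \<or> c \<noteq> 0"
  proof -
    \<comment> \<open>For \<open>n = 0\<close> the exponents are
      \<open>u_1 - u_0 + 1 = \<bar>X\<bar> - 1\<close> and \<open>u_0 - 1 = 0\<close>, so the second
      factor disappears.\<close>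
    let ?A = "cyclic_power (gcd a c) (int (card X) - 1)" and ?B = "cyclic_power (gcd a (gcd c d)) 0"
    have "homology (spindle_cpx X star a c d) 0 \<cong> homology ?P 0 \<times>\<times> (?A \<times>\<times> ?B)"
      using H5[OF that, of 0] by (simp add: u_seq_def)
    moreover have "?A \<times>\<times> ?B \<cong> ?A"
      using iso_trans[OF DirProd_commute_iso trivial_DirProd_iso[OF trivial_cyclic_power_0 group_cyclic_power]] .
    ultimately show ?thesis
      using iso_trans DirProd_iso_cong[OF gP DirProd_group[OF group_cyclic_power group_cyclic_power] p0] by blast
  qed
  have reven: "homology (spindle_cpx X star a c d) n \<cong>
      cyclic_power (gcd a c) (u_seq X (n + 1) - u_seq X n + 1) \<times>\<times> cyclic_power (gcd a (gcd c d)) (u_seq X n - 1)"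
    if "finite X" "a \<noteq> 0 \<or> c \<noteq> 0" "a + c + d \<noteq> 0" "n > 0" "even n" for n
    using iso_trans[OF H5[OF that(1,2), of n] trivial_DirProd_iso[OF homology_point_trivial[OF that(4,5,3)]
        DirProd_group[OF group_cyclic_power group_cyclic_power]]] that(5) by simp
  have rodd: "homology (spindle_cpx X star a c d) n \<cong> cyclic (a + c + d) \<times>\<times>
      cyclic_power (gcd a c) (u_seq X (n + 1) - u_seq X n - 1) \<times>\<times> cyclic_power (gcd a (gcd c d)) (u_seq X n)"
    if "finite X" "a \<noteq> 0 \<or> c \<noteq> 0" "odd n" for n
    using iso_trans[OF H5[OF that(1,2), of n] DirProd_iso_cong[OF gP
        DirProd_group[OF group_cyclic_power group_cyclic_power] podd[OF that(3)] iso_refl]] that(3) by simp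
  show ?thesis
    by (intro conjI impI allI chain_complex_spindle chain_complex_point summand_complexes(1,2) splitting
        p0 podd pzero homology_point_trivial H r0 reven rodd; blast)
qed

end
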